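(* Let $0<R<1$, $\Delta_V<\Delta_C$ positive integers with $\Delta_V/\Delta_C=1-R$, $A>2(1+R)$, $B>2(1+R)/(1-R)$, $1\le\alpha<A$, $\frac1{1-R}<\beta<\min\{\frac2{1-R},B\}$, and fix \[ \epsilon=\frac{1-R}{A+1-R},\qquad\vartheta=\frac{1}{B(1-R)+1}. \] Suppose $\Delta_V$ satisfies the degree condition $(\star)$ below and that for each $n$ the graph $\mathcal G=\mathcal G^{(n)}$ is $(\alpha,A,\beta,B,\epsilon,\vartheta)$-good. Let \[ \lambda>\max\Big\{\frac1R,\ \frac1{1-R},\ \frac{2}{A-2(1+R)},\ \frac{2}{B(1-R)-2(1+R)},\ 2\Big(1-\frac{1}{AB-1}-\frac1A\Big)^{-1}\Big\}, \] and let $\Lambda$ be randomly chosen from the $(\mathcal G,\lambda)$ LDA ensemble. Then the probability that $\Lambda$ is good for MSE quantization tends to $1$ as $n\to\infty$.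
   Context: $\mathcal G$ is a $(\Delta_V,\Delta_C)$-regular bipartite graph with $n$ variable nodes and $n(1-R)$ check nodes; $N(S)$ denotes neighbourhood. It is $(\alpha,A,\beta,B,\epsilon,\vartheta)$-good if: (L1) variable-node sets $S$ with $|S|\le\lceil\epsilon n\rceil$ have $|N(S)|\ge A|S|$; (L2) variable-node sets $S$ with $|S|\le\lceil n(1-R)/(2\alpha)\rceil$ have $|N(S)|\ge\alpha|S|$; (R1) check-node sets $T$ with $|T|\le\vartheta n(1-R)$ have $|N(T)|\ge B|T|$; (R2) check-node sets $T$ with $|T|\le n(1-R)/2$ have $|N(T)|\ge\beta|T|$. Degree condition $(\star)$, with $h_2(a)=-a\log_2a-(1-a)\log_2(1-a)$: $\Delta_V>\max\Big\{\frac{h_2(\frac{1-R}{2\alpha})+1-R}{h_2(\frac{1-R}{2\alpha})-\frac12h_2(\frac{1-R}{\alpha})},\ R+2\alpha,\ A+1,\ \frac{h_2(\epsilon)+(1-R)h_2(\frac{A\epsilon}{1-R})}{h_2(\epsilon)-\frac{A\epsilon}{1-R}h_2(\frac{1-R}{A})},\ \frac{1-R+h_2(\frac{\beta(1-R)}{2})}{1-\frac{\beta(1-R)}{2}h_2(\frac{1}{\beta(1-R)})},\ \frac{(2+\beta R)(1-R)}{2-\beta(1-R)},\ (1-R)(B+1),\ \frac{(1-R)h_2(\vartheta)+h_2(B\vartheta(1-R))}{h_2(\vartheta)-B\vartheta(1-R)h_2(\frac{1}{B(1-R)})},\ \frac{(A+1)(1-R)-A\epsilon(2-R)}{1-R-A\epsilon},\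 \frac{B+1-\vartheta B(2-R)}{\frac1{1-R}-\vartheta B}\Big\}$. $(\mathcal G,\lambda)$ LDA ensemble: $p$ is the smallest prime $\ge n^\lambda$; $\widehat H$ is the $n(1-R)\times n$ $0/1$ biadjacency matrix of $\mathcal G$; $H$ has entries $\widehat h_{i,j}h'_{i,j}$ with $h'_{i,j}$ i.i.d. uniform on $\mathbb F_p$; $\Lambda=\{\mathbf x\in\mathbb Z^n:H(\mathbf x\bmod p)=\mathbf 0\text{ over }\mathbb F_p\}$. For a lattice $\Lambda$ with fundamental Voronoi region $\mathcal V(\Lambda)$ of volume $\mathrm{vol}(\Lambda)$, $G(\Lambda)=\frac{1}{n\,\mathrm{vol}(\Lambda)^{1+2/n}}\int_{\mathcal V(\Lambda)}\|\mathbf y\|^2d\mathbf y$; a sequence $\{\Lambda^{(n)}\}$ is good for MSE quantization if $G(\Lambda^{(n)})\to\frac1{2\pi e}$. *)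

theory Defs
  imports "HOL-Probability.Probability" "HOL-Computational_Algebra.Primes"
begin

definition h2 :: "real \<Rightarrow> real" where
  "h2 a = - a * log 2 a - (1 - a) * log 2 (1 - a)"

text \<open>A bipartite graph with n variable nodes 0..<n and m check nodes 0..<m is given by its
  0/1 biadjacency matrix H (H i j: check i adjacent to variable j).\<close>

definition nbhd_var :: "nat \<Rightarrow> (nat \<Rightarrow> nat \<Rightarrow> bool) \<Rightarrow> nat set \<Rightarrow> nat set" where
  "nbhd_var m H S = {i. i < m \<and> (\<exists>j\<in>S. H i j)}"

definition nbhd_chk :: "nat \<Rightarrow> (nat \<Rightarrow> nat \<Rightarrow> bool) \<Rightarrow> nat set \<Rightarrow> nat set" where
  "nbhd_chk n H T = {j. j < n \<and> (\<exists>i\<in>T. H i j)}"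

definition biregular :: "nat \<Rightarrow> nat \<Rightarrow> (nat \<Rightarrow> nat \<Rightarrow> bool) \<Rightarrow> nat \<Rightarrow> nat \<Rightarrow> bool" where
  "biregular n m H dV dC \<longleftrightarrow>
     (\<forall>j<n. card {i. i < m \<and> H i j} = dV) \<and> (\<forall>i<m. card {j. j < n \<and> H i j} = dC)"

text \<open>(alpha,A,beta,B,epsilon,theta)-good; here m = n(1-R).\<close>
definition good_graph :: "nat \<Rightarrow> nat \<Rightarrow> (nat \<Rightarrow> nat \<Rightarrow> bool) \<Rightarrow>
    real \<Rightarrow> real \<Rightarrow> real \<Rightarrow> real \<Rightarrow> real \<Rightarrow> real \<Rightarrow> bool" where
  "good_graph n m H \<alpha> A \<beta> B \<epsilon> \<theta> \<longleftrightarrow>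
     (\<forall>S \<subseteq> {..<n}. real (card S) \<le> of_int \<lceil>\<epsilon> * real n\<rceil> \<longrightarrow>
         real (card (nbhd_var m H S)) \<ge> A * real (card S)) \<and>
     (\<forall>S \<subseteq> {..<n}. real (card S) \<le> of_int \<lceil>real m / (2 * \<alpha>)\<rceil> \<longrightarrow>
         real (card (nbhd_var m H S)) \<ge> \<alpha> * real (card S)) \<and>
     (\<forall>T \<subseteq> {..<m}. real (card T) \<le> \<theta> * real m \<longrightarrow>
         real (card (nbhd_chk n H T)) \<ge> B * real (card T)) \<and>
     (\<forall>T \<subseteq> {..<m}. real (card T) \<le> real m / 2 \<longrightarrow>
         real (card (nbhd_chk n H T)) \<ge> \<beta> * real (card T))"

definition degree_condition :: "nat \<Rightarrow> real \<Rightarrow> real \<Rightarrow> real \<Rightarrow> real \<Rightarrow> real \<Rightarrow> real \<Rightarrow> real \<Rightarrow> bool" where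
  "degree_condition dV R \<alpha> A \<beta> B \<epsilon> \<theta> \<longleftrightarrow>
     (\<forall>x \<in> set
       [ (h2 ((1 - R) / (2 * \<alpha>)) + 1 - R) / (h2 ((1 - R) / (2 * \<alpha>)) - h2 ((1 - R) / \<alpha>) / 2),
         R + 2 * \<alpha>,
         A + 1,
         (h2 \<epsilon> + (1 - R) * h2 (A * \<epsilon> / (1 - R))) /
            (h2 \<epsilon> - A * \<epsilon> / (1 - R) * h2 ((1 - R) / A)),
         (1 - R + h2 (\<beta> * (1 - R) / 2)) / (1 - \<beta> * (1 - R) / 2 * h2 (1 / (\<beta> * (1 - R)))),
         (2 + \<beta> * R) * (1 - R) / (2 - \<beta> * (1 - R)),
         (1 - R) * (B + 1),
         ((1 - R) * h2 \<theta> + h2 (B * \<theta> * (1 - R))) /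
            (h2 \<theta> - B * \<theta> * (1 - R) * h2 (1 / (B * (1 - R)))),
         ((A + 1) * (1 - R) - A * \<epsilon> * (2 - R)) / (1 - R - A * \<epsilon>),
         (B + 1 - \<theta> * B * (2 - R)) / (1 / (1 - R) - \<theta> * B) ].
       x < real dV)"

definition lda_prime :: "nat \<Rightarrow> real \<Rightarrow> nat" where
  "lda_prime n lam = (LEAST q. prime q \<and> real n powr lam \<le> real q)"

text \<open>Random coefficients h'(i,j), i<m, j<n, each uniform in F_p = {0..<p}.\<close>
definition lda_coeffs :: "nat \<Rightarrow> nat \<Rightarrow> nat \<Rightarrow> (nat \<times> nat \<Rightarrow> nat) set" where
  "lda_coeffs n m p = PiE ({..<m} \<times> {..<n}) (%_. {..<p})"

definition lda_lattice :: "nat \<Rightarrow> nat \<Rightarrow> nat \<Rightarrow> (nat \<Rightarrow> nat \<Rightarrow> bool) \<Rightarrow> (nat \<times> nat \<Rightarrow> nat)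
    \<Rightarrow> (nat \<Rightarrow> real) set" where
  "lda_lattice n m p Hh h =
     {x \<in> PiE {..<n} (%_. \<int>).
        \<forall>i<m. (\<Sum>j<n. (if Hh i j then int (h (i, j)) else 0) * (\<lfloor>x j\<rfloor> mod int p)) mod int p = 0}"

definition leb_n :: "nat \<Rightarrow> (nat \<Rightarrow> real) measure" where
  "leb_n n = PiM {..<n} (%_. lborel)"

definition sqnorm :: "nat \<Rightarrow> (nat \<Rightarrow> real) \<Rightarrow> real" where
  "sqnorm n y = (\<Sum>j<n. (y j)\<^sup>2)"

definition voronoi :: "nat \<Rightarrow> (nat \<Rightarrow> real) set \<Rightarrow> (nat \<Rightarrow> real) set" where
  "voronoi n L = {y \<in> PiE {..<n} (%_. UNIV). \<forall>x\<in>L. sqnorm n y \<le> sqnorm n (%j. y j - x j)}"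

definition lattice_vol :: "nat \<Rightarrow> (nat \<Rightarrow> real) set \<Rightarrow> real" where
  "lattice_vol n L = measure (leb_n n) (voronoi n L)"

definition nsm :: "nat \<Rightarrow> (nat \<Rightarrow> real) set \<Rightarrow> real" where
  "nsm n L = (set_lebesgue_integral (leb_n n) (voronoi n L) (sqnorm n)) /
              (real n * lattice_vol n L powr (1 + 2 / real n))"

end

theory Submission
  imports Defs "HOL-Real_Asymp.Real_Asymp"
begin

text \<open>
  The lower bound \<open>G \<ge> 1/(2\<pi>e)\<close> holds for every lattice, by Jensen's
  inequality for \<open>exp (- t \<parallel>y\<parallel>\<^sup>2)\<close> on the Voronoi cell. For the upper bound, \<open>G\<close> is, up to
  scaling, the mean over the cube \<open>[0,p)\<^sup>n\<close> of the squared distance to \<open>\<Lambda>\<close>, so \<open>\<Lambda>\<close> has to cover all but a fraction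
  \<open>o(p\<^sup>-\<^sup>2\<^sup>R)\<close> of the integer points \<open>u\<close> of the cube within the right radius. Weight the integer
  vectors \<open>z\<close> by a discrete Gaussian restricted to a thin spherical shell and let \<open>X(u)\<close> be the weight
  of the \<open>z\<close> with \<open>u + z \<in> \<Lambda>\<close>. Averaging over \<open>u\<close>, the second moment of \<open>X\<close> only involves the
  events \<open>z - z' \<in> \<Lambda>\<close>; their probability over the random coefficients is \<open>p\<close> to the minus number of
  checks touching the support of \<open>z - z'\<close>, so the excess of the second moment over the squared first
  one comes from the pairs for which some check is untouched. The expansion properties (R1), (R2)
  make these pairs rare when few checks are untouched, and (L1), (L2) when many are. Cauchy-Schwarz
  bounds the uncovered fraction by the excess, and Markov's inequality makes it small.
\<close>

section \<open>A prime in every long interval\<close>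

text \<open>Gaussian weights are chosen because they factor over coordinates: agreement of two
  vectors on a set of coordinates costs a product of one-dimensional collision rates, each of order
  p^(-(1-R)). A set X of untouched checks gains p^|X| and forces agreement on all its neighbours, so
  (R1) wins once B (1-R) > 1 + 3R: 2R comes from the required uncovered fraction, a further R from n
  <= p^R, which is what lambda > 1/R provides. The shell is two-sided: its outer radius controls the
  covering, its inner radius the largest weight. At the critical scale p^m times the largest weight
  over the total mass is about 1. The scale is enlarged by e^\<delta>, the thickness of the shell
  uses up e^(\<delta>/2), and the remaining e^(-\<delta> n/2) beats every power of p because p is
  polynomial in n; this is the purpose of the section on primes. One expectation over the
  coefficients suffices: the excess is nonnegative for every choice of them, so Markov applies to it
  directly, and since it also bounds the size of the code, rank-deficient matrices need no separate
  treatment.\<close>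

lemma card_multiples:
  fixes d n :: nat
  assumes "d > 0"
  shows "card {k\<in>{1..n}. d dvd k} = n div d"
proof -
  have "{k\<in>{1..n}. d dvd k} = (\<lambda>k. d * k) ` {1..n div d}"
  proof (intro equalityI subsetI)
    fix k assume "k \<in> {k\<in>{1..n}. d dvd k}"
    then obtain j where j: "k = d * j" "1 \<le> d * j" "d * j \<le> n" by (auto elim!: dvdE)
    from j(2) have "1 \<le> j" by (cases j) auto
    moreover have "j \<le> n div d" using j(3) assms by (simp add: less_eq_div_iff_mult_less_eq mult.commute)
    ultimately show "k \<in> (\<lambda>k. d * k) ` {1..n div d}" using j(1) by auto
  next
    fix k assume "k \<in> (\<lambda>k. d * k) ` {1..n div d}"
    then show "k \<in> {k\<in>{1..n}. d dvd k}"
      using assms by (auto simp: less_eq_div_iff_mult_less_eq mult.commute)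
  qed
  then show ?thesis using assms by (simp add: card_image inj_on_def)
qed

text \<open>The cut-off \<open>M\<close> may be any number from k on, since i < q^i; one cut-off
  common to all k up to n is what lets the two sums in Legendre's formula be exchanged.\<close>

lemma multiplicity_eq_card_powers:
  fixes q k M :: nat
  assumes "prime q" "0 < k" "k \<le> M"
  shows "multiplicity q k = card {i\<in>{1..M}. q ^ i dvd k}"
proof -
  have "{i\<in>{1..M}. q ^ i dvd k} = {1..multiplicity q k}"
  proof -
    have "i \<le> M" if "q ^ i dvd k" for i
    proof -
      have "i < q ^ i" using prime_gt_1_nat[OF assms(1)] by (intro power_gt_expt) auto
      also have "\<dots> \<le> k" using that assms(2) by (rule dvd_imp_le)
      finally show ?thesis using assms(3) by simp
    qed
    moreover have "q ^ i dvd k \<longleftrightarrow> i \<le> multiplicity q k" for i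
      using assms by (intro power_dvd_iff_le_multiplicity) (auto simp: prime_gt_1_nat[THEN less_imp_neq])
    ultimately show ?thesis by auto
  qed
  then show ?thesis by simp
qed

text \<open>Legendre's formula; terms with q^i > n vanish, so the cut-off \<open>M\<close> does not
  affect the sum.\<close>

lemma multiplicity_fact_eq:
  fixes q n M :: nat
  assumes "prime q" "n \<le> M"
  shows "multiplicity q (fact n) = (\<Sum>i=1..M. n div q ^ i)"
proof -
  have "multiplicity q (fact n) = (\<Sum>k=1..n. multiplicity q k)"
    unfolding fact_prod of_nat_id using assms
    by (subst prime_elem_multiplicity_prod_distrib) auto
  also have "\<dots> = (\<Sum>k=1..n. \<Sum>i=1..M. if q ^ i dvd k then 1 else 0)"
    using assms by (intro sum.cong refl)
      (subst multiplicity_eq_card_powers[where M=M], auto simp: sum.If_cases Int_def)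
  also have "\<dots> = (\<Sum>i=1..M. \<Sum>k=1..n. if q ^ i dvd k then 1 else 0)"
    by (rule sum.swap)
  also have "\<dots> = (\<Sum>i=1..M. card {k\<in>{1..n}. q ^ i dvd k})"
    by (intro sum.cong refl) (simp add: sum.If_cases Int_def)
  also have "\<dots> = (\<Sum>i=1..M. n div q ^ i)"
    using assms by (intro sum.cong refl card_multiples) (simp add: prime_gt_0_nat)
  finally show ?thesis .
qed

text \<open>By Legendre's formula a power q^i adds at most 1 to the multiplicity of q in the central
  binomial coefficient, and only if q^i <= 2N; so the multiplicity is at most the largest such
  i.\<close>

lemma prime_power_central_binomial_le:
  fixes q N :: nat
  assumes q: "prime q" and N: "0 < N"
  shows "q ^ multiplicity q ((2 * N) choose N) \<le> 2 * N"
proof -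
  let ?M = "2 * N"
  let ?J = "{i\<in>{1..?M}. q ^ i \<le> ?M}"
  have "fact ?M = fact N * (fact N * ((2 * N) choose N) :: nat)"
    using binomial_fact_lemma[of N "2 * N"] by simp
  then have "multiplicity q (fact ?M) = 2 * multiplicity q (fact N) + multiplicity q ((2 * N) choose N)"
    using q by (simp add: prime_elem_multiplicity_mult_distrib)
  then have "multiplicity q ((2 * N) choose N) + (\<Sum>i=1..?M. 2 * (N div q ^ i)) = (\<Sum>i=1..?M. ?M div q ^ i)"
    using multiplicity_fact_eq[OF q, of ?M ?M] multiplicity_fact_eq[OF q, of N ?M]
    by (simp add: sum_distrib_left)
  also have "\<dots> \<le> (\<Sum>i=1..?M. 2 * (N div q ^ i) + (if q ^ i \<le> ?M then 1 else 0))"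
  proof (rule sum_mono)
    fix i assume "i \<in> {1..?M}"
    let ?d = "q ^ i"
    have d: "?d > 0" using q prime_gt_0_nat by simp
    have "?M div ?d \<le> 2 * (N div ?d) + 1"
    proof -
      have "N < (N div ?d + 1) * ?d" using d by (simp add: dividend_less_div_times add.commute)
      then have "?M < (2 * (N div ?d) + 2) * ?d" by (simp add: algebra_simps)
      then have "?M div ?d < 2 * (N div ?d) + 2" by (rule less_mult_imp_div_less)
      then show ?thesis by simp
    qed
    then show "?M div ?d \<le> 2 * (N div ?d) + (if ?d \<le> ?M then 1 else 0)" by auto
  qed
  also have "\<dots> = (\<Sum>i=1..?M. 2 * (N div q ^ i)) + card ?J"
    by (simp add: sum.distrib sum.If_cases Int_def)
  finally have le: "multiplicity q ((2 * N) choose N) \<le> card ?J" by simp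
  have "q ^ card ?J \<le> ?M"
  proof (cases "?J = {}")
    case False
    have fin: "finite ?J" by simp
    define k where "k = Max ?J"
    have "k \<in> ?J" unfolding k_def using fin False by (rule Max_in)
    have "?J \<subseteq> {1..k}" using Max_ge[OF fin] by (auto simp: k_def)
    then have "card ?J \<le> k" using card_mono[of "{1..k}" ?J] by simp
    then have "q ^ card ?J \<le> q ^ k" using prime_ge_1_nat[OF q] by (rule power_increasing)
    also have "\<dots> \<le> ?M" using \<open>k \<in> ?J\<close> by simp
    finally show ?thesis .
  next
    case True
    then have c: "card ?J = 0" by (metis card.empty)
    show ?thesis unfolding c using N by simp
  qed
  moreover have "q ^ multiplicity q ((2 * N) choose N) \<le> q ^ card ?J"
    using le prime_ge_1_nat[OF q] by (rule power_increasing)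
  ultimately show ?thesis by linarith
qed

text \<open>A weak form of Bertrand's postulate: were there no such prime, the central binomial
  coefficient of \<open>2x\<^sup>2\<close> would have fewer than \<open>x\<close> prime factors, each contributing a
  prime power at most \<open>2x\<^sup>2\<close>.\<close>
lemma exists_prime_between:
  fixes x :: nat
  assumes x: "x \<ge> 7"
  shows "\<exists>q. prime q \<and> x \<le> q \<and> q \<le> 2 * x\<^sup>2"
proof (rule ccontr)
  assume none: "\<nexists>q. prime q \<and> x \<le> q \<and> q \<le> 2 * x\<^sup>2"
  define N where "N = x\<^sup>2"
  define b where "b = (2 * N) choose N"
  have N: "N > 0" using x by (simp add: N_def)
  have b0: "b > 0" by (simp add: b_def)
  \<comment> \<open>Prime factors of \<open>b\<close> divide (2N)!, hence are at most 2N = 2x^2; the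
    assumed gap pushes them below x.\<close>
  have sub: "prime_factors b \<subseteq> {1..<x}"
  proof
    fix q assume q: "q \<in> prime_factors b"
    then have pq: "prime q" and "q dvd b" by (auto simp: in_prime_factors_iff)
    have "b dvd fact (2 * N)"
      unfolding b_def using binomial_fact_lemma[of N "2 * N"] by (metis dvd_triv_right le_add1 mult_2)
    then have "q dvd fact (2 * N)" using \<open>q dvd b\<close> dvd_trans by blast
    then have "q \<le> 2 * N" using pq prime_dvd_fact_iff by blast
    then have "q < x" using none pq unfolding N_def by (meson not_le)
    then show "q \<in> {1..<x}" using pq prime_ge_1_nat by auto
  qed
  have "b = (\<Prod>q\<in>prime_factors b. q ^ multiplicity q b)"
    using b0 by (simp add: prime_factorization_nat)
  also have "\<dots> \<le> (\<Prod>q\<in>prime_factors b. 2 * N)"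
    by (intro prod_mono) (auto simp: b_def in_prime_factors_iff intro: prime_power_central_binomial_le[OF _ N])
  also have "\<dots> = (2 * N) ^ card (prime_factors b)" by simp
  also have "\<dots> \<le> (2 * N) ^ x"
    using card_mono[OF _ sub] N x by (intro power_increasing) auto
  finally have up: "b \<le> (2 * N) ^ x" .
  have "4 ^ N / (2 * real N) \<le> real b"
    unfolding b_def using N by (rule central_binomial_lower_bound)
  moreover have "(2::real) ^ N \<le> 4 ^ N / (2 * real N)"
  proof -
    have *: "2 * real N \<le> 2 ^ N" if "N \<ge> 3" for N :: nat
      using that by (induction N rule: dec_induct) auto
    have "N \<ge> 3" unfolding N_def using x power_mono[of 7 x 2] by simp
    then have "2 * real N * 2 ^ N \<le> 2 ^ N * 2 ^ N" by (intro mult_right_mono *) auto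
    also have "\<dots> = 4 ^ N" by (simp flip: power_mult_distrib)
    finally show ?thesis using N by (simp add: field_simps)
  qed
  ultimately have "2 ^ N \<le> real b" by linarith
  also have "\<dots> \<le> (2 * real N) ^ x" using up by (metis of_nat_le_iff of_nat_mult of_nat_numeral of_nat_power)
  \<comment> \<open>With N = x^2 both sides are x-th powers; taking roots leaves 2^x <= 2x^2, which
    fails from x = 7 on.\<close>
  finally have "(2 ^ x) ^ x \<le> (2 * real N) ^ x" by (simp add: N_def power2_eq_square flip: power_mult)
  then have "2 ^ x \<le> 2 * real N" using power_mono_iff[of "2 ^ x" "2 * real N" x] x by simp
  moreover have "2 * (real x)\<^sup>2 < 2 ^ x"
    using x
  proof (induction x rule: dec_induct)
    case (step k)
    then have "2 * (real (Suc k))\<^sup>2 \<le> 2 * (2 * (real k)\<^sup>2)"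
    proof -
      have "2 * k + 1 \<le> k * k" using step(1) mult_le_mono1[of 7 k k] by linarith
      then have "real (2 * k + 1) \<le> real (k * k)" by (simp only: of_nat_le_iff)
      then show ?thesis by (simp add: power2_eq_square algebra_simps)
    qed
    also have "\<dots> < 2 * 2 ^ k" using step.IH by simp
    finally show ?case by simp
  qed simp
  ultimately show False by (simp add: N_def)
qed

section \<open>Gaussian sums over the integers\<close>

text \<open>A theta sum cut off at \<open>L\<close>, so that all later sums over integer vectors are
  finite; the cut-off is fixed only where a lower bound on the mass is wanted.\<close>

definition gauss_sum :: "nat \<Rightarrow> real \<Rightarrow> real" where
  "gauss_sum L \<tau> = (\<Sum>a\<in>{- int L..int L}. exp (- \<tau> * (real_of_int a)\<^sup>2))"

lemma gauss_sum_eq: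
  "gauss_sum L \<tau> = 1 + 2 * (\<Sum>k<L. exp (- \<tau> * (real (Suc k))\<^sup>2))"
proof (induction L)
  case (Suc L)
  have "{- int (Suc L)..int (Suc L)} = insert (- int (Suc L)) (insert (int (Suc L)) {- int L..int L})"
    by auto
  then have "gauss_sum (Suc L) \<tau> = 2 * exp (- \<tau> * (real (Suc L))\<^sup>2) + gauss_sum L \<tau>"
    unfolding gauss_sum_def by (simp add: power2_eq_square algebra_simps)
  then show ?case using Suc by simp
qed (simp add: gauss_sum_def)

lemma half_gaussian_integral:
  fixes \<tau> :: real
  assumes "\<tau> > 0"
  shows "has_bochner_integral lborel (\<lambda>x. indicator {0..} x *\<^sub>R exp (- \<tau> * x\<^sup>2)) (sqrt (pi / \<tau>) / 2)"
proof -
  have "has_bochner_integral lborel (\<lambda>x. indicator {0..} (0 + sqrt \<tau> * x) *\<^sub>R exp (- (0 + sqrt \<tau> * x)\<^sup>2))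
     ((sqrt pi / 2) /\<^sub>R \<bar>sqrt \<tau>\<bar>)"
    using gaussian_moment_0 assms by (subst lborel_has_bochner_integral_real_affine_iff[symmetric]) auto
  also have "(\<lambda>x. indicator {0..} (0 + sqrt \<tau> * x) *\<^sub>R exp (- (0 + sqrt \<tau> * x)\<^sup>2))
      = (\<lambda>x. indicator {0..} x *\<^sub>R exp (- \<tau> * x\<^sup>2))"
    using assms by (auto simp: indicator_def zero_le_mult_iff power_mult_distrib)
  also have "(sqrt pi / 2) /\<^sub>R \<bar>sqrt \<tau>\<bar> = sqrt (pi / \<tau>) / 2"
    using assms by (simp add: real_sqrt_divide field_simps)
  finally show ?thesis .
qed

lemma gaussian_integral:
  fixes \<tau> :: real
  assumes "\<tau> > 0"
  shows "has_bochner_integral lborel (\<lambda>x. exp (- \<tau> * x\<^sup>2)) (sqrt (pi / \<tau>))"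
proof -
  have "has_bochner_integral lborel
      (\<lambda>x. indicator {0..} (0 + (-1) * x) *\<^sub>R exp (- \<tau> * (0 + (-1) * x)\<^sup>2)) ((sqrt (pi / \<tau>) / 2) /\<^sub>R \<bar>-1\<bar>)"
    using half_gaussian_integral[OF assms]
    by (subst lborel_has_bochner_integral_real_affine_iff[symmetric]) auto
  then have neg: "has_bochner_integral lborel (\<lambda>x. indicator {..0} x *\<^sub>R exp (- \<tau> * x\<^sup>2)) (sqrt (pi / \<tau>) / 2)"
    by (simp add: indicator_def)
  have "has_bochner_integral lborel (\<lambda>x. indicator {0..} x *\<^sub>R exp (- \<tau> * x\<^sup>2) + indicator {..0} x *\<^sub>R exp (- \<tau> * x\<^sup>2))
     (sqrt (pi / \<tau>) / 2 + sqrt (pi / \<tau>) / 2)"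
    by (intro has_bochner_integral_add half_gaussian_integral assms neg)
  moreover have "AE x in lborel. x \<noteq> (0::real)" by (rule AE_lborel_singleton)
  then have "AE x in lborel. indicator {0..} x *\<^sub>R exp (- \<tau> * x\<^sup>2) + indicator {..0} x *\<^sub>R exp (- \<tau> * x\<^sup>2) = exp (- \<tau> * x\<^sup>2)"
    by eventually_elim (auto simp: indicator_def)
  ultimately show ?thesis
    by (subst (asm) has_bochner_integral_cong_AE) (auto simp: indicator_def)
qed

text \<open>The Gaussian decreases on x >= 0, so sums compare with integrals over unit intervals.
  The upper bound holds for every cut-off. The lower one loses 1 because the term at 0 occurs once
  instead of twice, and 1 to the cut-off.\<close>

lemma gauss_sum_bounds:
  fixes \<tau> :: real
  assumes "\<tau> > 0"
  shows "gauss_sum L \<tau> \<le> sqrt (pi / \<tau>) + 1"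
    and "\<exists>L. gauss_sum L \<tau> \<ge> sqrt (pi / \<tau>) - 2"
proof -
  let ?f = "\<lambda>x::real. exp (- \<tau> * x\<^sup>2)"
  define G where "G = (\<lambda>L::nat. LINT x:{0..real L}|lborel. ?f x)"
  have intble: "set_integrable lborel {0..} ?f" and int: "(LINT x:{0..}|lborel. ?f x) = sqrt (pi / \<tau>) / 2"
    using half_gaussian_integral[OF assms]
    by (auto simp: set_integrable_def set_lebesgue_integral_def has_bochner_integral_iff)
  have intb: "set_integrable lborel {real a..real b} ?f" for a b :: nat
    by (rule set_integrable_subset[OF intble]) auto
  have G_le: "G L \<le> sqrt (pi / \<tau>) / 2" for L
    unfolding G_def int[symmetric] set_lebesgue_integral_def
    using intble intb[of 0 L] by (intro integral_mono) (auto simp: set_integrable_def indicator_def)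
  have G_lim: "G \<longlonglongrightarrow> sqrt (pi / \<tau>) / 2"
    unfolding G_def int[symmetric] set_lebesgue_integral_def
  proof (rule integral_dominated_convergence)
    show "integrable lborel (\<lambda>x. indicator {0..} x *\<^sub>R ?f x)" using intble by (simp add: set_integrable_def)
    show "AE x in lborel. (\<lambda>L. indicator {0..real L} x *\<^sub>R ?f x) \<longlonglongrightarrow> indicator {0..} x *\<^sub>R ?f x"
    proof (intro AE_I2 tendsto_eventually)
      fix x :: real
      show "\<forall>\<^sub>F L in sequentially. indicator {0..real L} x *\<^sub>R ?f x = indicator {0..} x *\<^sub>R ?f x"
        using eventually_ge_at_top[of "nat \<lceil>x\<rceil>"]
        by eventually_elim (auto simp: indicator_def)
    qed
  qed (auto simp: indicator_def)
  have step: "?f (real (Suc L)) \<le> G (Suc L) - G L" "G (Suc L) - G L \<le> ?f (real L)" for L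
  proof -
    have U: "{0..real (Suc L)} = {0..real L} \<union> {real L<..real (Suc L)}" by auto
    have "G (Suc L) = G L + (LINT x:{real L<..real (Suc L)}|lborel. ?f x)"
      unfolding G_def U by (rule set_integral_Un) (auto intro: set_integrable_subset[OF intble[simplified]])
    then have eq: "G (Suc L) - G L = (LINT x:{real L<..real (Suc L)}|lborel. ?f x)" by simp
    have c: "set_integrable lborel {real L<..real (Suc L)} (\<lambda>x. c::real)" for c
      unfolding set_integrable_def by (intro integrable_scaleR_left) simp
    have i: "set_integrable lborel {real L<..real (Suc L)} ?f"
      by (rule set_integrable_subset[OF intble]) auto
    have sq: "x\<^sup>2 \<le> (real (Suc L))\<^sup>2" "(real L)\<^sup>2 \<le> x\<^sup>2" if "x \<in> {real L<..real (Suc L)}" for x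
      using that by (auto intro!: power_mono)
    have "(LINT x:{real L<..real (Suc L)}|lborel. ?f (real (Suc L))) \<le> (LINT x:{real L<..real (Suc L)}|lborel. ?f x)"
      using sq assms by (intro set_integral_mono c i) auto
    moreover have "(LINT x:{real L<..real (Suc L)}|lborel. ?f x) \<le> (LINT x:{real L<..real (Suc L)}|lborel. ?f (real L))"
      using sq assms by (intro set_integral_mono c i) auto
    moreover have "(LINT x:{real L<..real (Suc L)}|lborel. c) = c" for c :: real
      by (simp add: set_lebesgue_integral_def)
    ultimately show "?f (real (Suc L)) \<le> G (Suc L) - G L" "G (Suc L) - G L \<le> ?f (real L)"
      unfolding eq by auto
  qed
  have G0: "G 0 = 0"
  proof -
    have "AE x in lborel. x \<noteq> (0::real)" by (rule AE_lborel_singleton)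
    then have "AE x in lborel. indicator {0..real 0} x *\<^sub>R ?f x = 0"
      by eventually_elim auto
    then show ?thesis unfolding G_def set_lebesgue_integral_def by (rule integral_eq_zero_AE)
  qed
  have telescope: "G L = (\<Sum>k<L. G (Suc k) - G k)" for L
    using G0 by (simp add: sum_lessThan_telescope)
  have "(\<Sum>k<L. ?f (real (Suc k))) \<le> G L"
    by (subst telescope) (intro sum_mono step)
  then show "gauss_sum L \<tau> \<le> sqrt (pi / \<tau>) + 1"
    unfolding gauss_sum_eq using G_le[of L] by linarith
  have low: "2 * G L - 1 \<le> gauss_sum L \<tau>" for L
  proof -
    have "G L \<le> (\<Sum>k<L. ?f (real k))"
      by (subst telescope) (intro sum_mono step)
    also have "\<dots> \<le> (\<Sum>k<Suc L. ?f (real k))"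
      by (intro sum_mono2) auto
    also have "\<dots> = 1 + (\<Sum>k<L. ?f (real (Suc k)))" by (subst sum.lessThan_Suc_shift) simp
    finally show ?thesis unfolding gauss_sum_eq by linarith
  qed
  have "\<forall>\<^sub>F L in sequentially. G L > sqrt (pi / \<tau>) / 2 - 1 / 2"
    using G_lim by (rule order_tendstoD) simp
  then obtain L where "G L > sqrt (pi / \<tau>) / 2 - 1 / 2" using eventually_happens by force
  then show "\<exists>L. gauss_sum L \<tau> \<ge> sqrt (pi / \<tau>) - 2"
    using low[of L] by (intro exI[of _ L]) linarith
qed

section \<open>Voronoi cells of periodic lattices\<close>

interpretation lborel_product: product_sigma_finite "\<lambda>_::nat. lborel :: real measure" ..

lemma space_leb_n: "space (leb_n n) = PiE {..<n} (\<lambda>_. UNIV)"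
  by (simp add: leb_n_def space_PiM)

lemma measurable_leb_n_component [measurable]: "j < n \<Longrightarrow> (\<lambda>y. y j) \<in> borel_measurable (leb_n n)"
  unfolding leb_n_def by (simp add: measurable_component_singleton)

lemma sqnorm_nonneg: "0 \<le> sqnorm k y"
  by (simp add: sqnorm_def sum_nonneg)

lemma component_le_sqnorm: "j < k \<Longrightarrow> (y j)\<^sup>2 \<le> sqnorm k y"
  unfolding sqnorm_def by (rule member_le_sum) auto

lemma sqnorm_cong: "(\<And>j. j < k \<Longrightarrow> y j = z j) \<Longrightarrow> sqnorm k y = sqnorm k z"
  by (simp add: sqnorm_def)

lemma sqnorm_measurable [measurable]: "(\<lambda>y. sqnorm n (\<lambda>j. y j - x j)) \<in> borel_measurable (leb_n n)"
  unfolding sqnorm_def by measurable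

lemma sqnorm_measurable' [measurable]: "sqnorm n \<in> borel_measurable (leb_n n)"
  using sqnorm_measurable[of n "\<lambda>_. 0"] by simp

lemma emeasure_leb_n_box:
  "(\<And>j. j < n \<Longrightarrow> A j \<in> sets borel) \<Longrightarrow> emeasure (leb_n n) (PiE {..<n} A) = (\<Prod>j<n. emeasure lborel (A j))"
  unfolding leb_n_def by (subst lborel_product.emeasure_PiM) auto

text \<open>The restriction keeps the result extensional, that is inside the space of
  \<open>leb_n\<close>. The vector is subtracted, so \<open>shift n (\<lambda>j. - x j)\<close> adds
  \<open>x\<close>.\<close>

definition shift :: "nat \<Rightarrow> (nat \<Rightarrow> real) \<Rightarrow> (nat \<Rightarrow> real) \<Rightarrow> nat \<Rightarrow> real" where
  "shift n x y = (\<lambda>j\<in>{..<n}. y j - x j)"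

lemma shift_measurable [measurable]: "shift n x \<in> measurable (leb_n n) (leb_n n)"
proof -
  have "shift n x \<in> measurable (leb_n n) (PiM {..<n} (\<lambda>_. lborel))"
    unfolding shift_def by (rule measurable_restrict) auto
  then show ?thesis by (simp add: leb_n_def)
qed

lemma leb_n_shift_invariant: "distr (leb_n n) (leb_n n) (shift n x) = leb_n n"
proof -
  have "PiM {..<n} (\<lambda>_. lborel) = distr (leb_n n) (leb_n n) (shift n x)"
  proof (rule lborel_product.PiM_eqI[symmetric])
    fix A :: "nat \<Rightarrow> real set" assume A: "\<And>j. j \<in> {..<n} \<Longrightarrow> A j \<in> sets lborel"
    have pre: "(+) (- x j) -` A j \<in> sets borel" if "j < n" for j
    proof -
      have "(+) (- x j) \<in> borel_measurable borel" by measurable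
      from measurable_sets[OF this, of "A j"] A that show ?thesis by auto
    qed
    have "shift n x -` PiE {..<n} A \<inter> space (leb_n n) = PiE {..<n} (\<lambda>j. (+) (- x j) -` A j)"
      by (auto simp: space_leb_n shift_def PiE_iff)
    moreover have "PiE {..<n} A \<in> sets (leb_n n)"
      unfolding leb_n_def by (rule sets_PiM_I_finite) (use A in auto)
    ultimately have "emeasure (distr (leb_n n) (leb_n n) (shift n x)) (PiE {..<n} A)
        = (\<Prod>j<n. emeasure lborel ((+) (- x j) -` A j))"
      using pre by (subst emeasure_distr) (auto simp: emeasure_leb_n_box)
    also have "\<dots> = (\<Prod>j<n. emeasure lborel (A j))"
    proof (intro prod.cong refl)
      fix j assume j: "j \<in> {..<n}"
      have "emeasure lborel (A j) = emeasure (distr lborel borel ((+) (- x j))) (A j)"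
        by (simp add: lborel_distr_plus)
      also have "\<dots> = emeasure lborel ((+) (- x j) -` A j)"
        using A[OF j] by (subst emeasure_distr) auto
      finally show "emeasure lborel ((+) (- x j) -` A j) = emeasure lborel (A j)" by simp
    qed
    finally show "emeasure (distr (leb_n n) (leb_n n) (shift n x)) (PiE {..<n} A)
        = (\<Prod>j\<in>{..<n}. emeasure lborel (A j))" .
  qed (auto simp: leb_n_def)
  then show ?thesis by (simp add: leb_n_def)
qed

lemma nn_integral_shift:
  assumes "f \<in> borel_measurable (leb_n n)"
  shows "(\<integral>\<^sup>+y. f (shift n x y) \<partial>leb_n n) = (\<integral>\<^sup>+y. f y \<partial>leb_n n)"
  using nn_integral_distr[OF shift_measurable, of f n x] assms
  by (simp add: leb_n_shift_invariant)

text \<open>Tonelli in the coordinate i: every line in that direction meets the hyperplane in a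
  single point.\<close>

lemma hyperplane_null:
  fixes a :: "nat \<Rightarrow> real"
  assumes i: "i < n" "a i \<noteq> 0"
  shows "AE y in leb_n n. (\<Sum>j<n. a j * y j) \<noteq> b"
proof -
  let ?I = "{..<n} - {i}"
  let ?H = "{y \<in> space (leb_n n). (\<Sum>j<n. a j * y j) = b}"
  have ins: "insert i ?I = {..<n}" using i by auto
  have PiM_eq: "PiM (insert i ?I) (\<lambda>_. lborel) = leb_n n" unfolding ins by (simp add: leb_n_def)
  have "(\<lambda>y. \<Sum>j<n. a j * y j) \<in> borel_measurable (leb_n n)"
    by (intro borel_measurable_sum borel_measurable_times) auto
  then have H[measurable]: "?H \<in> sets (leb_n n)" by measurable
  have "emeasure (leb_n n) ?H = (\<integral>\<^sup>+y. indicator ?H y \<partial>PiM (insert i ?I) (\<lambda>_. lborel))"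
    unfolding PiM_eq by simp
  also have "\<dots> = (\<integral>\<^sup>+x. \<integral>\<^sup>+t. indicator ?H (x(i := t)) \<partial>lborel \<partial>PiM ?I (\<lambda>_. lborel))"
    using H by (intro lborel_product.product_nn_integral_insert) (simp_all add: PiM_eq del: insert_Diff_single)
  also have "\<dots> \<le> (\<integral>\<^sup>+x. 0 \<partial>PiM ?I (\<lambda>_. lborel :: real measure))"
  proof (rule nn_integral_mono)
    fix x :: "nat \<Rightarrow> real"
    have "(\<integral>\<^sup>+t. indicator ?H (x(i := t)) \<partial>lborel)
        \<le> (\<integral>\<^sup>+t. indicator {(b - (\<Sum>j\<in>?I. a j * x j)) / a i} t \<partial>lborel)"
    proof (rule nn_integral_mono)
      fix t :: real
      have "(\<Sum>j<n. a j * (x(i := t)) j) = a i * t + (\<Sum>j\<in>?I. a j * x j)"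
        using i by (subst sum.remove[of _ i]) (auto intro!: sum.cong)
      then show "(indicator ?H (x(i := t)) :: ennreal) \<le> indicator {(b - (\<Sum>j\<in>?I. a j * x j)) / a i} t"
        using i by (auto simp: indicator_def field_simps)
    qed
    also have "\<dots> = 0" by simp
    finally show "(\<integral>\<^sup>+t. indicator ?H (x(i := t)) \<partial>lborel) \<le> 0" .
  qed
  finally have "emeasure (leb_n n) ?H = 0" by simp
  then have "?H \<in> null_sets (leb_n n)" using H by auto
  then show ?thesis by (rule AE_I'[where N="?H"]) auto
qed

text \<open>The squares of the coordinates of y cancel, so the points equidistant from x and x' form
  a hyperplane with normal 2 (x' - x).\<close>

lemma equidistant_null:
  assumes "x \<in> extensional {..<n}" "x' \<in> extensional {..<n}" "x \<noteq> x'"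
  shows "AE y in leb_n n. sqnorm n (\<lambda>j. y j - x j) \<noteq> sqnorm n (\<lambda>j. y j - x' j)"
proof -
  obtain i where i: "i < n" "x i \<noteq> x' i"
    using assms by (auto simp: extensional_def fun_eq_iff) (metis)
  have "AE y in leb_n n. (\<Sum>j<n. (2 * (x' j - x j)) * y j) \<noteq> (\<Sum>j<n. (x' j)\<^sup>2 - (x j)\<^sup>2)"
    using i by (intro hyperplane_null) auto
  then show ?thesis
  proof eventually_elim
    case (elim y)
    have "sqnorm n (\<lambda>j. y j - x j) - sqnorm n (\<lambda>j. y j - x' j)
        = (\<Sum>j<n. (2 * (x' j - x j)) * y j) - (\<Sum>j<n. (x' j)\<^sup>2 - (x j)\<^sup>2)"
      unfolding sqnorm_def sum_subtractf[symmetric]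
      by (intro sum.cong refl) (simp add: power2_eq_square algebra_simps)
    with elim show ?case by linarith
  qed
qed

text \<open>Construction A in abstract form: \<open>K\<close> is a subgroup of the integer vectors
  that contains all multiples of p. Vectors are total functions, so \<open>periodic\<close> also
  makes \<open>K\<close> blind to coordinates from n on. \<open>C\<close> is the code,
  \<open>L\<close> its lattice.\<close>

locale periodic_lattice =
  fixes n p :: nat and K :: "(nat \<Rightarrow> int) \<Rightarrow> bool"
  assumes n: "0 < n" and p: "0 < p"
    and zero: "K (\<lambda>_. 0)"
    and diff: "K x \<Longrightarrow> K y \<Longrightarrow> K (\<lambda>j. x j - y j)"
    and periodic: "K x \<Longrightarrow> (\<And>j. j < n \<Longrightarrow> x j mod int p = y j mod int p) \<Longrightarrow> K y"
begin

definition U :: "(nat \<Rightarrow> int) set" where "U = PiE {..<n} (\<lambda>_. {0..<int p})"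
definition C :: "(nat \<Rightarrow> int) set" where "C = {u \<in> U. K u}"
definition L :: "(nat \<Rightarrow> real) set" where "L = {x \<in> PiE {..<n} (\<lambda>_. \<int>). K (\<lambda>j. \<lfloor>x j\<rfloor>)}"
abbreviation V :: "(nat \<Rightarrow> real) set" where "V \<equiv> voronoi n L"
definition Q :: "(nat \<Rightarrow> real) set" where "Q = PiE {..<n} (\<lambda>_. {0..<real p})"

lemma finite_U: "finite U" and card_U: "card U = p ^ n"
  unfolding U_def by (auto intro!: finite_PiE simp: card_PiE)

lemma finite_C: "finite C"
  using finite_U by (simp add: C_def)

lemma neg: "K x \<Longrightarrow> K (\<lambda>j. - x j)"
  using diff[OF zero, of x] by simp

lemma add: "K x \<Longrightarrow> K y \<Longrightarrow> K (\<lambda>j. x j + y j)"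
  using diff[of x "\<lambda>j. - y j"] neg[of y] by simp

lemma periodic_iff: "(\<And>j. j < n \<Longrightarrow> x j mod int p = y j mod int p) \<Longrightarrow> K x \<longleftrightarrow> K y"
  using periodic[of x y] periodic[of y x] by auto

lemma card_C_pos: "card C > 0"
proof -
  have "(\<lambda>j\<in>{..<n}. 0) \<in> C"
    unfolding C_def U_def using p by (auto intro: periodic[OF zero])
  then show ?thesis using finite_C by (auto simp: card_gt_0_iff)
qed

text \<open>Adding z and reducing mod p permutes the period \<open>U\<close>. Hence the first moment
  of the covering count over u is known exactly for each individual code.\<close>

lemma card_fiber: "card {u \<in> U. K (\<lambda>j. u j + z j)} = card C"
proof (rule bij_betw_same_card)
  let ?f = "\<lambda>z u. \<lambda>j\<in>{..<n}. (u j + z j) mod int p"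
  have fU: "?f z u \<in> U" for z u using p by (auto simp: U_def)
  have inv: "?f (\<lambda>j. - z j) (?f z u) = u" if "u \<in> U" for u z
  proof
    fix j
    show "?f (\<lambda>j. - z j) (?f z u) j = u j"
    proof (cases "j < n")
      case True
      then have "u j \<in> {0..<int p}" using that PiE_mem[of u "{..<n}" "\<lambda>_. {0..<int p}" j] by (simp add: U_def)
      then have "((u j + z j) mod int p + - z j) mod int p = u j"
        unfolding mod_add_left_eq by simp
      with True show ?thesis by (simp only: restrict_apply' lessThan_iff)
    next
      case False with that show ?thesis
        using PiE_arb[of u "{..<n}" "\<lambda>_. {0..<int p}" j] by (simp add: U_def)
    qed
  qed
  have Kf: "K (?f z u) \<longleftrightarrow> K (\<lambda>j. u j + z j)" for u z
    by (rule periodic_iff) auto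
  show "bij_betw (?f z) {u \<in> U. K (\<lambda>j. u j + z j)} C"
  proof (rule bij_betwI[where g="?f (\<lambda>j. - z j)"])
    show "?f z \<in> {u \<in> U. K (\<lambda>j. u j + z j)} \<rightarrow> C"
      using fU Kf by (auto simp: C_def)
    show "?f (\<lambda>j. - z j) \<in> C \<rightarrow> {u \<in> U. K (\<lambda>j. u j + z j)}"
    proof
      fix c assume c: "c \<in> C"
      have "K (\<lambda>j. ?f (\<lambda>j. - z j) c j + z j) \<longleftrightarrow> K c"
        by (rule periodic_iff) (auto simp: mod_add_left_eq)
      then show "?f (\<lambda>j. - z j) c \<in> {u \<in> U. K (\<lambda>j. u j + z j)}" using c fU[of c "\<lambda>j. - z j"] by (auto simp: C_def)
    qed
    show "?f (\<lambda>j. - z j) (?f z u) = u" if "u \<in> {u \<in> U. K (\<lambda>j. u j + z j)}" for u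
      using that by (intro inv) simp
    show "?f z (?f (\<lambda>j. - z j) c) = c" if "c \<in> C" for c
      using inv[of c "\<lambda>j. - z j"] that by (simp add: C_def)
  qed
qed

lemma countable_L: "countable L"
proof -
  have "countable (PiE {..<n} (\<lambda>_. \<int> :: real set))"
    by (intro countable_PiE) (auto simp: Ints_def)
  then show ?thesis by (rule countable_subset[rotated]) (auto simp: L_def)
qed

lemma L_extensional: "x \<in> L \<Longrightarrow> x \<in> extensional {..<n}"
  by (auto simp: L_def PiE_def)

lemma V_measurable [measurable]: "V \<in> sets (leb_n n)"
proof -
  have "(\<lambda>j\<in>{..<n}. 0) \<in> L"
    using p by (auto simp: L_def intro: periodic[OF zero])
  then have ne: "L \<noteq> {}" by auto
  then have "V = (\<Inter>x\<in>L. {y \<in> space (leb_n n). sqnorm n y \<le> sqnorm n (\<lambda>j. y j - x j)})"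
    by (auto simp: voronoi_def space_leb_n)
  also have "\<dots> \<in> sets (leb_n n)"
    by (rule sets.countable_INT'[OF countable_L ne]) auto
  finally show ?thesis .
qed

lemma Q_measurable [measurable]: "Q \<in> sets (leb_n n)"
  unfolding Q_def leb_n_def by (rule sets_PiM_I_finite) auto

text \<open>Every code word c has exactly one lift in \<open>L\<close> that carries y into the cube,
  namely c minus p times the floor of (y + c)/p in each coordinate; reduction mod p is the
  inverse.\<close>

lemma card_translates_in_Q:
  assumes "y \<in> PiE {..<n} (\<lambda>_. UNIV)"
  shows "finite {x\<in>L. shift n (\<lambda>j. - x j) y \<in> Q}" (is "finite ?X")
    and "card {x\<in>L. shift n (\<lambda>j. - x j) y \<in> Q} = card C"
proof -
  let ?f = "\<lambda>x::nat \<Rightarrow> real. \<lambda>j\<in>{..<n}. \<lfloor>x j\<rfloor> mod int p"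
  let ?g = "\<lambda>c::nat \<Rightarrow> int. \<lambda>j\<in>{..<n}. real_of_int (c j - int p * \<lfloor>(y j + c j) / p\<rfloor>)"
  have bij: "bij_betw ?g C ?X"
  proof (rule bij_betwI[where g="?f"])
    show "?g \<in> C \<rightarrow> ?X"
    proof
      fix c assume c: "c \<in> C"
      have fl: "\<lfloor>?g c j\<rfloor> = c j - int p * \<lfloor>(y j + c j) / p\<rfloor>" if "j < n" for j
        using that by (simp only: restrict_apply' floor_of_int lessThan_iff)
      have "K (\<lambda>j. \<lfloor>?g c j\<rfloor>) \<longleftrightarrow> K c"
        by (rule periodic_iff) (simp only: fl, simp add: mod_eq_dvd_iff)
      then have "?g c \<in> L" using c by (auto simp: L_def C_def)
      moreover have "y j + ?g c j \<in> {0..<real p}" if "j < n" for j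
      proof -
        define s where "s = (y j + c j) / p"
        have "of_int \<lfloor>s\<rfloor> \<le> s" "s < of_int \<lfloor>s\<rfloor> + 1" by linarith+
        then have "of_int \<lfloor>s\<rfloor> * real p \<le> s * real p" "s * real p < (of_int \<lfloor>s\<rfloor> + 1) * real p"
          using p by (auto intro: mult_right_mono mult_strict_right_mono)
        moreover have "s * p = y j + c j" using p by (simp add: s_def)
        moreover have "?g c j = c j - p * of_int \<lfloor>s\<rfloor>" using that by (simp add: s_def)
        ultimately show ?thesis by (simp add: algebra_simps)
      qed
      ultimately show "?g c \<in> ?X" by (auto simp: shift_def Q_def)
    qed
    show "?f \<in> ?X \<rightarrow> C"
    proof
      fix x assume x: "x \<in> ?X"
      have "K (?f x) \<longleftrightarrow> K (\<lambda>j. \<lfloor>x j\<rfloor>)"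
        by (rule periodic_iff) auto
      then show "?f x \<in> C" using x p by (auto simp: C_def U_def L_def)
    qed
    show "?f (?g c) = c" if "c \<in> C" for c
    proof
      fix j show "?f (?g c) j = c j"
      proof (cases "j < n")
        case True
        then have "c j \<in> {0..<int p}" using that PiE_mem[of c "{..<n}" "\<lambda>_. {0..<int p}" j] by (simp add: C_def U_def)
        then have "(c j - int p * \<lfloor>(y j + c j) / p\<rfloor>) mod int p = c j"
          using mod_diff_right_eq[of "c j" "int p * \<lfloor>(y j + c j) / p\<rfloor>" "int p"]
          by (simp only: mod_mult_self1_is_0 diff_zero atLeastLessThan_iff mod_pos_pos_trivial)
        moreover have "\<lfloor>?g c j\<rfloor> = c j - int p * \<lfloor>(y j + c j) / p\<rfloor>"
          using True by (simp only: restrict_apply' floor_of_int lessThan_iff)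
        ultimately show ?thesis using True by (simp only: restrict_apply' lessThan_iff)
      next
        case False with that show ?thesis
          using PiE_arb[of c "{..<n}" "\<lambda>_. {0..<int p}" j] by (simp add: C_def U_def)
      qed
    qed
    show "?g (?f x) = x" if "x \<in> ?X" for x
    proof
      fix j show "?g (?f x) j = x j"
      proof (cases "j < n")
        case True
        then have "x j \<in> \<int>" using that by (auto simp: L_def)
        then obtain k where k: "x j = of_int k" by (auto elim: Ints_cases)
        have r: "0 \<le> y j + of_int k" "y j + of_int k < real p"
          using that True unfolding k[symmetric] by (auto simp: shift_def Q_def PiE_iff)
        define q where "q = k div int p"
        have kq: "k = k mod int p + int p * q" by (simp add: q_def)
        have "\<lfloor>(y j + (k mod int p)) / p\<rfloor> = - q"
        proof (rule floor_unique)
          have e: "y j + of_int k = y j + of_int (k mod int p) + real p * of_int q"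
            by (subst kq) simp
          show "of_int (- q) \<le> (y j + of_int (k mod int p)) / real p"
            using r(1) p unfolding e by (simp add: le_divide_eq algebra_simps)
          show "(y j + of_int (k mod int p)) / real p < of_int (- q) + 1"
            using r(2) p unfolding e by (subst divide_less_eq) (simp add: algebra_simps)
        qed
        then have "?g (?f x) j = of_int (k mod int p + int p * q)" using True k by simp
        also have "\<dots> = x j" by (simp only: kq[symmetric] k)
        finally show ?thesis .
      next
        case False with that show ?thesis
          using PiE_arb[of x "{..<n}" "\<lambda>_. \<int>" j] by (simp add: L_def)
      qed
    qed
  qed
  show "finite ?X" using bij_betw_finite[OF bij] finite_C by simp
  show "card ?X = card C" using bij_betw_same_card[OF bij] by simp
qed

text \<open>The translates of \<open>V\<close> tile space and every coset of \<open>L\<close> meets \<open>Q\<close> exactly \<open>card C\<close> times;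
  exchanging the two tilings turns integrals over \<open>V\<close> into integrals over \<open>Q\<close>.\<close>
lemma nn_integral_voronoi:
  assumes f[measurable]: "f \<in> borel_measurable (leb_n n)"
  shows "of_nat (card C) * (\<integral>\<^sup>+y. indicator V y * f y \<partial>leb_n n) =
    (\<integral>\<^sup>+y. indicator Q y * (\<integral>\<^sup>+x. indicator V (shift n x y) * f (shift n x y) \<partial>count_space L) \<partial>leb_n n)"
proof -
  have c: "(\<integral>\<^sup>+x. indicator Q (shift n (\<lambda>j. - x j) y) \<partial>count_space L) = of_nat (card C)"
    if y: "y \<in> space (leb_n n)" for y
  proof -
    have "(\<integral>\<^sup>+x. indicator Q (shift n (\<lambda>j. - x j) y) \<partial>count_space L)
        = (\<integral>\<^sup>+x. indicator {x\<in>L. shift n (\<lambda>j. - x j) y \<in> Q} x \<partial>count_space L)"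
      by (intro nn_integral_cong) (auto simp: indicator_def)
    also have "\<dots> = of_nat (card C)"
      using card_translates_in_Q[of y] y by (simp add: space_leb_n emeasure_count_space_finite)
    finally show ?thesis .
  qed
  have "of_nat (card C) * (\<integral>\<^sup>+y. indicator V y * f y \<partial>leb_n n)
      = (\<integral>\<^sup>+y. of_nat (card C) * (indicator V y * f y) \<partial>leb_n n)"
    by (rule nn_integral_cmult[symmetric]) measurable
  \<comment> \<open>The constant \<open>card C\<close> is rewritten as the number of translates of y
    in the cube. In the resulting double integral y can be translated separately for each lattice
    point x, which moves x from the cube to the cell.\<close>
  also have "\<dots> = (\<integral>\<^sup>+y. \<integral>\<^sup>+x. indicator Q (shift n (\<lambda>j. - x j) y) * (indicator V y * f y) \<partial>count_space L \<partial>leb_n n)"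
    by (intro nn_integral_cong) (simp add: nn_integral_multc c)
  also have "\<dots> = (\<integral>\<^sup>+x. \<integral>\<^sup>+y. indicator Q (shift n (\<lambda>j. - x j) y) * (indicator V y * f y) \<partial>leb_n n \<partial>count_space L)"
    using countable_L by (rule nn_integral_count_space_nn_integral) measurable
  also have "\<dots> = (\<integral>\<^sup>+x. \<integral>\<^sup>+y. indicator Q y * (indicator V (shift n x y) * f (shift n x y)) \<partial>leb_n n \<partial>count_space L)"
  proof (rule nn_integral_cong)
    fix x assume "x \<in> space (count_space L)"
    have "(\<integral>\<^sup>+y. indicator Q (shift n (\<lambda>j. - x j) y) * (indicator V y * f y) \<partial>leb_n n)
       = (\<integral>\<^sup>+y. indicator Q (shift n (\<lambda>j. - x j) (shift n x y)) * (indicator V (shift n x y) * f (shift n x y)) \<partial>leb_n n)"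
      by (rule nn_integral_shift[symmetric]) measurable
    also have "\<dots> = (\<integral>\<^sup>+y. indicator Q y * (indicator V (shift n x y) * f (shift n x y)) \<partial>leb_n n)"
    proof (rule nn_integral_cong)
      fix y assume "y \<in> space (leb_n n)"
      then have "shift n (\<lambda>j. - x j) (shift n x y) = y"
        by (auto simp: shift_def space_leb_n PiE_def extensional_def fun_eq_iff)
      then show "indicator Q (shift n (\<lambda>j. - x j) (shift n x y)) * (indicator V (shift n x y) * f (shift n x y))
          = indicator Q y * (indicator V (shift n x y) * f (shift n x y))" by simp
    qed
    finally show "(\<integral>\<^sup>+y. indicator Q (shift n (\<lambda>j. - x j) y) * (indicator V y * f y) \<partial>leb_n n)
        = (\<integral>\<^sup>+y. indicator Q y * (indicator V (shift n x y) * f (shift n x y)) \<partial>leb_n n)" .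
  qed
  also have "\<dots> = (\<integral>\<^sup>+y. \<integral>\<^sup>+x. indicator Q y * (indicator V (shift n x y) * f (shift n x y)) \<partial>count_space L \<partial>leb_n n)"
    using countable_L by (rule nn_integral_count_space_nn_integral[symmetric]) measurable
  also have "\<dots> = (\<integral>\<^sup>+y. indicator Q y * (\<integral>\<^sup>+x. indicator V (shift n x y) * f (shift n x y) \<partial>count_space L) \<partial>leb_n n)"
    by (intro nn_integral_cong nn_integral_cmult) simp
  finally show ?thesis .
qed

lemma L_add: 
  assumes "x \<in> L" "y \<in> L"
  shows "(\<lambda>j\<in>{..<n}. x j + y j) \<in> L"
proof -
  have "K (\<lambda>j. \<lfloor>x j\<rfloor> + \<lfloor>y j\<rfloor>)" using assms by (intro add) (auto simp: L_def)
  moreover have "\<lfloor>x j + y j\<rfloor> = \<lfloor>x j\<rfloor> + \<lfloor>y j\<rfloor>" if "j < n" for j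
  proof -
    have "x j \<in> \<int>" using assms that by (auto simp: L_def PiE_iff)
    then show ?thesis by (elim Ints_cases) simp
  qed
  ultimately have "K (\<lambda>j. \<lfloor>(\<lambda>j\<in>{..<n}. x j + y j) j\<rfloor>)"
    by (subst periodic_iff[where y="\<lambda>j. \<lfloor>x j\<rfloor> + \<lfloor>y j\<rfloor>"]) auto
  then show ?thesis using assms by (auto simp: L_def PiE_iff)
qed

lemma L_uminus: 
  assumes "x \<in> L"
  shows "(\<lambda>j\<in>{..<n}. - x j) \<in> L"
proof -
  have "K (\<lambda>j. - \<lfloor>x j\<rfloor>)" using assms by (intro neg) (auto simp: L_def)
  moreover have "\<lfloor>- x j\<rfloor> = - \<lfloor>x j\<rfloor>" if "j < n" for j
  proof -
    have "x j \<in> \<int>" using assms that by (auto simp: L_def PiE_iff)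
    then show ?thesis by (elim Ints_cases) (simp add: floor_minus)
  qed
  ultimately have "K (\<lambda>j. \<lfloor>(\<lambda>j\<in>{..<n}. - x j) j\<rfloor>)"
    by (subst periodic_iff[where y="\<lambda>j. - \<lfloor>x j\<rfloor>"]) auto
  then show ?thesis using assms by (auto simp: L_def PiE_iff)
qed

lemma zero_in_L: "(\<lambda>j\<in>{..<n}. 0) \<in> L"
  using p by (auto simp: L_def intro: periodic[OF zero])

text \<open>Since \<open>L\<close> is a group, y - x lies in the cell of the origin exactly if x is
  a nearest lattice point of y.\<close>

lemma shift_in_V_iff:
  assumes "x \<in> L"
  shows "shift n x y \<in> V \<longleftrightarrow> (\<forall>x'\<in>L. sqnorm n (\<lambda>j. y j - x j) \<le> sqnorm n (\<lambda>j. y j - x' j))"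
proof -
  have e: "sqnorm n (shift n x y) = sqnorm n (\<lambda>j. y j - x j)"
    by (intro sqnorm_cong) (simp add: shift_def)
  have "(\<forall>x'\<in>L. sqnorm n (shift n x y) \<le> sqnorm n (\<lambda>j. shift n x y j - x' j))
      \<longleftrightarrow> (\<forall>x'\<in>L. sqnorm n (\<lambda>j. y j - x j) \<le> sqnorm n (\<lambda>j. y j - x' j))"
  proof (intro iffI ballI)
    fix x' assume h: "\<forall>x'\<in>L. sqnorm n (shift n x y) \<le> sqnorm n (\<lambda>j. shift n x y j - x' j)" and x': "x' \<in> L"
    have "(\<lambda>j\<in>{..<n}. x' j + (\<lambda>j\<in>{..<n}. - x j) j) \<in> L"
      using x' assms by (intro L_add L_uminus)
    from h[rule_format, OF this]
    have "sqnorm n (\<lambda>j. y j - x j) \<le> sqnorm n (\<lambda>j. shift n x y j - (\<lambda>j\<in>{..<n}. x' j + (\<lambda>j\<in>{..<n}. - x j) j) j)"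
      unfolding e .
    also have "\<dots> = sqnorm n (\<lambda>j. y j - x' j)"
      by (intro sqnorm_cong) (simp add: shift_def)
    finally show "sqnorm n (\<lambda>j. y j - x j) \<le> sqnorm n (\<lambda>j. y j - x' j)" .
  next
    fix x' assume h: "\<forall>x'\<in>L. sqnorm n (\<lambda>j. y j - x j) \<le> sqnorm n (\<lambda>j. y j - x' j)" and x': "x' \<in> L"
    have "sqnorm n (shift n x y) \<le> sqnorm n (\<lambda>j. y j - (\<lambda>j\<in>{..<n}. x j + x' j) j)"
      unfolding e using x' assms by (intro h[rule_format] L_add)
    also have "\<dots> = sqnorm n (\<lambda>j. shift n x y j - x' j)"
      by (intro sqnorm_cong) (simp add: shift_def)
    finally show "sqnorm n (shift n x y) \<le> sqnorm n (\<lambda>j. shift n x y j - x' j)" .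
  qed
  then show ?thesis by (simp add: voronoi_def shift_def)
qed

text \<open>The ball about y through the origin contains a lattice point, and only finitely many of
  them, so the minimum is attained.\<close>

lemma nearest_point_exists: "\<exists>x\<in>L. shift n x y \<in> V"
proof -
  define s where "s = sqnorm n (\<lambda>j. y j - 0)"
  define X where "X = {x\<in>L. sqnorm n (\<lambda>j. y j - x j) \<le> s}"
  have "X \<subseteq> PiE {..<n} (\<lambda>j. of_int ` {\<lfloor>y j - sqrt s\<rfloor>..\<lceil>y j + sqrt s\<rceil>})"
  proof
    fix x assume x: "x \<in> X"
    have "x j \<in> of_int ` {\<lfloor>y j - sqrt s\<rfloor>..\<lceil>y j + sqrt s\<rceil>}" if j: "j < n" for j
    proof -
      obtain k where k: "x j = of_int k" using x j by (auto simp: X_def L_def PiE_iff elim: Ints_cases)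
      have "(y j - x j)\<^sup>2 \<le> s"
        using x component_le_sqnorm[OF j, of "\<lambda>j. y j - x j"] by (auto simp: X_def)
      then have "\<bar>y j - x j\<bar> \<le> sqrt s" by (simp add: real_le_rsqrt)
      then have "k \<in> {\<lfloor>y j - sqrt s\<rfloor>..\<lceil>y j + sqrt s\<rceil>}"
        unfolding k atLeastAtMost_iff abs_le_iff by linarith
      then show ?thesis using k by blast
    qed
    then show "x \<in> PiE {..<n} (\<lambda>j. of_int ` {\<lfloor>y j - sqrt s\<rfloor>..\<lceil>y j + sqrt s\<rceil>})"
      using x by (auto simp: X_def L_def PiE_iff)
  qed
  then have "finite X" by (rule finite_subset) (auto intro!: finite_PiE)
  moreover have "sqnorm n (\<lambda>j. y j - (\<lambda>j\<in>{..<n}. 0) j) = s"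
    unfolding s_def by (intro sqnorm_cong) simp
  then have "X \<noteq> {}" using zero_in_L by (auto simp: X_def)
  ultimately obtain x where x: "x \<in> X" "\<And>x'. x' \<in> X \<Longrightarrow> sqnorm n (\<lambda>j. y j - x j) \<le> sqnorm n (\<lambda>j. y j - x' j)"
    using ex_min_if_finite[of "(\<lambda>x. sqnorm n (\<lambda>j. y j - x j)) ` X"] by (auto simp: not_less)
  have "sqnorm n (\<lambda>j. y j - x j) \<le> sqnorm n (\<lambda>j. y j - x' j)" if "x' \<in> L" for x'
    using x that by (cases "x' \<in> X") (auto simp: X_def)
  then show ?thesis using x(1) shift_in_V_iff[of x y] by (auto simp: X_def)
qed

lemma emeasure_Q: "emeasure (leb_n n) Q = of_nat (p ^ n)"
  unfolding Q_def using p
  by (subst emeasure_leb_n_box) (auto simp: ennreal_of_nat_eq_real_of_nat ennreal_power)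

text \<open>The tiling identity with integrand 1: each point of the cube has at least one nearest
  lattice point. This direction is the one an upper bound on the normalised second moment calls
  for.\<close>

lemma voronoi_volume_lower: "of_nat (p ^ n) \<le> of_nat (card C) * emeasure (leb_n n) V"
proof -
  have "of_nat (p ^ n) = (\<integral>\<^sup>+y. indicator Q y \<partial>leb_n n)"
    using emeasure_Q by simp
  also have "\<dots> \<le> (\<integral>\<^sup>+y. indicator Q y * (\<integral>\<^sup>+x. indicator V (shift n x y) * 1 \<partial>count_space L) \<partial>leb_n n)"
  proof (rule nn_integral_mono)
    fix y
    obtain x where x: "x \<in> L" "shift n x y \<in> V" using nearest_point_exists by blast
    have "1 = (\<integral>\<^sup>+x'. indicator {x} x' \<partial>count_space L)"
      using x by (simp add: emeasure_count_space_finite)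
    also have "\<dots> \<le> (\<integral>\<^sup>+x. indicator V (shift n x y) * 1 \<partial>count_space L)"
      using x by (intro nn_integral_mono) (auto simp: indicator_def)
    finally have "1 \<le> (\<integral>\<^sup>+x. indicator V (shift n x y) * 1 \<partial>count_space L)" .
    then show "indicator Q y \<le> indicator Q y * (\<integral>\<^sup>+x. indicator V (shift n x y) * 1 \<partial>count_space L)"
      by (auto simp: indicator_def)
  qed
  also have "\<dots> = of_nat (card C) * (\<integral>\<^sup>+y. indicator V y * 1 \<partial>leb_n n)"
    by (rule nn_integral_voronoi[symmetric]) simp
  finally show ?thesis by simp
qed

text \<open>Almost every point has a unique nearest lattice point, so each point of the cube is counted once.\<close>
lemma voronoi_moment_upper:
  fixes g :: "(nat \<Rightarrow> int) \<Rightarrow> real"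
  assumes g: "\<And>u y. u \<in> U \<Longrightarrow> (\<And>j. j < n \<Longrightarrow> \<lfloor>y j\<rfloor> = u j) \<Longrightarrow> \<exists>x\<in>L. sqnorm n (\<lambda>j. y j - x j) \<le> g u"
  shows "of_nat (card C) * (\<integral>\<^sup>+y. indicator V y * ennreal (sqnorm n y) \<partial>leb_n n) \<le> ennreal (\<Sum>u\<in>U. g u)"
proof -
  have g0: "0 \<le> g u" if u: "u \<in> U" for u
  proof -
    obtain x where "sqnorm n (\<lambda>j. real_of_int (u j) - x j) \<le> g u"
      using g[OF u, of "\<lambda>j. of_int (u j)"] by auto
    then show ?thesis using sqnorm_nonneg order_trans by blast
  qed
  define B where "B = (\<lambda>u::nat \<Rightarrow> int. PiE {..<n} (\<lambda>j. {real_of_int (u j)..<real_of_int (u j) + 1}))"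
  have B[measurable]: "B u \<in> sets (leb_n n)" for u
    unfolding B_def leb_n_def by (rule sets_PiM_I_finite) auto
  have eB: "emeasure (leb_n n) (B u) = 1" for u
    unfolding B_def by (subst emeasure_leb_n_box) auto
  have "AE y in leb_n n. \<forall>x\<in>L. \<forall>x'\<in>L. x \<noteq> x' \<longrightarrow> sqnorm n (\<lambda>j. y j - x j) \<noteq> sqnorm n (\<lambda>j. y j - x' j)"
    using countable_L L_extensional by (auto simp: AE_ball_countable intro!: equidistant_null)
  then have le: "AE y in leb_n n. indicator Q y * (\<integral>\<^sup>+x. indicator V (shift n x y) * ennreal (sqnorm n (shift n x y)) \<partial>count_space L)
     \<le> (\<Sum>u\<in>U. ennreal (g u) * indicator (B u) y)"
  proof eventually_elim
    case (elim y)
    obtain x where x: "x \<in> L" "shift n x y \<in> V" using nearest_point_exists by blast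
    have uniq: "x' = x" if "x' \<in> L" "shift n x' y \<in> V" for x'
    proof (rule ccontr)
      assume "x' \<noteq> x"
      moreover have "sqnorm n (\<lambda>j. y j - x' j) = sqnorm n (\<lambda>j. y j - x j)"
        using that x shift_in_V_iff by (intro antisym) auto
      ultimately show False using elim that x by blast
    qed
    show ?case
    proof (cases "y \<in> Q")
      case True
      define u where "u = (\<lambda>j\<in>{..<n}. \<lfloor>y j\<rfloor>)"
      have u: "u \<in> U" "y \<in> B u"
        using True by (auto simp: u_def U_def Q_def B_def PiE_iff floor_less_iff)
      obtain x0 where x0: "x0 \<in> L" "sqnorm n (\<lambda>j. y j - x0 j) \<le> g u"
        using g[OF u(1), of y] by (auto simp: u_def)
      have "sqnorm n (shift n x y) = sqnorm n (\<lambda>j. y j - x j)"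
        by (intro sqnorm_cong) (simp add: shift_def)
      also have "\<dots> \<le> g u" using x x0 shift_in_V_iff order_trans by blast
      finally have sg: "sqnorm n (shift n x y) \<le> g u" .
      have "(\<integral>\<^sup>+x. indicator V (shift n x y) * ennreal (sqnorm n (shift n x y)) \<partial>count_space L)
          \<le> (\<integral>\<^sup>+x'. ennreal (g u) * indicator {x} x' \<partial>count_space L)"
      proof (rule nn_integral_mono)
        fix x' assume "x' \<in> space (count_space L)"
        then have x': "x' \<in> L" by simp
        show "indicator V (shift n x' y) * ennreal (sqnorm n (shift n x' y)) \<le> ennreal (g u) * indicator {x} x'"
        proof (cases "shift n x' y \<in> V")
          case True
          then have "x' = x" using x' by (rule uniq[rotated])
          then show ?thesis using True sg by (simp add: ennreal_leI)
        qed simp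
      qed
      also have "\<dots> = ennreal (g u)"
        using x by (subst nn_integral_cmult_indicator) (auto simp: emeasure_count_space_finite)
      also have "\<dots> = ennreal (g u) * indicator (B u) y" using u by simp
      also have "\<dots> \<le> (\<Sum>u\<in>U. ennreal (g u) * indicator (B u) y)"
        by (rule member_le_sum) (use u finite_U in auto)
      finally show ?thesis using True by simp
    qed simp
  qed
  have "of_nat (card C) * (\<integral>\<^sup>+y. indicator V y * ennreal (sqnorm n y) \<partial>leb_n n)
      = (\<integral>\<^sup>+y. indicator Q y * (\<integral>\<^sup>+x. indicator V (shift n x y) * ennreal (sqnorm n (shift n x y)) \<partial>count_space L) \<partial>leb_n n)"
    by (rule nn_integral_voronoi) simp
  also have "\<dots> \<le> (\<integral>\<^sup>+y. (\<Sum>u\<in>U. ennreal (g u) * indicator (B u) y) \<partial>leb_n n)"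
    using le by (rule nn_integral_mono_AE)
  also have "\<dots> = (\<Sum>u\<in>U. ennreal (g u))"
    by (subst nn_integral_sum) (auto simp: nn_integral_cmult_indicator eB)
  also have "\<dots> = ennreal (\<Sum>u\<in>U. g u)" using g0 by simp
  finally show ?thesis .
qed

text \<open>Comparison of y with the lattice points that have p or -p in coordinate j and 0
  elsewhere.\<close>

lemma V_bounded: "y \<in> V \<Longrightarrow> j < n \<Longrightarrow> \<bar>y j\<bar> \<le> real p / 2"
proof -
  assume y: "y \<in> V" and j: "j < n"
  have *: "s * y j \<le> p / 2" if s: "s = 1 \<or> s = -1" for s :: real
  proof -
    define x :: "nat \<Rightarrow> real" where "x = (\<lambda>i\<in>{..<n}. if i = j then s * p else 0)"
    have "\<lfloor>x i\<rfloor> mod int p = 0" if "i < n" for i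
      using s that by (auto simp: x_def floor_minus)
    then have "K (\<lambda>i. \<lfloor>x i\<rfloor>)" by (intro periodic[OF zero]) simp
    then have "x \<in> L" using s by (auto simp: L_def x_def)
    then have "sqnorm n y \<le> sqnorm n (\<lambda>i. y i - x i)" using y by (auto simp: voronoi_def)
    also have "\<dots> = sqnorm n y + (s * p)\<^sup>2 - 2 * (s * y j) * p"
    proof -
      have "sqnorm n (\<lambda>i. y i - x i) = (y j - s * p)\<^sup>2 + (\<Sum>i\<in>{..<n} - {j}. (y i)\<^sup>2)"
        unfolding sqnorm_def using j by (subst sum.remove[of _ j]) (auto simp: x_def intro!: sum.cong)
      moreover have "sqnorm n y = (y j)\<^sup>2 + (\<Sum>i\<in>{..<n} - {j}. (y i)\<^sup>2)"
        unfolding sqnorm_def using j by (subst sum.remove[of _ j]) auto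
      ultimately show ?thesis by (simp add: power2_eq_square algebra_simps)
    qed
    finally have "2 * (s * y j) * p \<le> p * p" using s by (auto simp: power2_eq_square)
    then have "2 * (s * y j) \<le> p" using p by simp
    then show ?thesis by simp
  qed
  show ?thesis using *[of 1] *[of "-1"] by (simp add: abs_le_iff)
qed

text \<open>\<open>measure\<close> is 0 on sets of infinite measure, so \<open>lattice_vol\<close>
  says something about the cell only once this is known.\<close>

lemma emeasure_V_finite: "emeasure (leb_n n) V < \<infinity>"
proof -
  have "V \<subseteq> PiE {..<n} (\<lambda>_. {- real p / 2..real p / 2})"
  proof
    fix y assume y: "y \<in> V"
    have "y j \<in> {- real p / 2..real p / 2}" if "j < n" for j
      using V_bounded[OF y that] by (simp add: abs_le_iff) linarith
    then show "y \<in> PiE {..<n} (\<lambda>_. {- real p / 2..real p / 2})"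
      using y by (auto simp: voronoi_def PiE_iff)
  qed
  then have "emeasure (leb_n n) V \<le> emeasure (leb_n n) (PiE {..<n} (\<lambda>_. {- real p / 2..real p / 2}))"
    by (rule emeasure_mono) (auto simp: leb_n_def intro!: sets_PiM_I_finite)
  also have "\<dots> = (\<Prod>j<n. ennreal p)"
    by (subst emeasure_leb_n_box) (auto simp: field_simps)
  also have "\<dots> < \<infinity>" by (simp add: ennreal_power ennreal_less_top)
  finally show ?thesis .
qed

text \<open>The Bochner integral in \<open>nsm\<close> defaults to 0 off the integrable functions;
  boundedness of the cell rules this out and ties it to the nonnegative integral used in the tiling
  identity.\<close>

lemma integral_voronoi:
  shows "set_integrable (leb_n n) V (sqnorm n)"
    and "ennreal (set_lebesgue_integral (leb_n n) V (sqnorm n)) = (\<integral>\<^sup>+y. indicator V y * ennreal (sqnorm n y) \<partial>leb_n n)"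
    and "0 \<le> set_lebesgue_integral (leb_n n) V (sqnorm n)"
proof -
  have e: "(\<integral>\<^sup>+y. ennreal (indicator V y *\<^sub>R sqnorm n y) \<partial>leb_n n) = (\<integral>\<^sup>+y. indicator V y * ennreal (sqnorm n y) \<partial>leb_n n)"
    by (intro nn_integral_cong) (auto simp: indicator_def)
  have "(\<integral>\<^sup>+y. indicator V y * ennreal (sqnorm n y) \<partial>leb_n n) \<le> (\<integral>\<^sup>+y. ennreal (n * (real p / 2)\<^sup>2) * indicator V y \<partial>leb_n n)"
  proof (rule nn_integral_mono)
    fix y
    have "sqnorm n y \<le> n * (real p / 2)\<^sup>2" if "y \<in> V"
    proof -
      have "sqnorm n y \<le> (\<Sum>j<n. (real p / 2)\<^sup>2)"
        unfolding sqnorm_def using V_bounded[OF that] p by (intro sum_mono) (simp add: abs_le_square_iff[symmetric])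
      then show ?thesis by simp
    qed
    then show "indicator V y * ennreal (sqnorm n y) \<le> ennreal (n * (real p / 2)\<^sup>2) * indicator V y"
      by (auto simp: indicator_def intro!: ennreal_leI)
  qed
  also have "\<dots> < \<infinity>"
    using emeasure_V_finite by (subst nn_integral_cmult_indicator) (auto simp: ennreal_mult_less_top)
  finally have fin: "(\<integral>\<^sup>+y. indicator V y * ennreal (sqnorm n y) \<partial>leb_n n) < \<infinity>" .
  have nn: "AE y in leb_n n. 0 \<le> indicator V y *\<^sub>R sqnorm n y"
    by (auto simp: indicator_def sqnorm_nonneg)
  show i: "set_integrable (leb_n n) V (sqnorm n)"
    unfolding set_integrable_def by (rule integrableI_nonneg) (use nn fin e in auto)
  show "ennreal (set_lebesgue_integral (leb_n n) V (sqnorm n)) = (\<integral>\<^sup>+y. indicator V y * ennreal (sqnorm n y) \<partial>leb_n n)"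
    unfolding set_lebesgue_integral_def using i nn e
    by (subst nn_integral_eq_integral[symmetric]) (auto simp: set_integrable_def)
  show "0 \<le> set_lebesgue_integral (leb_n n) V (sqnorm n)"
    unfolding set_lebesgue_integral_def using nn by (rule integral_nonneg_AE)
qed

lemma lattice_vol_lower: "real p ^ n / card C \<le> lattice_vol n L" and lattice_vol_pos: "lattice_vol n L > 0"
proof -
  have "ennreal (real p ^ n) \<le> ennreal (card C * lattice_vol n L)"
    using voronoi_volume_lower emeasure_V_finite
    by (simp add: lattice_vol_def emeasure_eq_ennreal_measure ennreal_mult ennreal_of_nat_eq_real_of_nat flip: ennreal_power)
  then have "real p ^ n \<le> card C * lattice_vol n L"
    by (subst (asm) ennreal_le_iff) (auto simp: lattice_vol_def)
  then show "real p ^ n / card C \<le> lattice_vol n L"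
    using card_C_pos by (simp add: field_simps)
  moreover have "real p ^ n / card C > 0" using p card_C_pos by simp
  ultimately show "lattice_vol n L > 0" by linarith
qed

text \<open>The volume enters the denominator with exponent 1 + 2/n: one factor turns the integral
  over the cell into a mean over the cube, the rest is the normalisation. Both are estimated by vol
  >= p^n / \<open>card C\<close>.\<close>

lemma nsm_upper:
  fixes g :: "(nat \<Rightarrow> int) \<Rightarrow> real"
  assumes g: "\<And>u y. u \<in> U \<Longrightarrow> (\<And>j. j < n \<Longrightarrow> \<lfloor>y j\<rfloor> = u j) \<Longrightarrow> \<exists>x\<in>L. sqnorm n (\<lambda>j. y j - x j) \<le> g u"
    and g0: "\<And>u. u \<in> U \<Longrightarrow> 0 \<le> g u"
  shows "nsm n L \<le> (\<Sum>u\<in>U. g u) / real p ^ n / (n * (real p ^ n / card C) powr (2 / n))"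
proof -
  define I where "I = set_lebesgue_integral (leb_n n) V (sqnorm n)"
  define v where "v = lattice_vol n L"
  define v0 where "v0 = real p ^ n / card C"
  have v: "v0 \<le> v" "v > 0" "v0 > 0"
    using lattice_vol_lower lattice_vol_pos p card_C_pos by (auto simp: v_def v0_def)
  have "ennreal (card C * I) \<le> ennreal (\<Sum>u\<in>U. g u)"
    using voronoi_moment_upper[OF g] integral_voronoi(2,3)
    by (simp add: I_def ennreal_mult ennreal_of_nat_eq_real_of_nat)
  then have "card C * I \<le> (\<Sum>u\<in>U. g u)"
    by (subst (asm) ennreal_le_iff) (auto intro: sum_nonneg g0)
  then have I: "I \<le> (\<Sum>u\<in>U. g u) / card C" using card_C_pos by (simp add: field_simps)
  have "nsm n L = I / v / (n * v powr (2 / n))"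
    using v by (simp add: nsm_def I_def v_def powr_add)
  also have "\<dots> \<le> ((\<Sum>u\<in>U. g u) / card C) / v0 / (n * v0 powr (2 / n))"
    using I v n integral_voronoi(3) sum_nonneg[of U g, OF g0]
    by (intro frac_le mult_left_mono powr_mono2) (auto simp: I_def)
  also have "((\<Sum>u\<in>U. g u) / card C) / v0 = (\<Sum>u\<in>U. g u) / real p ^ n"
    using card_C_pos by (simp add: v0_def)
  finally show ?thesis by (simp add: v0_def)
qed

text \<open>Jensen's inequality for \<open>exp (- t \<parallel>y\<parallel>\<^sup>2)\<close> on the Voronoi cell.\<close>
lemma voronoi_gaussian_bound:
  assumes t: "t > 0"
  shows "lattice_vol n L * exp (- t * (set_lebesgue_integral (leb_n n) V (sqnorm n) / lattice_vol n L)) \<le> sqrt (pi / t) ^ n"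
proof -
  define I where "I = set_lebesgue_integral (leb_n n) V (sqnorm n)"
  define v where "v = lattice_vol n L"
  define M where "M = I / v"
  have v: "v > 0" using lattice_vol_pos by (simp add: v_def)
  have gi: "integrable lborel (\<lambda>x. exp (- t * x\<^sup>2))" and ge: "integral\<^sup>L lborel (\<lambda>x. exp (- t * x\<^sup>2)) = sqrt (pi / t)"
    using gaussian_integral[OF t] by (auto simp: has_bochner_integral_iff)
  have ex: "exp (- t * sqnorm n y) = (\<Prod>j<n. exp (- t * (y j)\<^sup>2))" for y
    by (simp add: sqnorm_def sum_distrib_left exp_sum flip: sum_negf)
  have gint: "integrable (leb_n n) (\<lambda>y. exp (- t * sqnorm n y))"
    unfolding ex leb_n_def by (rule lborel_product.product_integrable_prod) (use gi in auto)
  have geq: "integral\<^sup>L (leb_n n) (\<lambda>y. exp (- t * sqnorm n y)) = sqrt (pi / t) ^ n"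
    unfolding ex leb_n_def by (subst lborel_product.product_integral_prod) (use gi ge in auto)
  have int1: "integrable (leb_n n) (\<lambda>y. indicator V y * c)" for c :: real
    using emeasure_V_finite by (intro integrable_mult_left) (simp add: less_top)
  have int2: "integrable (leb_n n) (\<lambda>y. indicator V y * sqnorm n y)"
    using integral_voronoi(1) by (simp add: set_integrable_def)
  \<comment> \<open>The integrand is the tangent to x -> exp(-t x) at the mean M, taken at the
    squared norm; over the cell its linear part cancels because M is the mean.\<close>
  have "v * exp (- t * M) = integral\<^sup>L (leb_n n) (\<lambda>y. indicator V y * (exp (- t * M) * (1 + t * M)) - (exp (- t * M) * t) * (indicator V y * sqnorm n y))"
  proof -
    have "integral\<^sup>L (leb_n n) (\<lambda>y. indicator V y * (exp (- t * M) * (1 + t * M)) - (exp (- t * M) * t) * (indicator V y * sqnorm n y))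
       = v * (exp (- t * M) * (1 + t * M)) - (exp (- t * M) * t) * I"
      using int1 int2
      by (subst Bochner_Integration.integral_diff)
         (auto simp: v_def lattice_vol_def I_def set_lebesgue_integral_def)
    also have "\<dots> = v * exp (- t * M)" using v by (simp add: M_def field_simps)
    finally show ?thesis by simp
  qed
  also have "\<dots> \<le> integral\<^sup>L (leb_n n) (\<lambda>y. exp (- t * sqnorm n y))"
  proof (rule integral_mono[OF _ gint])
    show "integrable (leb_n n) (\<lambda>y. indicator V y * (exp (- t * M) * (1 + t * M)) - (exp (- t * M) * t) * (indicator V y * sqnorm n y))"
      using int1 int2 by (intro Bochner_Integration.integrable_diff integrable_mult_right)
    fix y
    have "1 + (t * M - t * sqnorm n y) \<le> exp (t * M - t * sqnorm n y)" by (rule exp_ge_add_one_self)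
    then have "exp (- t * M) * (1 + (t * M - t * sqnorm n y)) \<le> exp (- t * M) * exp (t * M - t * sqnorm n y)"
      by (intro mult_left_mono) auto
    also have "\<dots> = exp (- t * sqnorm n y)" by (simp flip: exp_add)
    finally show "indicator V y * (exp (- t * M) * (1 + t * M)) - (exp (- t * M) * t) * (indicator V y * sqnorm n y)
        \<le> exp (- t * sqnorm n y)"
      by (auto simp: indicator_def algebra_simps)
  qed
  finally show ?thesis unfolding geq M_def I_def v_def .
qed

text \<open>The Gaussian bound is used at its optimal parameter t = n/(2M), with M the mean squared
  norm on the cell.\<close>

lemma nsm_lower: "1 / (2 * pi * exp 1) \<le> nsm n L"
proof -
  define I where "I = set_lebesgue_integral (leb_n n) V (sqnorm n)"
  define v where "v = lattice_vol n L"
  define M where "M = I / v"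
  define r where "r = v powr (1 / n)"
  have v: "v > 0" using lattice_vol_pos by (simp add: v_def)
  have r: "r > 0" using v by (simp add: r_def)
  have rn: "r ^ n = v" using v n by (simp add: r_def powr_realpow[symmetric] powr_powr)
  have M0: "M \<ge> 0" using integral_voronoi(3) v by (simp add: M_def I_def)
  have bound: "v * exp (- t * M) \<le> sqrt (pi / t) ^ n" if "t > 0" for t
    using voronoi_gaussian_bound[OF that] by (simp add: M_def I_def v_def)
  \<comment> \<open>The optimal t requires M > 0. If M were 0, the choice t = 4 pi / r^2 would bound
    v = r^n by (r/2)^n.\<close>
  have "M \<noteq> 0"
  proof
    assume "M = 0"
    then have "v \<le> sqrt (pi / (4 * pi / r\<^sup>2)) ^ n" using bound[of "4 * pi / r\<^sup>2"] r by simp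
    also have "pi / (4 * pi / r\<^sup>2) = (r / 2)\<^sup>2" by (simp add: power2_eq_square)
    also have "sqrt ((r / 2)\<^sup>2) = r / 2" using r by simp
    also have "(r / 2) ^ n = v / 2 ^ n" by (simp add: power_divide rn)
    also have "\<dots> < v" using v n by (simp add: field_simps)
    finally show False by simp
  qed
  with M0 have M: "M > 0" by simp
  have "v * exp (- (n / 2)) \<le> sqrt (2 * pi * M / n) ^ n"
    using bound[of "n / (2 * M)"] M n by (simp add: field_simps)
  then have "v \<le> exp (n / 2) * sqrt (2 * pi * M / n) ^ n"
    by (simp add: exp_minus field_simps)
  also have "exp (n / 2) = exp (1 / 2) ^ n" by (simp flip: exp_of_nat_mult)
  also have "exp (1 / 2) = sqrt (exp 1 :: real)"
    by (rule real_sqrt_unique[symmetric]) (simp_all add: power2_eq_square flip: exp_add)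
  also have "sqrt (exp 1) ^ n * sqrt (2 * pi * M / n) ^ n = sqrt (2 * pi * exp 1 * M / n) ^ n"
    by (simp add: power_mult_distrib[symmetric] real_sqrt_mult[symmetric] mult_ac)
  finally have "r ^ n \<le> sqrt (2 * pi * exp 1 * M / n) ^ n" by (simp add: rn)
  then have "r \<le> sqrt (2 * pi * exp 1 * M / n)"
    using n M r by (subst (asm) power_mono_iff) auto
  then have "r\<^sup>2 \<le> 2 * pi * exp 1 * M / n"
    using r M n by (simp add: real_le_rsqrt sqrt_ge_absD)
  then have le: "1 / (2 * pi * exp 1) \<le> M / (n * r\<^sup>2)"
    using n r by (simp add: field_simps)
  have "nsm n L = M / (n * v powr (2 / n))"
    using v by (simp add: nsm_def M_def I_def v_def powr_add)
  also have "v powr (2 / n) = r\<^sup>2" using v by (simp add: r_def power2_eq_square powr_add[symmetric])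
  finally show ?thesis using le by simp
qed

end

section \<open>Covering by the second moment method\<close>

abbreviation isq :: "nat \<Rightarrow> (nat \<Rightarrow> int) \<Rightarrow> real" where
  "isq n z \<equiv> (\<Sum>j<n. (real_of_int (z j))\<^sup>2)"

abbreviation pair_sum :: "((nat \<Rightarrow> int) \<Rightarrow> bool) \<Rightarrow> ((nat \<Rightarrow> int) \<Rightarrow> real) \<Rightarrow> (nat \<Rightarrow> int) set \<Rightarrow> real" where
  "pair_sum K w T \<equiv> (\<Sum>z\<in>T. \<Sum>z'\<in>T. w z * w z' * of_bool (K (\<lambda>j. z j - z' j)))"

context periodic_lattice
begin

definition covered :: "(nat \<Rightarrow> int) set \<Rightarrow> (nat \<Rightarrow> int) set" where
  "covered T = {u \<in> U. \<exists>z\<in>T. K (\<lambda>j. u j + z j)}"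

text \<open>Cauchy-Schwarz for the count \<open>X\<close>, which vanishes off the covered points.
  Its sum over u is the total weight times \<open>card C\<close>; the sum of its squares is
  \<open>card C\<close> times \<open>pair_sum\<close>.\<close>

lemma second_moment:
  fixes w :: "(nat \<Rightarrow> int) \<Rightarrow> real"
  assumes T: "finite T"
  shows "(\<Sum>z\<in>T. w z)\<^sup>2 * card C
     \<le> card (covered T) * (pair_sum K w T)"
proof -
  define X where "X = (\<lambda>u. \<Sum>z\<in>T. w z * of_bool (K (\<lambda>j. u j + z j)))"
  let ?T2 = "\<Sum>z\<in>T. \<Sum>z'\<in>T. w z * w z' * of_bool (K (\<lambda>j. z j - z' j))"
  have cnt: "(\<Sum>u\<in>U. of_bool (P u)) = real (card {u\<in>U. P u})" for P
    using finite_U by (simp add: of_bool_def sum.If_cases Int_def)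
  have "(\<Sum>u\<in>U. X u) = (\<Sum>z\<in>T. w z * (\<Sum>u\<in>U. of_bool (K (\<lambda>j. u j + z j))))"
    unfolding X_def by (subst sum.swap) (simp add: sum_distrib_left)
  also have "\<dots> = (\<Sum>z\<in>T. w z) * card C"
    by (simp add: cnt card_fiber sum_distrib_right)
  finally have m1: "(\<Sum>u\<in>U. X u) = (\<Sum>z\<in>T. w z) * card C" .
  \<comment> \<open>Given K (u + z), the condition K (u + z') is equivalent to K (z - z'), by the
    group law; so the joint count is either the whole fibre or nothing.\<close>
  have both: "(\<Sum>u\<in>U. of_bool (K (\<lambda>j. u j + z j)) * of_bool (K (\<lambda>j. u j + z' j)))
      = real (card C) * of_bool (K (\<lambda>j. z j - z' j))" for z z'
  proof (cases "K (\<lambda>j. z j - z' j)")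
    case True
    have "K (\<lambda>j. u j + z j) \<Longrightarrow> K (\<lambda>j. u j + z' j)" for u
      using diff[OF _ True, of "\<lambda>j. u j + z j"] by (simp add: algebra_simps)
    then have "(\<Sum>u\<in>U. of_bool (K (\<lambda>j. u j + z j)) * of_bool (K (\<lambda>j. u j + z' j)))
        = (\<Sum>u\<in>U. of_bool (K (\<lambda>j. u j + z j)) :: real)"
      by (intro sum.cong refl) auto
    then show ?thesis using True by (simp add: cnt card_fiber)
  next
    case False
    have "\<not> (K (\<lambda>j. u j + z j) \<and> K (\<lambda>j. u j + z' j))" for u
      using False diff[of "\<lambda>j. u j + z j" "\<lambda>j. u j + z' j"] by auto
    then have "of_bool (K (\<lambda>j. u j + z j)) * of_bool (K (\<lambda>j. u j + z' j)) = (0::real)" for u by auto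
    then have "(\<Sum>u\<in>U. of_bool (K (\<lambda>j. u j + z j)) * of_bool (K (\<lambda>j. u j + z' j))) = (\<Sum>u\<in>U. 0::real)"
      by (intro sum.cong refl)
    then show ?thesis using False by simp
  qed
  have "(\<Sum>u\<in>U. (X u)\<^sup>2) = (\<Sum>u\<in>U. \<Sum>z\<in>T. \<Sum>z'\<in>T. w z * w z' * (of_bool (K (\<lambda>j. u j + z j)) * of_bool (K (\<lambda>j. u j + z' j))))"
    unfolding X_def power2_eq_square sum_product by (intro sum.cong refl) (simp add: mult_ac)
  also have "\<dots> = (\<Sum>z\<in>T. \<Sum>u\<in>U. \<Sum>z'\<in>T. w z * w z' * (of_bool (K (\<lambda>j. u j + z j)) * of_bool (K (\<lambda>j. u j + z' j))))"
    by (rule sum.swap)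
  also have "\<dots> = (\<Sum>z\<in>T. \<Sum>z'\<in>T. \<Sum>u\<in>U. w z * w z' * (of_bool (K (\<lambda>j. u j + z j)) * of_bool (K (\<lambda>j. u j + z' j))))"
    by (intro sum.cong refl sum.swap)
  also have "\<dots> = card C * ?T2"
    by (simp only: sum_distrib_left[symmetric] both) (simp add: sum_distrib_left mult_ac)
  finally have m2: "(\<Sum>u\<in>U. (X u)\<^sup>2) = card C * ?T2" .
  have sub: "covered T \<subseteq> U" by (auto simp: covered_def)
  have "(\<Sum>u\<in>covered T. X u) = (\<Sum>u\<in>U. X u)"
    using finite_U sub by (intro sum.mono_neutral_left) (auto simp: covered_def X_def)
  then have "((\<Sum>z\<in>T. w z) * card C)\<^sup>2 = (\<Sum>u\<in>covered T. 1 * X u)\<^sup>2"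
    by (simp add: m1)
  also have "\<dots> \<le> (\<Sum>u\<in>covered T. 1\<^sup>2) * (\<Sum>u\<in>covered T. (X u)\<^sup>2)"
    by (rule Cauchy_Schwarz_ineq_sum)
  also have "\<dots> \<le> card (covered T) * (\<Sum>u\<in>U. (X u)\<^sup>2)"
    using finite_U sub by (auto intro!: mult_left_mono sum_mono2)
  finally have "card C * ((\<Sum>z\<in>T. w z)\<^sup>2 * card C) \<le> card C * (card (covered T) * ?T2)"
    unfolding m2 by (simp add: power2_eq_square mult_ac)
  then show ?thesis using card_C_pos by simp
qed

lemma covered_subset: "covered T \<subseteq> U"
  by (auto simp: covered_def)

text \<open>Inserting the trivial bound p^n for the covered points into
  \<open>second_moment\<close>, together with \<open>card C\<close> >= p^(n-m). Nonnegativity for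
  each single code is what admits the excess to Markov's inequality.\<close>

lemma pair_excess_nonneg:
  fixes w :: "(nat \<Rightarrow> int) \<Rightarrow> real" and m :: nat
  assumes T: "finite T" and W: "(\<Sum>z\<in>T. w z) > 0" and cardC: "p ^ n \<le> card C * p ^ m"
  shows "0 \<le> real p ^ m * (pair_sum K w T) / (\<Sum>z\<in>T. w z)\<^sup>2 - 1"
proof -
  define W where "W = (\<Sum>z\<in>T. w z)"
  define T2 where "T2 = (pair_sum K w T)"
  define G where "G = real (card (covered T))"
  have main: "W\<^sup>2 * card C \<le> G * T2"
    using second_moment[OF T, of w] by (simp add: W_def G_def T2_def)
  have G: "0 \<le> G" "G \<le> real p ^ n"
    using card_mono[OF finite_U covered_subset] unfolding card_U G_def by (simp, metis of_nat_le_iff of_nat_power)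
  have W0: "W > 0" using W by (simp add: W_def)
  have T2: "T2 \<ge> 0"
  proof (rule ccontr)
    assume "\<not> T2 \<ge> 0"
    then have "G * T2 \<le> 0" using G by (simp add: mult_nonneg_nonpos)
    moreover have "W\<^sup>2 * card C > 0" using W0 card_C_pos by simp
    ultimately show False using main by linarith
  qed
  have c_low: "real p ^ n \<le> card C * real p ^ m"
    using cardC by (metis of_nat_le_iff of_nat_mult of_nat_power)
  have "real p ^ n * W\<^sup>2 \<le> (card C * real p ^ m) * W\<^sup>2" using c_low by (intro mult_right_mono) auto
  also have "\<dots> = (W\<^sup>2 * card C) * real p ^ m" by simp
  also have "\<dots> \<le> (G * T2) * real p ^ m" using main by (intro mult_right_mono) auto
  also have "\<dots> \<le> (real p ^ n * T2) * real p ^ m" using G T2 by (intro mult_right_mono) auto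
  finally have "real p ^ n * W\<^sup>2 \<le> real p ^ n * (real p ^ m * T2)" by (simp add: mult_ac)
  then have "W\<^sup>2 \<le> real p ^ m * T2" using p by simp
  then have "1 \<le> real p ^ m * T2 / W\<^sup>2" using W0 by simp
  then show ?thesis by (simp add: W_def T2_def)
qed

text \<open>For a point of the cube whose integer part is not covered, the distance to the origin serves
  as a crude bound; this is why the uncovered fraction \<open>F\<close> has to beat \<open>p\<^sup>2\<close>.\<close>
lemma nsm_upper_covering:
  fixes w :: "(nat \<Rightarrow> int) \<Rightarrow> real" and m :: nat
  assumes T: "finite T" and W: "(\<Sum>z\<in>T. w z) > 0"
    and sq: "\<And>z. z \<in> T \<Longrightarrow> isq n z \<le> S"
    and S: "S \<ge> 0"
    and cardC: "p ^ n \<le> card C * p ^ m"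
    and F: "real p ^ m * (pair_sum K w T) / (\<Sum>z\<in>T. w z)\<^sup>2 - 1 \<le> F"
    and n2: "n \<ge> 2" and \<delta>: "\<delta> > 0"
  shows "nsm n L \<le> ((1 + \<delta>) * S / n + (1 + 1 / \<delta>) + F * (real p)\<^sup>2) * (1 + F) / real p powr (2 * m / n)"
proof -
  define W where "W = (\<Sum>z\<in>T. w z)"
  define T2 where "T2 = (pair_sum K w T)"
  define c where "c = real (card C)"
  define G where "G = real (card (covered T))"
  have pos: "W > 0" "c > 0" "real p > 0"
    using W card_C_pos p by (auto simp: W_def c_def)
  note sub = covered_subset[of T]
  have Gle: "G \<le> real p ^ n"
    using card_mono[OF finite_U sub] unfolding card_U G_def by (metis of_nat_le_iff of_nat_power)
  have G0: "G \<ge> 0" by (simp add: G_def)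
  have main: "W\<^sup>2 * c \<le> G * T2"
    using second_moment[OF T, of w] by (simp add: W_def c_def G_def T2_def)
  have T2: "T2 > 0" 
  proof (rule ccontr)
    assume "\<not> T2 > 0"
    then have "G * T2 \<le> 0" using G0 by (simp add: mult_nonneg_nonpos)
    moreover have "W\<^sup>2 * c > 0" using pos by simp
    ultimately show False using main by linarith
  qed
  have F1: "real p ^ m * T2 \<le> (1 + F) * W\<^sup>2"
    using F pos by (simp add: T2_def W_def field_simps)
  have c_low: "real p ^ n \<le> c * real p ^ m"
    using cardC unfolding c_def by (metis of_nat_le_iff of_nat_mult of_nat_power)
  have "real p ^ n * W\<^sup>2 \<le> (c * real p ^ m) * W\<^sup>2" using c_low by (intro mult_right_mono) auto
  also have "\<dots> \<le> real p ^ m * (G * T2)"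
    using main pos by (simp add: mult_ac)
  also have "\<dots> = G * (real p ^ m * T2)" by simp
  also have "\<dots> \<le> G * ((1 + F) * W\<^sup>2)"
    using F1 G0 by (intro mult_left_mono)
  finally have "real p ^ n * W\<^sup>2 \<le> (G * (1 + F)) * W\<^sup>2" by (simp add: mult_ac)
  \<comment> \<open>The covered fraction is at least 1/(1 + F), so the uncovered one is at most
    F.\<close>
  then have G1: "real p ^ n \<le> G * (1 + F)" using pos by simp
  have F0: "F \<ge> 0"
    using pair_excess_nonneg[OF T W cardC] F by simp
  then have Fpos: "1 + F > 0" by simp
  have bad: "real p ^ n - G \<le> real p ^ n * F"
  proof -
    have "G * F \<le> real p ^ n * F" using Gle F0 by (intro mult_right_mono)
    then show ?thesis using G1 by (simp add: algebra_simps)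
  qed
  \<comment> \<open>The same inequality with the covered set bounded by all of \<open>U\<close> now
    caps the code size: a loss of rank can reduce the cell volume by no more than the factor 1 +
    F.\<close>
  have "c * (real p ^ m * W\<^sup>2) = (W\<^sup>2 * c) * real p ^ m" by simp
  also have "\<dots> \<le> G * T2 * real p ^ m" using main by (intro mult_right_mono) auto
  also have "\<dots> = G * (real p ^ m * T2)" by simp
  also have "\<dots> \<le> real p ^ n * ((1 + F) * W\<^sup>2)"
    using T2 pos by (intro mult_mono[OF Gle F1]) auto
  finally have "(c * real p ^ m) * W\<^sup>2 \<le> (real p ^ n * (1 + F)) * W\<^sup>2" by (simp add: mult_ac)
  then have "c * real p ^ m \<le> real p ^ n * (1 + F)" using pos by simp
  then have vol: "real p ^ m / (1 + F) \<le> real p ^ n / c"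
    using pos Fpos by (simp add: field_simps)
  define a where "a = (1 + \<delta>) * S + (1 + 1 / \<delta>) * n"
  define g where "g = (\<lambda>u. if u \<in> covered T then a else n * (real p)\<^sup>2)"
  have a0: "a \<ge> 0" using S \<delta> by (simp add: a_def)
  have "nsm n L \<le> (\<Sum>u\<in>U. g u) / real p ^ n / (n * (real p ^ n / card C) powr (2 / n))"
  proof (rule nsm_upper)
    show "0 \<le> g u" for u using a0 by (simp add: g_def)
    fix u and y :: "nat \<Rightarrow> real" assume u: "u \<in> U" and y: "\<And>j. j < n \<Longrightarrow> \<lfloor>y j\<rfloor> = u j"
    show "\<exists>x\<in>L. sqnorm n (\<lambda>j. y j - x j) \<le> g u"
    proof (cases "u \<in> covered T")
      case True
      then obtain z where z: "z \<in> T" "K (\<lambda>j. u j + z j)" by (auto simp: covered_def)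
      define x where "x = (\<lambda>j\<in>{..<n}. real_of_int (u j + z j))"
      have fx: "\<lfloor>x j\<rfloor> = u j + z j" if "j < n" for j
        using that by (simp only: x_def restrict_apply' lessThan_iff floor_of_int)
      have "K (\<lambda>j. \<lfloor>x j\<rfloor>)"
        by (rule periodic[OF z(2)]) (simp only: fx)
      then have "x \<in> L" by (auto simp: L_def x_def)
      moreover have "sqnorm n (\<lambda>j. y j - x j) \<le> a"
      proof -
        have "sqnorm n (\<lambda>j. y j - x j) \<le> (\<Sum>j<n. (1 + \<delta>) * (real_of_int (z j))\<^sup>2 + (1 + 1 / \<delta>))"
          unfolding sqnorm_def
        proof (rule sum_mono)
          fix j assume j: "j \<in> {..<n}"
          define f where "f = y j - of_int (u j)"
          have f: "0 \<le> f" "f \<le> 1"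
            using y[of j] j unfolding f_def by (auto simp: floor_eq_iff)
          then have f1: "f\<^sup>2 \<le> 1" by (simp add: power_le_one)
          \<comment> \<open>Young's inequality in disguise: the fractional part f of y j costs a
            bounded amount, at the price of a factor 1 + \<delta> on the square of z j.\<close>
          have "0 \<le> (\<delta> * z j + f)\<^sup>2 / \<delta>" using \<delta> by simp
          also have "\<dots> = \<delta> * (z j)\<^sup>2 + 2 * z j * f + f\<^sup>2 / \<delta>"
            using \<delta> by (simp add: power2_eq_square field_simps)
          finally have "(f - z j)\<^sup>2 \<le> (1 + \<delta>) * (z j)\<^sup>2 + (1 + 1 / \<delta>) * f\<^sup>2"
            by (simp add: power2_eq_square algebra_simps)
          also have "\<dots> \<le> (1 + \<delta>) * (z j)\<^sup>2 + (1 + 1 / \<delta>) * 1"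
            using f1 \<delta> by (intro add_left_mono mult_left_mono) auto
          finally show "(y j - x j)\<^sup>2 \<le> (1 + \<delta>) * (real_of_int (z j))\<^sup>2 + (1 + 1 / \<delta>)"
            using j by (simp add: x_def f_def algebra_simps)
        qed
        also have "\<dots> = (1 + \<delta>) * isq n z + (1 + 1 / \<delta>) * n"
          by (simp add: sum.distrib sum_distrib_left)
        also have "\<dots> \<le> a" unfolding a_def using sq[OF z(1)] \<delta> by (intro add_right_mono mult_left_mono) auto
        finally show ?thesis .
      qed
      ultimately show ?thesis using True by (auto simp: g_def)
    next
      case False
      have "sqnorm n (\<lambda>j. y j - (\<lambda>j\<in>{..<n}. 0) j) \<le> (\<Sum>j<n. (real p)\<^sup>2)"
        unfolding sqnorm_def
      proof (rule sum_mono)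
        fix j assume j: "j \<in> {..<n}"
        have "u j \<in> {0..<int p}" using PiE_mem[of u "{..<n}" "\<lambda>_. {0..<int p}" j] u j by (simp add: U_def)
        then have "0 \<le> u j" "u j + 1 \<le> int p" by auto
        then have "0 \<le> real_of_int (u j)" "real_of_int (u j) + 1 \<le> real p" by linarith+
        then have "0 \<le> y j" "y j \<le> p" using y[of j] j by (auto simp: floor_eq_iff)
        then show "(y j - (\<lambda>j\<in>{..<n}. 0) j)\<^sup>2 \<le> (real p)\<^sup>2" using j by (simp add: power_mono)
      qed
      then show ?thesis using False unfolding g_def by (intro bexI[OF _ zero_in_L]) simp
    qed
  qed
  also have "\<dots> \<le> (n * ((1 + \<delta>) * S / n + (1 + 1 / \<delta>) + F * (real p)\<^sup>2)) / (n * (real p powr (2 * m / n) / (1 + F)))"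
  proof (rule frac_le)
    have "(\<Sum>u\<in>U. g u) = a * G + n * (real p)\<^sup>2 * (real p ^ n - G)"
    proof -
      have "(\<Sum>u\<in>U. g u) = a * card (covered T) + n * (real p)\<^sup>2 * card (U - covered T)"
        unfolding g_def using finite_U sub
        by (subst sum.If_cases) (auto simp: Int_absorb1 Diff_eq mult_ac)
      also have "card (U - covered T) = p ^ n - card (covered T)"
        using finite_U sub by (simp add: card_Diff_subset finite_subset card_U)
      finally show ?thesis using card_mono[OF finite_U sub] by (simp add: G_def card_U of_nat_diff)
    qed
    also have "\<dots> \<le> a * real p ^ n + n * (real p)\<^sup>2 * (real p ^ n * F)"
      using a0 Gle bad by (intro add_mono mult_left_mono) auto
    finally have "(\<Sum>u\<in>U. g u) / real p ^ n \<le> a + n * (real p)\<^sup>2 * F"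
      using pos by (simp add: field_simps)
    moreover have "n * ((1 + \<delta>) * S / n + (1 + 1 / \<delta>) + F * (real p)\<^sup>2) = a + n * (real p)\<^sup>2 * F"
    proof -
      have "n * (x / n + y + z) = x + y * n + n * z" for x y z :: real
        using n by (simp add: field_simps)
      then show ?thesis by (simp add: a_def)
    qed
    ultimately show "(\<Sum>u\<in>U. g u) / real p ^ n \<le> n * ((1 + \<delta>) * S / n + (1 + 1 / \<delta>) + F * (real p)\<^sup>2)"
      by simp
    have "real p powr (2 * m / n) / (1 + F) \<le> real p powr (2 * m / n) / (1 + F) powr (2 / n)"
      using powr_mono[of "2 / n" 1 "1 + F"] n2 F0 Fpos by (intro divide_left_mono) auto
    also have "\<dots> = (real p ^ m / (1 + F)) powr (2 / n)"
      using pos Fpos by (simp add: powr_divide powr_realpow[symmetric] powr_powr mult_ac)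
    also have "\<dots> \<le> (real p ^ n / card C) powr (2 / n)"
      using vol pos Fpos by (intro powr_mono2) (auto simp: c_def)
    finally show "n * (real p powr (2 * m / n) / (1 + F)) \<le> n * (real p ^ n / card C) powr (2 / n)"
      by (intro mult_left_mono) auto
    show "0 \<le> n * ((1 + \<delta>) * S / n + (1 + 1 / \<delta>) + F * (real p)\<^sup>2)"
      using S \<delta> F0 by (intro mult_nonneg_nonneg add_nonneg_nonneg) auto
    show "0 < n * (real p powr (2 * m / n) / (1 + F))"
      using n pos Fpos by simp
  qed
  also have "\<dots> = ((1 + \<delta>) * S / n + (1 + 1 / \<delta>) + F * (real p)\<^sup>2) * (1 + F) / real p powr (2 * m / n)"
    using n by simp
  finally show ?thesis .
qed

end

section \<open>Random coefficients\<close>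

definition kernel :: "nat \<Rightarrow> nat \<Rightarrow> nat \<Rightarrow> (nat \<Rightarrow> nat \<Rightarrow> bool) \<Rightarrow> (nat \<times> nat \<Rightarrow> nat) \<Rightarrow> (nat \<Rightarrow> int) \<Rightarrow> bool" where
  "kernel n m p H h x \<longleftrightarrow>
     (\<forall>i<m. (\<Sum>j<n. (if H i j then int (h (i, j)) else 0) * (x j mod int p)) mod int p = 0)"

lemma kernel_iff:
  "kernel n m p H h x \<longleftrightarrow> (\<forall>i<m. int p dvd (\<Sum>j<n. (if H i j then int (h (i, j)) else 0) * x j))"
proof -
  have "(\<Sum>j<n. c j * (x j mod int p)) mod int p = (\<Sum>j<n. c j * x j) mod int p" for c :: "nat \<Rightarrow> int"
    by (subst (1 2) mod_sum_eq[symmetric]) (simp add: mod_mult_right_eq)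
  then show ?thesis by (simp add: kernel_def dvd_eq_mod_eq_0)
qed

lemma periodic_lattice_kernel:
  assumes "0 < n" "0 < p"
  shows "periodic_lattice n p (kernel n m p H h)"
proof
  fix x y
  assume "kernel n m p H h x" "kernel n m p H h y"
  then show "kernel n m p H h (\<lambda>j. x j - y j)"
    unfolding kernel_iff by (simp add: right_diff_distrib sum_subtractf dvd_diff)
next
  fix x y
  assume "kernel n m p H h x" and xy: "\<And>j. j < n \<Longrightarrow> x j mod int p = y j mod int p"
  moreover have "(\<Sum>j<n. (if H i j then int (h (i, j)) else 0) * (x j mod int p))
      = (\<Sum>j<n. (if H i j then int (h (i, j)) else 0) * (y j mod int p))" for i
    using xy by (intro sum.cong refl) auto
  ultimately show "kernel n m p H h y" unfolding kernel_def by simp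
qed (use assms in \<open>auto simp: kernel_def\<close>)

lemma lda_lattice_eq:
  assumes "0 < n" "0 < p"
  shows "lda_lattice n m p H h = periodic_lattice.L n (kernel n m p H h)"
  using periodic_lattice.L_def[OF periodic_lattice_kernel[OF assms]]
  by (simp add: lda_lattice_def kernel_def)

text \<open>The syndrome map sends \<open>U\<close> to at most p^m values, and each nonempty fibre
  lies in a translate of the kernel.\<close>

lemma card_kernel_lower:
  assumes "0 < n" "0 < p"
  shows "p ^ n \<le> card (periodic_lattice.C n p (kernel n m p H h)) * p ^ m"
proof -
  interpret periodic_lattice n p "kernel n m p H h" by (rule periodic_lattice_kernel[OF assms])
  define f where "f = (\<lambda>u. \<lambda>i\<in>{..<m}. (\<Sum>j<n. (if H i j then int (h (i, j)) else 0) * u j) mod int p)"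
  define S where "S = PiE {..<m} (\<lambda>_. {0..<int p})"
  have S: "finite S" "card S = p ^ m" by (auto simp: S_def card_PiE intro!: finite_PiE)
  have fib: "card {u\<in>U. f u = s} \<le> card C" for s
  proof (cases "\<exists>u0\<in>U. f u0 = s")
    case True
    then obtain u0 where u0: "u0 \<in> U" "f u0 = s" by auto
    have "{u\<in>U. f u = s} \<subseteq> {u\<in>U. kernel n m p H h (\<lambda>j. u j + (- u0 j))}"
    proof safe
      fix u assume "u \<in> U" "s = f u"
      then have e: "f u i = f u0 i" for i using u0 by simp
      show "kernel n m p H h (\<lambda>j. u j + (- u0 j))"
        unfolding kernel_iff
      proof (intro allI impI)
        fix i assume "i < m"
        then have "int p dvd (\<Sum>j<n. (if H i j then int (h (i, j)) else 0) * u j)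
            - (\<Sum>j<n. (if H i j then int (h (i, j)) else 0) * u0 j)"
          using e[of i] by (simp add: f_def mod_eq_dvd_iff)
        then show "int p dvd (\<Sum>j<n. (if H i j then int (h (i, j)) else 0) * (u j + - u0 j))"
          by (simp only: ring_distribs mult_minus_right sum.distrib sum_negf diff_conv_add_uminus)
      qed
    qed
    then have "card {u\<in>U. f u = s} \<le> card {u\<in>U. kernel n m p H h (\<lambda>j. u j + (- u0 j))}"
      using finite_U by (intro card_mono) auto
    then show ?thesis by (simp only: card_fiber)
  next
    case False
    then have e: "{u\<in>U. f u = s} = {}" by auto
    show ?thesis unfolding e by simp
  qed
  have "f ` U \<subseteq> S" using assms unfolding f_def S_def by (intro image_subsetI) (simp add: restrict_PiE_iff)
  then have "card U = (\<Sum>s\<in>S. card {u\<in>U. f u = s})"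
    using finite_U S(1) sum.group[of U S f "\<lambda>_. 1::nat"] by simp
  also have "\<dots> \<le> (\<Sum>s\<in>S. card C)" by (intro sum_mono fib)
  finally show ?thesis by (simp add: card_U S mult.commute)
qed

lemma finite_lda_coeffs: "finite (lda_coeffs n m p)"
  and card_lda_coeffs: "card (lda_coeffs n m p) = p ^ (m * n)"
  unfolding lda_coeffs_def by (auto intro!: finite_PiE simp: card_PiE)

text \<open>Each check touching the support of \<open>w\<close> has a coefficient determined by the others.\<close>
lemma card_kernel_coeffs:
  assumes p: "prime p"
  shows "card {h \<in> lda_coeffs n m p. kernel n m p H h w} * p ^ card (nbhd_var m H {j\<in>{..<n}. \<not> int p dvd w j}) \<le> p ^ (m * n)"
proof -
  define A where "A = nbhd_var m H {j\<in>{..<n}. \<not> int p dvd w j}"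
  have "\<forall>i\<in>A. \<exists>j. j < n \<and> \<not> int p dvd w j \<and> H i j" by (auto simp: A_def nbhd_var_def)
  \<comment> \<open>A pivot edge for each touched check, at a coordinate where w is invertible mod
    p. Pivots lie in different rows, so there are as many as touched checks, and forgetting them is
    injective on the solutions.\<close>
  then obtain J where J: "\<And>i. i \<in> A \<Longrightarrow> J i < n \<and> \<not> int p dvd w (J i) \<and> H i (J i)" by metis
  define D where "D = {..<m} \<times> {..<n}"
  define E where "E = (\<lambda>i. (i, J i)) ` A"
  have Am: "A \<subseteq> {..<m}" by (auto simp: A_def nbhd_var_def)
  then have finA: "finite A" by (rule finite_subset) simp
  have ED: "E \<subseteq> D" using J Am by (auto simp: E_def D_def)
  have cE: "card E = card A" unfolding E_def by (rule card_image) (auto simp: inj_on_def)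
  have finD: "finite D" "card D = m * n" by (auto simp: D_def)
  define S where "S = {h \<in> lda_coeffs n m p. kernel n m p H h w}"
  have hp: "h (i, j) < p" if "h \<in> S" "i < m" "j < n" for h i j
    using that PiE_mem[of h "{..<m} \<times> {..<n}" "\<lambda>_. {..<p}" "(i, j)"] by (auto simp: S_def lda_coeffs_def)
  have inj: "inj_on (\<lambda>h. restrict h (D - E)) S"
  proof (rule inj_onI)
    fix h h' assume h: "h \<in> S" and h': "h' \<in> S" and eq: "restrict h (D - E) = restrict h' (D - E)"
    have off: "h x = h' x" if "x \<in> D - E" for x
      using that eq by (metis restrict_apply')
    have onE: "h (i, J i) = h' (i, J i)" if i: "i \<in> A" for i
    proof -
      have im: "i < m" using i Am by auto
      let ?c = "\<lambda>h j. (if H i j then int (h (i, j)) else 0) * w j"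
      have "int p dvd (\<Sum>j<n. ?c h j) - (\<Sum>j<n. ?c h' j)"
        using h h' im unfolding S_def kernel_iff by (intro dvd_diff) auto
      also have "(\<Sum>j<n. ?c h j) - (\<Sum>j<n. ?c h' j) = (\<Sum>j<n. ?c h j - ?c h' j)"
        by (rule sum_subtractf[symmetric])
      also have "\<dots> = (\<Sum>j\<in>{J i}. ?c h j - ?c h' j)"
      proof (rule sum.mono_neutral_right)
        show "\<forall>j\<in>{..<n} - {J i}. ?c h j - ?c h' j = 0"
        proof
          fix j assume j: "j \<in> {..<n} - {J i}"
          then have "(i, j) \<in> D - E" using im by (auto simp: D_def E_def)
          then show "?c h j - ?c h' j = 0" using off by simp
        qed
      qed (use J[OF i] in auto)
      finally have "int p dvd (int (h (i, J i)) - int (h' (i, J i))) * w (J i)"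
        using J[OF i] by (simp add: algebra_simps)
      then have "int p dvd int (h (i, J i)) - int (h' (i, J i))"
        using J[OF i] p by (simp add: prime_dvd_mult_iff)
      then have "int (h (i, J i)) mod int p = int (h' (i, J i)) mod int p"
        by (simp add: mod_eq_dvd_iff)
      then show ?thesis using hp[OF h im, of "J i"] hp[OF h' im, of "J i"] J[OF i] by simp
    qed
    show "h = h'"
    proof (rule PiE_ext)
      show "h \<in> PiE D (\<lambda>_. {..<p})" "h' \<in> PiE D (\<lambda>_. {..<p})"
        using h h' by (auto simp: S_def lda_coeffs_def D_def)
      show "h x = h' x" if "x \<in> D" for x
        using that off[of x] onE by (cases "x \<in> E") (auto simp: E_def)
    qed
  qed
  have res: "restrict h (D - E) \<in> PiE (D - E) (\<lambda>_. {..<p})" if "h \<in> S" for h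
    using that unfolding restrict_PiE_iff S_def lda_coeffs_def D_def[symmetric] by auto
  have "card S = card ((\<lambda>h. restrict h (D - E)) ` S)" using inj by (rule card_image[symmetric])
  also have "\<dots> \<le> card (PiE (D - E) (\<lambda>_. {..<p}))"
    using finD res by (intro card_mono finite_PiE image_subsetI) auto
  also have "\<dots> = p ^ (m * n - card A)"
    using finD ED finA by (simp add: card_PiE card_Diff_subset finite_subset[OF ED] cE)
  finally have "card S * p ^ card A \<le> p ^ (m * n - card A) * p ^ card A" by (rule mult_right_mono) simp
  also have "\<dots> = p ^ (m * n)"
    using card_mono[OF finD(1) ED] finD cE by (simp flip: power_add)
  finally show ?thesis by (simp add: S_def A_def)
qed

abbreviation touched :: "nat \<Rightarrow> nat \<Rightarrow> nat \<Rightarrow> (nat \<Rightarrow> nat \<Rightarrow> bool) \<Rightarrow> (nat \<Rightarrow> int) \<Rightarrow> (nat \<Rightarrow> int) \<Rightarrow> nat" where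
  "touched n m p H z z' \<equiv> card (nbhd_var m H {j\<in>{..<n}. \<not> int p dvd z j - z' j})"

text \<open>\<open>card_kernel_coeffs\<close> bounds the probability of each pair by p^(-touched),
  which p^m turns into p^(m - touched). The -1 is spread over the pairs because the squared total
  weight is itself a double sum.\<close>

lemma excess_expectation:
  fixes w :: "(nat \<Rightarrow> int) \<Rightarrow> real"
  assumes p: "prime p" and T: "finite T" and w: "\<And>z. z \<in> T \<Longrightarrow> w z \<ge> 0" and W: "(\<Sum>z\<in>T. w z) > 0"
  shows "(\<Sum>h\<in>lda_coeffs n m p. real p ^ m * (pair_sum (kernel n m p H h) w T) / (\<Sum>z\<in>T. w z)\<^sup>2 - 1) / real p ^ (m * n)
    \<le> (\<Sum>z\<in>T. \<Sum>z'\<in>T. w z * w z' * (real p ^ (m - touched n m p H z z') - 1)) / (\<Sum>z\<in>T. w z)\<^sup>2"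
proof -
  define W where "W = (\<Sum>z\<in>T. w z)"
  define a where "a = (\<lambda>z z'. touched n m p H z z')"
  have am: "a z z' \<le> m" for z z'
    using card_mono[of "{..<m}" "nbhd_var m H {j\<in>{..<n}. \<not> int p dvd z j - z' j}"]
    by (auto simp: a_def nbhd_var_def)
  have p0: "real p > 0" using p prime_gt_0_nat by simp
  let ?cnt = "\<lambda>z z'. (\<Sum>h\<in>lda_coeffs n m p. of_bool (kernel n m p H h (\<lambda>j. z j - z' j)) :: real)"
  have cnt: "?cnt z z' * real p ^ m \<le> real p ^ (m * n) * real p ^ (m - a z z')" for z z'
  proof -
    have "?cnt z z' = real (card {h \<in> lda_coeffs n m p. kernel n m p H h (\<lambda>j. z j - z' j)})"
      using finite_lda_coeffs by (simp add: of_bool_def sum.If_cases Int_def)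
    then have "?cnt z z' * real p ^ a z z' \<le> real p ^ (m * n)"
      using card_kernel_coeffs[OF p, of n m H "\<lambda>j. z j - z' j"]
      unfolding a_def by (metis (no_types, lifting) of_nat_le_iff of_nat_mult of_nat_power)
    then have "?cnt z z' * real p ^ a z z' * real p ^ (m - a z z') \<le> real p ^ (m * n) * real p ^ (m - a z z')"
      by (intro mult_right_mono) auto
    then show ?thesis using am[of z z'] by (simp add: mult.assoc flip: power_add)
  qed
  have "(\<Sum>h\<in>lda_coeffs n m p. \<Sum>z\<in>T. \<Sum>z'\<in>T. w z * w z' * of_bool (kernel n m p H h (\<lambda>j. z j - z' j)))
      = (\<Sum>z\<in>T. \<Sum>h\<in>lda_coeffs n m p. \<Sum>z'\<in>T. w z * w z' * of_bool (kernel n m p H h (\<lambda>j. z j - z' j)))"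
    by (rule sum.swap)
  also have "\<dots> = (\<Sum>z\<in>T. \<Sum>z'\<in>T. \<Sum>h\<in>lda_coeffs n m p. w z * w z' * of_bool (kernel n m p H h (\<lambda>j. z j - z' j)))"
    by (intro sum.cong refl sum.swap)
  also have "\<dots> = (\<Sum>z\<in>T. \<Sum>z'\<in>T. w z * w z' * ?cnt z z')"
    by (simp only: sum_distrib_left)
  finally have swap: "(\<Sum>h\<in>lda_coeffs n m p. \<Sum>z\<in>T. \<Sum>z'\<in>T. w z * w z' * of_bool (kernel n m p H h (\<lambda>j. z j - z' j)))
      = (\<Sum>z\<in>T. \<Sum>z'\<in>T. w z * w z' * ?cnt z z')" .
  have "real p ^ m * (\<Sum>z\<in>T. \<Sum>z'\<in>T. w z * w z' * ?cnt z z') = (\<Sum>z\<in>T. \<Sum>z'\<in>T. w z * w z' * (?cnt z z' * real p ^ m))"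
    by (simp add: sum_distrib_left mult_ac)
  also have "\<dots> \<le> (\<Sum>z\<in>T. \<Sum>z'\<in>T. w z * w z' * (real p ^ (m * n) * real p ^ (m - a z z')))"
    using w by (intro sum_mono mult_left_mono cnt) auto
  also have "\<dots> = real p ^ (m * n) * (\<Sum>z\<in>T. \<Sum>z'\<in>T. w z * w z' * real p ^ (m - a z z'))"
    by (simp add: sum_distrib_left mult_ac)
  finally have le: "real p ^ m * (\<Sum>z\<in>T. \<Sum>z'\<in>T. w z * w z' * ?cnt z z') \<le> real p ^ (m * n) * (\<Sum>z\<in>T. \<Sum>z'\<in>T. w z * w z' * real p ^ (m - a z z'))" .
  have "(\<Sum>h\<in>lda_coeffs n m p. real p ^ m * (pair_sum (kernel n m p H h) w T) / W\<^sup>2 - 1)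
     = real p ^ m * (\<Sum>z\<in>T. \<Sum>z'\<in>T. w z * w z' * ?cnt z z') / W\<^sup>2 - real p ^ (m * n)"
    by (simp only: sum_subtractf sum_divide_distrib[symmetric] sum_distrib_left[symmetric] swap)
       (simp add: card_lda_coeffs)
  also have "\<dots> \<le> real p ^ (m * n) * (\<Sum>z\<in>T. \<Sum>z'\<in>T. w z * w z' * real p ^ (m - a z z')) / W\<^sup>2 - real p ^ (m * n)"
    using le by (intro diff_right_mono divide_right_mono) auto
  finally have "(\<Sum>h\<in>lda_coeffs n m p. real p ^ m * (pair_sum (kernel n m p H h) w T) / W\<^sup>2 - 1) / real p ^ (m * n)
     \<le> (real p ^ (m * n) * (\<Sum>z\<in>T. \<Sum>z'\<in>T. w z * w z' * real p ^ (m - a z z')) / W\<^sup>2 - real p ^ (m * n)) / real p ^ (m * n)"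
    by (rule divide_right_mono) simp
  also have "\<dots> = (\<Sum>z\<in>T. \<Sum>z'\<in>T. w z * w z' * real p ^ (m - a z z')) / W\<^sup>2 - 1"
    using p0 by (simp add: diff_divide_distrib)
  also have "\<dots> = ((\<Sum>z\<in>T. \<Sum>z'\<in>T. w z * w z' * real p ^ (m - a z z')) - W * W) / W\<^sup>2"
    using W by (simp add: W_def power2_eq_square diff_divide_distrib)
  also have "W * W = (\<Sum>z\<in>T. \<Sum>z'\<in>T. w z * w z')" unfolding W_def by (rule sum_product)
  also have "(\<Sum>z\<in>T. \<Sum>z'\<in>T. w z * w z' * real p ^ (m - a z z')) - (\<Sum>z\<in>T. \<Sum>z'\<in>T. w z * w z')
      = (\<Sum>z\<in>T. \<Sum>z'\<in>T. w z * w z' * (real p ^ (m - a z z') - 1))"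
    by (simp add: sum_subtractf right_diff_distrib)
  finally show ?thesis by (simp add: W_def a_def)
qed

section \<open>Pairs of Gaussian vectors and expansion\<close>

definition int_box :: "nat \<Rightarrow> nat \<Rightarrow> (nat \<Rightarrow> int) set" where
  "int_box n k = PiE {..<n} (\<lambda>_. {- int k..int k})"

definition gauss_weight :: "nat \<Rightarrow> real \<Rightarrow> (nat \<Rightarrow> int) \<Rightarrow> real" where
  "gauss_weight n \<tau> z = exp (- \<tau> * isq n z)"

lemma finite_int_box: "finite (int_box n k)"
  unfolding int_box_def by (intro finite_PiE) auto

lemma gauss_weight_eq_prod: "gauss_weight n \<tau> z = (\<Prod>j<n. exp (- \<tau> * (real_of_int (z j))\<^sup>2))"
  by (simp add: gauss_weight_def sum_distrib_left exp_sum flip: sum_negf)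

lemma gauss_weight_pos: "gauss_weight n \<tau> z > 0"
  by (simp add: gauss_weight_def)

lemma sum_int_box_prod:
  fixes f :: "nat \<Rightarrow> int \<Rightarrow> real"
  shows "(\<Sum>z\<in>int_box n k. \<Prod>j<n. f j (z j)) = (\<Prod>j<n. \<Sum>a\<in>{- int k..int k}. f j a)"
  unfolding int_box_def by (rule prod_sum_PiE[symmetric]) auto

lemma sum_gauss_weight: "(\<Sum>z\<in>int_box n k. gauss_weight n \<tau> z) = gauss_sum k \<tau> ^ n"
  unfolding gauss_weight_eq_prod by (subst sum_int_box_prod) (simp add: gauss_sum_def)

lemma of_bool_ball_eq_prod:
  fixes n :: nat
  assumes "Z \<subseteq> {..<n}"
  shows "of_bool (\<forall>j\<in>Z. P j) = (\<Prod>j<n. if j \<in> Z then of_bool (P j) else (1::real))"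
proof (cases "\<forall>j\<in>Z. P j")
  case True
  then have "(\<Prod>j<n. if j \<in> Z then of_bool (P j) else (1::real)) = 1"
    by (intro prod.neutral) auto
  then show ?thesis using True by simp
next
  case False
  then obtain j where "j \<in> Z" "\<not> P j" by auto
  then have "(\<Prod>j<n. if j \<in> Z then of_bool (P j) else (1::real)) = 0"
    using assms by (intro prod_zero) auto
  then show ?thesis using False by (simp only: of_bool_eq)
qed

lemma prod_if_const:
  fixes n :: nat
  assumes "Z \<subseteq> {..<n}"
  shows "(\<Prod>j<n. if j \<in> Z then a else (b::real)) = a ^ card Z * b ^ (n - card Z)"
proof -
  have "card ({..<n} - Z) = n - card Z"
    using assms by (subst card_Diff_subset) (auto intro: finite_subset)
  then show ?thesis
    using assms by (subst prod.If_cases) (auto simp: Int_absorb1 Diff_eq)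
qed

text \<open>Weights and agreement indicator are products over coordinates. A coordinate in Z
  contributes the sum of squared weights, which is a Gaussian sum with doubled parameter.\<close>

lemma collision_sum:
  assumes Z: "Z \<subseteq> {..<n}"
  shows "(\<Sum>z\<in>int_box n k. \<Sum>z'\<in>int_box n k. gauss_weight n \<tau> z * gauss_weight n \<tau> z' * of_bool (\<forall>j\<in>Z. z j = z' j))
    = gauss_sum k (2 * \<tau>) ^ card Z * ((gauss_sum k \<tau>)\<^sup>2) ^ (n - card Z)"
proof -
  let ?e = "\<lambda>a::int. exp (- \<tau> * (real_of_int a)\<^sup>2)"
  have inner: "(\<Sum>z'\<in>int_box n k. gauss_weight n \<tau> z' * of_bool (\<forall>j\<in>Z. z j = z' j))
      = (\<Prod>j<n. if j \<in> Z then ?e (z j) else gauss_sum k \<tau>)" if z: "z \<in> int_box n k" for z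
  proof -
    have "(\<Sum>z'\<in>int_box n k. gauss_weight n \<tau> z' * of_bool (\<forall>j\<in>Z. z j = z' j))
        = (\<Sum>z'\<in>int_box n k. \<Prod>j<n. ?e (z' j) * (if j \<in> Z then of_bool (z j = z' j) else 1))"
      unfolding gauss_weight_eq_prod of_bool_ball_eq_prod[OF Z] by (simp only: prod.distrib)
    also have "\<dots> = (\<Prod>j<n. \<Sum>a\<in>{- int k..int k}. ?e a * (if j \<in> Z then of_bool (z j = a) else 1))"
      by (rule sum_int_box_prod)
    also have "\<dots> = (\<Prod>j<n. if j \<in> Z then ?e (z j) else gauss_sum k \<tau>)"
    proof (intro prod.cong refl)
      fix j assume j: "j \<in> {..<n}"
      have "z j \<in> {- int k..int k}" using z j unfolding int_box_def by (rule PiE_mem)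
      then have "(\<Sum>a\<in>{- int k..int k}. ?e a * of_bool (z j = a)) = ?e (z j)"
        by (subst sum.remove[of _ "z j"]) auto
      then show "(\<Sum>a\<in>{- int k..int k}. ?e a * (if j \<in> Z then of_bool (z j = a) else 1))
          = (if j \<in> Z then ?e (z j) else gauss_sum k \<tau>)"
        by (simp add: gauss_sum_def)
    qed
    finally show ?thesis .
  qed
  have "(\<Sum>z\<in>int_box n k. \<Sum>z'\<in>int_box n k. gauss_weight n \<tau> z * gauss_weight n \<tau> z' * of_bool (\<forall>j\<in>Z. z j = z' j))
      = (\<Sum>z\<in>int_box n k. \<Prod>j<n. ?e (z j) * (if j \<in> Z then ?e (z j) else gauss_sum k \<tau>))"
    by (intro sum.cong refl) (simp only: mult.assoc sum_distrib_left[symmetric] inner, simp only: gauss_weight_eq_prod prod.distrib)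
  also have "\<dots> = (\<Prod>j<n. \<Sum>a\<in>{- int k..int k}. ?e a * (if j \<in> Z then ?e a else gauss_sum k \<tau>))"
    by (rule sum_int_box_prod)
  also have "\<dots> = (\<Prod>j<n. if j \<in> Z then gauss_sum k (2 * \<tau>) else (gauss_sum k \<tau>)\<^sup>2)"
  proof (intro prod.cong refl)
    fix j
    have "?e a * ?e a = exp (- (2 * \<tau>) * (real_of_int a)\<^sup>2)" for a by (simp flip: exp_add)
    then show "(\<Sum>a\<in>{- int k..int k}. ?e a * (if j \<in> Z then ?e a else gauss_sum k \<tau>))
        = (if j \<in> Z then gauss_sum k (2 * \<tau>) else (gauss_sum k \<tau>)\<^sup>2)"
      by (simp add: gauss_sum_def power2_eq_square flip: sum_distrib_right)
  qed
  finally show ?thesis by (simp add: prod_if_const[OF Z])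
qed

lemma card_int_abs_le:
  fixes \<rho> :: real
  assumes "\<rho> \<ge> 0"
  shows "finite {a::int. \<bar>real_of_int a\<bar> \<le> \<rho>}" "real (card {a::int. \<bar>real_of_int a\<bar> \<le> \<rho>}) \<le> 2 * \<rho> + 1"
proof -
  have e: "{a::int. \<bar>real_of_int a\<bar> \<le> \<rho>} = {- \<lfloor>\<rho>\<rfloor>..\<lfloor>\<rho>\<rfloor>}"
    by (auto simp: le_floor_iff abs_le_iff) (simp_all add: minus_le_iff le_floor_iff)
  show "finite {a::int. \<bar>real_of_int a\<bar> \<le> \<rho>}" unfolding e by simp
  have "\<lfloor>\<rho>\<rfloor> \<ge> 0" using assms by simp
  then have "real (card {- \<lfloor>\<rho>\<rfloor>..\<lfloor>\<rho>\<rfloor>}) = 2 * of_int \<lfloor>\<rho>\<rfloor> + 1" by simp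
  then show "real (card {a::int. \<bar>real_of_int a\<bar> \<le> \<rho>}) \<le> 2 * \<rho> + 1"
    unfolding e by linarith
qed

text \<open>Two counts for the vectors of T that agree with z off S. The first bounds each free
  coordinate by the radius and serves small S. The second pays exp(tau rho^2) once, but then only
  one Gaussian sum per free coordinate, and serves large S.\<close>

lemma neighbour_count:
  fixes z :: "nat \<Rightarrow> int"
  assumes S: "S \<subseteq> {..<n}" and T: "T \<subseteq> int_box n k"
    and sq: "\<And>z. z \<in> T \<Longrightarrow> isq n z \<le> \<rho>\<^sup>2" and \<rho>: "\<rho> \<ge> 0" and \<tau>: "\<tau> \<ge> 0"
  shows "(\<Sum>z'\<in>T. of_bool (\<forall>j\<in>{..<n} - S. z j = z' j)) \<le> (2 * \<rho> + 1) ^ card S"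
    and "(\<Sum>z'\<in>T. of_bool (\<forall>j\<in>{..<n} - S. z j = z' j)) \<le> exp (\<tau> * \<rho>\<^sup>2) * gauss_sum k \<tau> ^ card S"
proof -
  have finT: "finite T" using T finite_int_box finite_subset by blast
  \<comment> \<open>Rankin's trick: any f with 1 <= c times the product of f over S majorises the
    indicator of T, and the enlarged sum over the box factors. The indicator of |a| <= rho and the
    Gaussian are the two choices of f.\<close>
  have general: "(\<Sum>z'\<in>T. of_bool (\<forall>j\<in>{..<n} - S. z j = z' j)) \<le> c * x ^ card S"
    if f0: "\<And>a. f a \<ge> (0::real)" and fx: "(\<Sum>a\<in>{- int k..int k}. f a) \<le> x" and c: "c \<ge> 0"
      and fT: "\<And>z'. z' \<in> T \<Longrightarrow> 1 \<le> c * (\<Prod>j\<in>S. f (z' j))" for f c x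
  proof -
    have "(\<Sum>z'\<in>T. of_bool (\<forall>j\<in>{..<n} - S. z j = z' j))
        \<le> (\<Sum>z'\<in>T. c * (\<Prod>j<n. if j \<in> S then f (z' j) else of_bool (z j = z' j)))"
    proof (rule sum_mono)
      fix z' assume z': "z' \<in> T"
      have "(\<Prod>j<n. if j \<in> S then f (z' j) else of_bool (z j = z' j))
          = (\<Prod>j\<in>S. f (z' j)) * (\<Prod>j\<in>{..<n} - S. of_bool (z j = z' j))"
        using S by (subst prod.If_cases) (auto simp: Int_absorb1 Diff_eq)
      also have "(\<Prod>j\<in>{..<n} - S. of_bool (z j = z' j)) = (of_bool (\<forall>j\<in>{..<n} - S. z j = z' j) :: real)"
        by (auto intro!: prod.neutral prod_zero)
      finally have e: "(\<Prod>j<n. if j \<in> S then f (z' j) else of_bool (z j = z' j))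
          = (\<Prod>j\<in>S. f (z' j)) * of_bool (\<forall>j\<in>{..<n} - S. z j = z' j)" .
      show "of_bool (\<forall>j\<in>{..<n} - S. z j = z' j)
          \<le> c * (\<Prod>j<n. if j \<in> S then f (z' j) else of_bool (z j = z' j))"
        unfolding e
        using fT[OF z'] by (cases "\<forall>j\<in>{..<n} - S. z j = z' j") simp_all
    qed
    also have "\<dots> \<le> (\<Sum>z'\<in>int_box n k. c * (\<Prod>j<n. if j \<in> S then f (z' j) else of_bool (z j = z' j)))"
      using T f0 c by (intro sum_mono2 finite_int_box) (auto intro!: mult_nonneg_nonneg prod_nonneg)
    also have "\<dots> = c * (\<Prod>j<n. \<Sum>a\<in>{- int k..int k}. if j \<in> S then f a else of_bool (z j = a))"
      by (subst sum_distrib_left[symmetric], subst sum_int_box_prod) simp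
    also have "\<dots> \<le> c * (\<Prod>j<n. if j \<in> S then x else 1)"
    proof (intro mult_left_mono[OF _ c] prod_mono conjI)
      fix j
      have "(\<Sum>a\<in>{- int k..int k}. of_bool (z j = a)) \<le> (1::real)"
      proof -
        have "(\<Sum>a\<in>{- int k..int k}. of_bool (z j = a)) = (\<Sum>a\<in>{- int k..int k}. if z j = a then 1 else (0::real))"
          by (intro sum.cong) auto
        also have "\<dots> \<le> 1" by (simp add: sum.delta')
        finally show ?thesis .
      qed
      then show "(\<Sum>a\<in>{- int k..int k}. if j \<in> S then f a else of_bool (z j = a)) \<le> (if j \<in> S then x else 1)"
        using fx by simp
      show "0 \<le> (\<Sum>a\<in>{- int k..int k}. if j \<in> S then f a else of_bool (z j = a))"
        using f0 by (intro sum_nonneg) auto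
    qed
    also have "\<dots> = c * x ^ card S" by (simp add: prod_if_const[OF S])
    finally show ?thesis .
  qed
  have part: "(\<Sum>j\<in>S. (real_of_int (z' j))\<^sup>2) \<le> \<rho>\<^sup>2" if "z' \<in> T" for z'
    using sum_mono2[of "{..<n}" S "\<lambda>j. (real_of_int (z' j))\<^sup>2"] S sq[OF that] by simp
  have "(\<Sum>z'\<in>T. of_bool (\<forall>j\<in>{..<n} - S. z j = z' j)) \<le> 1 * (2 * \<rho> + 1) ^ card S"
  proof (rule general[where f="\<lambda>a. of_bool (\<bar>real_of_int a\<bar> \<le> \<rho>)"])
    have "(\<Sum>a\<in>{- int k..int k}. of_bool (\<bar>real_of_int a\<bar> \<le> \<rho>)) = real (card {a\<in>{- int k..int k}. \<bar>real_of_int a\<bar> \<le> \<rho>})"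
      by (simp add: of_bool_def sum.If_cases Int_def)
    also have "\<dots> \<le> real (card {a::int. \<bar>real_of_int a\<bar> \<le> \<rho>})"
      using card_int_abs_le[OF \<rho>] by (intro of_nat_mono card_mono) auto
    also have "\<dots> \<le> 2 * \<rho> + 1" by (rule card_int_abs_le[OF \<rho>])
    finally show "(\<Sum>a\<in>{- int k..int k}. of_bool (\<bar>real_of_int a\<bar> \<le> \<rho>)) \<le> 2 * \<rho> + 1" .
    fix z' assume z': "z' \<in> T"
    have "\<bar>real_of_int (z' j)\<bar> \<le> \<rho>" if "j \<in> S" for j
    proof -
      have "(real_of_int (z' j))\<^sup>2 \<le> (\<Sum>j\<in>S. (real_of_int (z' j))\<^sup>2)"
        using that S by (intro member_le_sum) (auto intro: finite_subset)
      then have "(real_of_int (z' j))\<^sup>2 \<le> \<rho>\<^sup>2" using part[OF z'] by linarith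
      then show ?thesis using \<rho> by (metis abs_le_square_iff abs_of_nonneg)
    qed
    then show "1 \<le> 1 * (\<Prod>j\<in>S. of_bool (\<bar>real_of_int (z' j)\<bar> \<le> \<rho>) :: real)" by simp
  qed auto
  then show "(\<Sum>z'\<in>T. of_bool (\<forall>j\<in>{..<n} - S. z j = z' j)) \<le> (2 * \<rho> + 1) ^ card S" by simp
  show "(\<Sum>z'\<in>T. of_bool (\<forall>j\<in>{..<n} - S. z j = z' j)) \<le> exp (\<tau> * \<rho>\<^sup>2) * gauss_sum k \<tau> ^ card S"
  proof (rule general[where f="\<lambda>a. exp (- \<tau> * (real_of_int a)\<^sup>2)"])
    fix z' assume z': "z' \<in> T"
    have fS: "finite S" using S finite_subset by blast
    have "0 \<le> \<tau> * (\<rho>\<^sup>2 - (\<Sum>j\<in>S. (real_of_int (z' j))\<^sup>2))" using part[OF z'] \<tau> by simp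
    then have "1 \<le> exp (\<tau> * (\<rho>\<^sup>2 - (\<Sum>j\<in>S. (real_of_int (z' j))\<^sup>2)))" by simp
    also have "\<dots> = exp (\<tau> * \<rho>\<^sup>2) * exp (\<Sum>j\<in>S. - \<tau> * (real_of_int (z' j))\<^sup>2)"
      by (simp add: right_diff_distrib sum_negf sum_distrib_left flip: exp_add)
    also have "\<dots> = exp (\<tau> * \<rho>\<^sup>2) * (\<Prod>j\<in>S. exp (- \<tau> * (real_of_int (z' j))\<^sup>2))"
      by (simp only: exp_sum[OF fS])
    finally show "1 \<le> exp (\<tau> * \<rho>\<^sup>2) * (\<Prod>j\<in>S. exp (- \<tau> * (real_of_int (z' j))\<^sup>2))" .
  qed (auto simp: gauss_sum_def)
qed

section \<open>Splitting pairs by their untouched checks\<close>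

lemma finite_nbhd_var: "finite (nbhd_var m H S)" and nbhd_var_subset: "nbhd_var m H S \<subseteq> {..<m}"
  by (auto simp: nbhd_var_def)

lemma nbhd_chk_subset: "nbhd_chk n H X \<subseteq> {..<n}"
  by (auto simp: nbhd_chk_def)

text \<open>A larger S would contain a subset of exactly ceil(m/(2 alpha)) variables, to which (L2)
  still applies and which already has m/2 neighbours.\<close>

lemma small_support_if_few_checks:
  assumes good: "good_graph n m H \<alpha> A \<beta> B \<epsilon> \<theta>" and \<alpha>: "\<alpha> > 0"
    and S: "S \<subseteq> {..<n}" and few: "2 * card (nbhd_var m H S) < m"
  shows "real (card S) \<le> of_int \<lceil>real m / (2 * \<alpha>)\<rceil>"
proof (rule ccontr)
  assume neg: "\<not> ?thesis"
  define k where "k = nat \<lceil>real m / (2 * \<alpha>)\<rceil>"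
  have "-1 < real m / (2 * \<alpha>)" by (rule less_le_trans[of _ 0]) (use \<alpha> in auto)
  then have "\<lceil>real m / (2 * \<alpha>)\<rceil> \<ge> 0" by simp
  then have k: "real k = of_int \<lceil>real m / (2 * \<alpha>)\<rceil>" by (simp add: k_def)
  then have "k \<le> card S" using neg by linarith
  then obtain S' where S': "S' \<subseteq> S" "card S' = k" by (rule obtain_subset_with_card_n)
  have L2: "\<alpha> * real (card S') \<le> real (card (nbhd_var m H S'))"
    using good S S' k unfolding good_graph_def by (metis order.trans order_refl)
  have "real m / (2 * \<alpha>) \<le> k" unfolding k by linarith
  then have "real m / 2 \<le> \<alpha> * k" using \<alpha> by (simp add: field_simps)
  also have "\<dots> \<le> card (nbhd_var m H S')" using L2 S' by simp
  also have "\<dots> \<le> card (nbhd_var m H S)"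
    using S'(1) finite_nbhd_var by (intro of_nat_mono card_mono) (auto simp: nbhd_var_def)
  finally show False using few by linarith
qed

text \<open>Let S be the support of z - z' and X the checks it leaves untouched. If X is empty the
  left side is 0. If X has at most m/2 elements, z and z' agree on its neighbours and X contributes
  its own term to the first sum. Otherwise S touches few checks, is small by (L2), and appears in
  the second sum. Summing over all X and S frees the index from the pair, so that pairs can be
  summed first.\<close>

lemma pair_excess_pointwise:
  assumes good: "good_graph n m H \<alpha> A \<beta> B \<epsilon> \<theta>" and \<alpha>: "\<alpha> > 0" and p: "p > 0"
    and nowrap: "\<And>j. j < n \<Longrightarrow> int p dvd z j - z' j \<Longrightarrow> z j = z' j"
  shows "real p ^ (m - touched n m p H z z') - 1
    \<le> (\<Sum>X | X \<subseteq> {..<m} \<and> X \<noteq> {} \<and> 2 * card X \<le> m. real p ^ card X * of_bool (\<forall>j\<in>nbhd_chk n H X. z j = z' j))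
      + (\<Sum>S | S \<subseteq> {..<n} \<and> real (card S) \<le> of_int \<lceil>real m / (2 * \<alpha>)\<rceil>. real p ^ (m - card (nbhd_var m H S)) * of_bool (\<forall>j\<in>{..<n} - S. z j = z' j))"
    (is "_ \<le> sum ?f ?X + sum ?g ?S")
proof -
  define S where "S = {j\<in>{..<n}. z j \<noteq> z' j}"
  define X where "X = {..<m} - nbhd_var m H S"
  have "{j\<in>{..<n}. \<not> int p dvd z j - z' j} = S"
    using nowrap by (auto simp: S_def)
  moreover have cX: "card X = m - card (nbhd_var m H S)"
    using nbhd_var_subset[of m H S] finite_nbhd_var by (simp add: X_def card_Diff_subset)
  ultimately have lhs: "m - touched n m p H z z' = card X" by simp
  have "?X \<subseteq> Pow {..<m}" "?S \<subseteq> Pow {..<n}" by auto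
  then have fin: "finite ?X" "finite ?S" by (auto intro: finite_subset)
  have nn: "0 \<le> sum ?f ?X" "0 \<le> sum ?g ?S" by (auto intro!: sum_nonneg)
  have Xm: "X \<subseteq> {..<m}" by (auto simp: X_def)
  consider "X = {}" | "X \<noteq> {}" "2 * card X \<le> m" | "2 * card X > m" by linarith
  then show ?thesis
  proof cases
    case 1
    then show ?thesis using nn unfolding lhs by simp
  next
    case 2
    have "\<forall>j\<in>nbhd_chk n H X. z j = z' j"
      by (auto simp: nbhd_chk_def nbhd_var_def X_def S_def)
    then have "real p ^ card X = ?f X" by simp
    also have "\<dots> \<le> sum ?f ?X"
      using 2 Xm fin by (intro member_le_sum) auto
    finally show ?thesis using nn unfolding lhs by linarith
  next
    case 3
    have few: "2 * card (nbhd_var m H S) < m" using 3 cX by linarith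
    have Sn: "S \<subseteq> {..<n}" by (auto simp: S_def)
    have "S \<in> ?S" using small_support_if_few_checks[OF good \<alpha> Sn few] Sn by simp
    moreover have "\<forall>j\<in>{..<n} - S. z j = z' j" by (auto simp: S_def)
    then have "real p ^ card X = ?g S" by (simp add: cX)
    moreover have "?g S \<le> sum ?g ?S"
      by (rule member_le_sum) (use \<open>S \<in> ?S\<close> fin in auto)
    ultimately show ?thesis using nn unfolding lhs by linarith
  qed
qed

lemma sum_mult_divide: "(\<Sum>x\<in>I. f x * g x) / c = (\<Sum>x\<in>I. f x * (g x / c :: real))"
  by (simp add: sum_divide_distrib)

text \<open>In the first sum T is enlarged to the box, where \<open>collision_sum\<close> is exact;
  the factor 4 is the square of the 2 lost in the total weight W. In the second, one weight is
  replaced by its maximum M, its vectors are counted by \<open>cnt\<close>, and the other weight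
  sums to W.\<close>

lemma pair_excess_sum:
  fixes \<tau> :: real and n :: nat
  defines "w \<equiv> gauss_weight n \<tau>"
  assumes good: "good_graph n m H \<alpha> A \<beta> B \<epsilon> \<theta>" and \<alpha>: "\<alpha> > 0" and p: "p > 0"
    and T: "T \<subseteq> int_box n k"
    and nowrap: "\<And>z z' j. z \<in> T \<Longrightarrow> z' \<in> T \<Longrightarrow> j < n \<Longrightarrow> int p dvd z j - z' j \<Longrightarrow> z j = z' j"
    and N: "gauss_sum k \<tau> > 0"
    and W: "(\<Sum>z\<in>T. w z) \<ge> gauss_sum k \<tau> ^ n / 2"
    and M: "\<And>z. z \<in> T \<Longrightarrow> w z \<le> M"
    and cnt: "\<And>z S. z \<in> T \<Longrightarrow> S \<subseteq> {..<n} \<Longrightarrow> (\<Sum>z'\<in>T. of_bool (\<forall>j\<in>{..<n} - S. z j = z' j)) \<le> cnt S"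
  shows "(\<Sum>z\<in>T. \<Sum>z'\<in>T. w z * w z' * (real p ^ (m - touched n m p H z z') - 1)) / (\<Sum>z\<in>T. w z)\<^sup>2
    \<le> (\<Sum>X | X \<subseteq> {..<m} \<and> X \<noteq> {} \<and> 2 * card X \<le> m. 4 * real p ^ card X * (gauss_sum k (2 * \<tau>) / (gauss_sum k \<tau>)\<^sup>2) ^ card (nbhd_chk n H X))
      + (\<Sum>S | S \<subseteq> {..<n} \<and> real (card S) \<le> of_int \<lceil>real m / (2 * \<alpha>)\<rceil>. real p ^ (m - card (nbhd_var m H S)) * (M / (\<Sum>z\<in>T. w z) * cnt S))"
    (is "_ \<le> sum _ ?X + sum _ ?S")
proof -
  define N where "N = gauss_sum k \<tau>"
  define N2 where "N2 = gauss_sum k (2 * \<tau>)"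
  define W' where "W' = (\<Sum>z\<in>T. w z)"
  have N0: "N > 0" using N by (simp add: N_def)
  then have "N ^ n / 2 > 0" by simp
  then have W0: "W' > 0" using W unfolding W'_def N_def by linarith
  have wpos: "w z > 0" for z by (simp add: w_def gauss_weight_pos)
  let ?c = "\<lambda>Z z z'. of_bool (\<forall>j\<in>Z. z j = z' j) :: real"
  have "(\<Sum>z\<in>T. \<Sum>z'\<in>T. w z * w z' * (real p ^ (m - touched n m p H z z') - 1))
      \<le> (\<Sum>z\<in>T. \<Sum>z'\<in>T. w z * w z' * ((\<Sum>X\<in>?X. real p ^ card X * ?c (nbhd_chk n H X) z z') + (\<Sum>S\<in>?S. real p ^ (m - card (nbhd_var m H S)) * ?c ({..<n} - S) z z')))"
  proof (intro sum_mono)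
    fix z z' assume zz: "z \<in> T" "z' \<in> T"
    show "w z * w z' * (real p ^ (m - touched n m p H z z') - 1)
      \<le> w z * w z' * ((\<Sum>X\<in>?X. real p ^ card X * ?c (nbhd_chk n H X) z z') + (\<Sum>S\<in>?S. real p ^ (m - card (nbhd_var m H S)) * ?c ({..<n} - S) z z'))"
    proof (rule mult_left_mono)
      show "0 \<le> w z * w z'" using wpos[of z] wpos[of z'] by simp
    qed (rule pair_excess_pointwise[OF good \<alpha> p], rule nowrap[OF zz])
  qed
  also have "\<dots> = (\<Sum>z\<in>T. \<Sum>z'\<in>T. \<Sum>X\<in>?X. real p ^ card X * (w z * w z' * ?c (nbhd_chk n H X) z z'))
     + (\<Sum>z\<in>T. \<Sum>z'\<in>T. \<Sum>S\<in>?S. real p ^ (m - card (nbhd_var m H S)) * (w z * w z' * ?c ({..<n} - S) z z'))"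
    by (simp only: distrib_left sum.distrib sum_distrib_left mult_ac)
  also have "(\<Sum>z\<in>T. \<Sum>z'\<in>T. \<Sum>X\<in>?X. real p ^ card X * (w z * w z' * ?c (nbhd_chk n H X) z z'))
     = (\<Sum>X\<in>?X. real p ^ card X * (\<Sum>z\<in>T. \<Sum>z'\<in>T. w z * w z' * ?c (nbhd_chk n H X) z z'))"
    by (simp only: sum_distrib_left sum.swap[of _ ?X T])
  also have "(\<Sum>z\<in>T. \<Sum>z'\<in>T. \<Sum>S\<in>?S. real p ^ (m - card (nbhd_var m H S)) * (w z * w z' * ?c ({..<n} - S) z z'))
     = (\<Sum>S\<in>?S. real p ^ (m - card (nbhd_var m H S)) * (\<Sum>z\<in>T. \<Sum>z'\<in>T. w z * w z' * ?c ({..<n} - S) z z'))"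
    by (simp only: sum_distrib_left sum.swap[of _ ?S T])
  finally have "(\<Sum>z\<in>T. \<Sum>z'\<in>T. w z * w z' * (real p ^ (m - touched n m p H z z') - 1)) / W'\<^sup>2
      \<le> ((\<Sum>X\<in>?X. real p ^ card X * (\<Sum>z\<in>T. \<Sum>z'\<in>T. w z * w z' * ?c (nbhd_chk n H X) z z'))
    + (\<Sum>S\<in>?S. real p ^ (m - card (nbhd_var m H S)) * (\<Sum>z\<in>T. \<Sum>z'\<in>T. w z * w z' * ?c ({..<n} - S) z z'))) / W'\<^sup>2"
    by (rule divide_right_mono) simp
  then have "(\<Sum>z\<in>T. \<Sum>z'\<in>T. w z * w z' * (real p ^ (m - touched n m p H z z') - 1)) / W'\<^sup>2
    \<le> (\<Sum>X\<in>?X. real p ^ card X * ((\<Sum>z\<in>T. \<Sum>z'\<in>T. w z * w z' * ?c (nbhd_chk n H X) z z') / W'\<^sup>2))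
    + (\<Sum>S\<in>?S. real p ^ (m - card (nbhd_var m H S)) * ((\<Sum>z\<in>T. \<Sum>z'\<in>T. w z * w z' * ?c ({..<n} - S) z z') / W'\<^sup>2))"
    unfolding add_divide_distrib sum_mult_divide[of _ _ ?X] sum_mult_divide[of _ _ ?S] .
  also have "\<dots> \<le> (\<Sum>X\<in>?X. real p ^ card X * (4 * (N2 / N\<^sup>2) ^ card (nbhd_chk n H X)))
      + (\<Sum>S\<in>?S. real p ^ (m - card (nbhd_var m H S)) * (M / W' * cnt S))"
  proof (intro add_mono sum_mono mult_left_mono)
    fix X
    let ?Z = "nbhd_chk n H X"
    have Z: "card ?Z \<le> n" using card_mono[OF _ nbhd_chk_subset, of n H X] by simp
    have "(\<Sum>z\<in>T. \<Sum>z'\<in>T. w z * w z' * ?c ?Z z z') \<le> (\<Sum>z\<in>int_box n k. \<Sum>z'\<in>int_box n k. w z * w z' * ?c ?Z z z')"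
    proof -
      have "(\<Sum>z\<in>T. \<Sum>z'\<in>T. w z * w z' * ?c ?Z z z') \<le> (\<Sum>z\<in>T. \<Sum>z'\<in>int_box n k. w z * w z' * ?c ?Z z z')"
        by (intro sum_mono sum_mono2 finite_int_box T) (auto intro!: mult_nonneg_nonneg less_imp_le[OF wpos])
      also have "\<dots> \<le> (\<Sum>z\<in>int_box n k. \<Sum>z'\<in>int_box n k. w z * w z' * ?c ?Z z z')"
        by (intro sum_mono2 finite_int_box T) (auto intro!: sum_nonneg mult_nonneg_nonneg less_imp_le[OF wpos])
      finally show ?thesis .
    qed
    also have "\<dots> = N2 ^ card ?Z * (N\<^sup>2) ^ (n - card ?Z)"
      unfolding w_def N_def N2_def by (rule collision_sum[OF nbhd_chk_subset])
    also have "\<dots> = (N2 / N\<^sup>2) ^ card ?Z * (N\<^sup>2) ^ n"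
      using Z N0 by (simp add: power_diff power_divide)
    also have "\<dots> = (N2 / N\<^sup>2) ^ card ?Z * (4 * (N ^ n / 2)\<^sup>2)"
      by (simp add: power_divide power2_eq_square power_mult_distrib)
    also have "\<dots> \<le> (N2 / N\<^sup>2) ^ card ?Z * (4 * W'\<^sup>2)"
    proof -
      have "N2 \<ge> 0" by (simp add: N2_def gauss_sum_def sum_nonneg)
      moreover have "(N ^ n / 2)\<^sup>2 \<le> W'\<^sup>2"
        using W N0 by (intro power_mono) (auto simp: W'_def N_def)
      ultimately show ?thesis by (intro mult_left_mono) auto
    qed
    finally show "(\<Sum>z\<in>T. \<Sum>z'\<in>T. w z * w z' * ?c ?Z z z') / W'\<^sup>2 \<le> 4 * (N2 / N\<^sup>2) ^ card ?Z"
      using W0 by (simp add: divide_le_eq mult_ac)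
  next
    fix S assume S: "S \<in> ?S"
    then have Sn: "S \<subseteq> {..<n}" by auto
    have "(\<Sum>z\<in>T. \<Sum>z'\<in>T. w z * w z' * ?c ({..<n} - S) z z') \<le> (\<Sum>z\<in>T. \<Sum>z'\<in>T. w z * M * ?c ({..<n} - S) z z')"
      by (intro sum_mono mult_right_mono mult_left_mono M) (auto intro: less_imp_le[OF wpos])
    also have "\<dots> = (\<Sum>z\<in>T. w z * M * (\<Sum>z'\<in>T. ?c ({..<n} - S) z z'))"
      by (simp only: sum_distrib_left)
    also have "\<dots> \<le> (\<Sum>z\<in>T. w z * M * cnt S)"
    proof (intro sum_mono mult_left_mono cnt Sn)
      fix z assume "z \<in> T"
      then have "M > 0" using M wpos less_le_trans by blast
      then show "0 \<le> w z * M" using wpos[of z] by simp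
    qed
    also have "\<dots> = W' * (M * cnt S)" by (simp add: W'_def sum_distrib_left mult_ac)
    finally show "(\<Sum>z\<in>T. \<Sum>z'\<in>T. w z * w z' * ?c ({..<n} - S) z z') / W'\<^sup>2 \<le> M / W' * cnt S"
      using W0 by (simp add: divide_le_eq power2_eq_square mult_ac)
  qed auto
  finally show ?thesis by (simp add: W'_def N_def N2_def mult_ac)
qed

section \<open>Summation over check sets and variable sets\<close>

lemma sum_Pow_power:
  fixes x :: real
  assumes "finite A"
  shows "(\<Sum>X\<in>Pow A. x ^ card X) = (1 + x) ^ card A"
  using prod_add[OF assms, of "\<lambda>_. x" "\<lambda>_. 1"] by (simp add: add.commute)

lemma power_one_plus_le_exp:
  fixes x :: real
  assumes "x \<ge> 0"
  shows "(1 + x) ^ k \<le> exp (k * x)"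
  using power_mono[of "1 + x" "exp x" k] assms exp_ge_add_one_self[of x] by (simp add: exp_of_nat_mult)

text \<open>q stands for the collision rate of one coordinate. Up to size \<theta> m, (R1) gives (p
  q^B)^|X|, and leaving out the empty set makes the binomial sum linear in m p q^B. Beyond, (R2)
  makes each of at most 2^m terms no larger than the power of p q^\<beta> with exponent \<theta>
  m.\<close>

lemma small_check_sets_sum:
  fixes q :: real
  assumes good: "good_graph n m H \<alpha> A \<beta> B \<epsilon> \<theta>" and p: "p > 0" and q: "0 < q" "q \<le> 1"
    and x1: "m * (p * q powr B) \<le> 1" and x2: "p * q powr \<beta> \<le> 1" and \<theta>: "\<theta> \<ge> 0"
  shows "(\<Sum>X | X \<subseteq> {..<m} \<and> X \<noteq> {} \<and> 2 * card X \<le> m. real p ^ card X * q ^ card (nbhd_chk n H X))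
    \<le> 2 * (m * (p * q powr B)) + 2 ^ m * (p * q powr \<beta>) powr (\<theta> * m)"
proof -
  let ?X = "{X. X \<subseteq> {..<m} \<and> X \<noteq> {} \<and> 2 * card X \<le> m}"
  define x where "x = p * q powr B"
  define y where "y = p * q powr \<beta>"
  have xy: "x > 0" "y > 0" using p q by (auto simp: x_def y_def)
  have pow_le: "real p ^ card X * q ^ card (nbhd_chk n H X) \<le> (p * q powr b) ^ card X"
    if "b * card X \<le> card (nbhd_chk n H X)" for b :: real and X
  proof -
    have "q ^ card (nbhd_chk n H X) = q powr card (nbhd_chk n H X)" using q by (simp add: powr_realpow)
    also have "\<dots> \<le> q powr (b * card X)" using that q by (intro powr_mono') auto
    also have "\<dots> = (q powr b) ^ card X" using q by (simp add: powr_powr[symmetric] powr_realpow)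
    finally show ?thesis by (simp add: power_mult_distrib mult_left_mono)
  qed
  have "(\<Sum>X\<in>?X. real p ^ card X * q ^ card (nbhd_chk n H X)) \<le> (\<Sum>X\<in>?X. x ^ card X + y powr (\<theta> * m))"
  proof (rule sum_mono)
    fix X assume X: "X \<in> ?X"
    show "real p ^ card X * q ^ card (nbhd_chk n H X) \<le> x ^ card X + y powr (\<theta> * m)"
    proof (cases "card X \<le> \<theta> * m")
      case True
      then have "B * card X \<le> card (nbhd_chk n H X)"
        using good X by (auto simp: good_graph_def)
      then have "real p ^ card X * q ^ card (nbhd_chk n H X) \<le> x ^ card X"
        unfolding x_def by (rule pow_le)
      then show ?thesis by (smt (verit) powr_ge_zero)
    next
      case False
      have "real (card X) \<le> m / 2" using X by simp
      then have "\<beta> * card X \<le> card (nbhd_chk n H X)"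
        using good X unfolding good_graph_def by blast
      then have "real p ^ card X * q ^ card (nbhd_chk n H X) \<le> y ^ card X"
        unfolding y_def by (rule pow_le)
      also have "\<dots> = y powr card X" using xy by (simp add: powr_realpow)
      also have "\<dots> \<le> y powr (\<theta> * m)" using False x2 xy by (intro powr_mono') (auto simp: y_def)
      finally show ?thesis using xy by (smt (verit) zero_le_power)
    qed
  qed
  also have "\<dots> \<le> (\<Sum>X\<in>Pow {..<m} - {{}}. x ^ card X + y powr (\<theta> * m))"
    using xy by (intro sum_mono2) (auto intro!: add_nonneg_nonneg)
  also have "\<dots> = ((1 + x) ^ m - 1) + real (card (Pow {..<m} - {{}})) * y powr (\<theta> * m)"
    using sum_Pow_power[of "{..<m}" x] by (simp add: sum.distrib sum_diff1)
  also have "\<dots> \<le> 2 * (m * x) + 2 ^ m * y powr (\<theta> * m)"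
  proof (intro add_mono mult_right_mono)
    have "(1 + x) ^ m - 1 \<le> exp (m * x) - 1" using power_one_plus_le_exp[of x m] xy by simp
    also have "\<dots> \<le> 2 * (m * x)"
    proof -
      have mx: "0 \<le> m * x" "m * x \<le> 1" using xy x1 by (auto simp: x_def)
      then have "exp (m * x) \<le> 1 + m * x + (m * x)\<^sup>2" by (rule exp_bound)
      moreover have "(m * x)\<^sup>2 \<le> m * x" using mx by (simp add: power2_eq_square mult_left_le)
      ultimately show ?thesis by linarith
    qed
    finally show "(1 + x) ^ m - 1 \<le> 2 * (m * x)" .
    have "card (Pow {..<m} - {{}}) \<le> 2 ^ m" using card_mono[of "Pow {..<m}" "Pow {..<m} - {{}}"] by (simp add: card_Pow)
    then show "real (card (Pow {..<m} - {{}})) \<le> 2 ^ m" by (metis of_nat_le_iff of_nat_numeral of_nat_power)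
  qed auto
  finally show ?thesis by (simp add: x_def y_def)
qed

text \<open>Up to size \<epsilon> n, (L1) charges p^(-A) for each variable against 2 rho + 1 choices
  of its value. Beyond, (L2) with \<alpha> >= 1 charges at least 1/p against N choices; N/p is small
  and is raised to at least \<epsilon> n, which pays for \<open>E\<close> and for the 2^n
  sets.\<close>

lemma small_variable_sets_sum:
  fixes N \<rho> E :: real
  assumes good: "good_graph n m H \<alpha> A \<beta> B \<epsilon> \<theta>" and p: "p \<ge> 1" and \<alpha>: "\<alpha> \<ge> 1"
    and N: "0 < N" "N \<le> p" and \<rho>: "\<rho> \<ge> 0" and E: "E \<ge> 1"
    and cnt: "\<And>S. S \<subseteq> {..<n} \<Longrightarrow> 0 \<le> cnt S" "\<And>S. S \<subseteq> {..<n} \<Longrightarrow> cnt S \<le> (2 * \<rho> + 1) ^ card S" "\<And>S. S \<subseteq> {..<n} \<Longrightarrow> cnt S \<le> E * N ^ card S"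
    and \<epsilon>: "\<epsilon> \<ge> 0"
  shows "(\<Sum>S | S \<subseteq> {..<n} \<and> real (card S) \<le> of_int \<lceil>real m / (2 * \<alpha>)\<rceil>. real p ^ (m - card (nbhd_var m H S)) * cnt S)
    \<le> real p ^ m * (exp (n * ((2 * \<rho> + 1) * p powr - A)) + 2 ^ n * (E * (N / p) powr (\<epsilon> * n)))"
proof -
  let ?S = "{S. S \<subseteq> {..<n} \<and> real (card S) \<le> of_int \<lceil>real m / (2 * \<alpha>)\<rceil>}"
  define x where "x = (2 * \<rho> + 1) * p powr - A"
  define y where "y = E * (N / p) powr (\<epsilon> * n)"
  have p0: "real p > 0" "real p \<ge> 1" using p by auto
  have xy: "x \<ge> 0" "y \<ge> 0" using \<rho> E by (auto simp: x_def y_def)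
  have pow_le: "real p ^ (m - card (nbhd_var m H S)) \<le> real p ^ m * (p powr - a) ^ card S"
    if "a * card S \<le> card (nbhd_var m H S)" for a :: real and S
  proof -
    have c: "card (nbhd_var m H S) \<le> m" using card_mono[OF _ nbhd_var_subset, of m H S] by simp
    have "real p ^ (m - card (nbhd_var m H S)) = real p powr (real m - card (nbhd_var m H S))"
      using p0 c by (simp add: powr_realpow[symmetric] of_nat_diff)
    also have "\<dots> \<le> p powr (m + (- a) * card S)" using that p0 by (intro powr_mono) auto
    also have "\<dots> = real p ^ m * (p powr - a) ^ card S"
      unfolding powr_add powr_powr[symmetric] using p0 by (simp add: powr_realpow)
    finally show ?thesis .
  qed
  have "(\<Sum>S\<in>?S. real p ^ (m - card (nbhd_var m H S)) * cnt S) \<le> (\<Sum>S\<in>?S. real p ^ m * (x ^ card S + y))"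
  proof (rule sum_mono)
    fix S assume S: "S \<in> ?S"
    then have Sn: "S \<subseteq> {..<n}" by auto
    show "real p ^ (m - card (nbhd_var m H S)) * cnt S \<le> real p ^ m * (x ^ card S + y)"
    proof (cases "card S \<le> \<epsilon> * n")
      case True
      then have "real (card S) \<le> of_int \<lceil>\<epsilon> * n\<rceil>" by linarith
      then have "A * card S \<le> card (nbhd_var m H S)"
        using good Sn by (auto simp: good_graph_def)
      then have "real p ^ (m - card (nbhd_var m H S)) * cnt S \<le> (real p ^ m * (p powr - A) ^ card S) * (2 * \<rho> + 1) ^ card S"
        using cnt Sn by (intro mult_mono pow_le) auto
      also have "\<dots> = real p ^ m * x ^ card S" by (simp add: x_def power_mult_distrib mult_ac)
      also have "\<dots> \<le> real p ^ m * (x ^ card S + y)" using xy by (intro mult_left_mono) auto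
      finally show ?thesis .
    next
      case False
      have "\<alpha> * card S \<le> card (nbhd_var m H S)"
        using good S unfolding good_graph_def by blast
      then have "1 * real (card S) \<le> card (nbhd_var m H S)"
        using \<alpha> mult_right_mono[of 1 \<alpha> "real (card S)"] by linarith
      then have "real p ^ (m - card (nbhd_var m H S)) * cnt S \<le> (real p ^ m * (p powr - 1) ^ card S) * (E * N ^ card S)"
        using cnt Sn by (intro mult_mono pow_le) auto
      also have "\<dots> = real p ^ m * (E * (N / p) ^ card S)"
        using p0 by (simp add: powr_minus powr_one power_divide power_inverse divide_inverse power_mult_distrib mult_ac)
      also have "(N / p) ^ card S = (N / p) powr card S" using N p0 by (simp add: powr_realpow)
      also have "real p ^ m * (E * (N / p) powr card S) \<le> real p ^ m * y"
        unfolding y_def using False N p0 E by (intro mult_left_mono powr_mono') auto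
      also have "\<dots> \<le> real p ^ m * (x ^ card S + y)" using xy by (intro mult_left_mono) auto
      finally show ?thesis .
    qed
  qed
  also have "\<dots> \<le> (\<Sum>S\<in>Pow {..<n}. real p ^ m * (x ^ card S + y))"
    using xy by (intro sum_mono2) (auto intro!: mult_nonneg_nonneg add_nonneg_nonneg)
  also have "\<dots> = real p ^ m * ((1 + x) ^ n + 2 ^ n * y)"
    using sum_Pow_power[of "{..<n}" x] by (simp add: sum_distrib_left[symmetric] sum.distrib card_Pow)
  also have "\<dots> \<le> real p ^ m * (exp (n * x) + 2 ^ n * y)"
    using power_one_plus_le_exp[OF xy(1), of n] by (intro mult_left_mono add_right_mono) auto
  finally show ?thesis by (simp add: x_def y_def)
qed

text \<open>Chernoff bound by exchanging the variance \<sigma>^2 for x \<sigma>^2: on the tail the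
  old weight is at most exp(-(x-1)n/2) times the new one, whose one-dimensional mass is about
  sqrt(x) s. The sign condition in \<open>tail\<close> treats the upper tail (x > 1) and the lower
  tail (x < 1) together.\<close>

lemma gauss_tail:
  fixes \<sigma> x s :: real
  assumes \<sigma>: "\<sigma> > 0" and x: "x > 0" and T: "T \<subseteq> int_box n k"
    and tail: "\<And>z. z \<in> T \<Longrightarrow> 0 \<le> (x - 1) * (isq n z - x * n * \<sigma>\<^sup>2)"
    and s: "s = \<sigma> * sqrt (2 * pi)"
  shows "(\<Sum>z\<in>T. gauss_weight n (1 / (2 * \<sigma>\<^sup>2)) z) \<le> (exp (- (x - 1) / 2) * (sqrt x * s + 1)) ^ n"
proof -
  define \<tau> where "\<tau> = 1 / (2 * \<sigma>\<^sup>2)"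
  have \<tau>: "\<tau> > 0" using \<sigma> by (simp add: \<tau>_def)
  have "(\<Sum>z\<in>T. gauss_weight n \<tau> z) \<le> (\<Sum>z\<in>T. exp (- (x - 1) / 2) ^ n * gauss_weight n (\<tau> / x) z)"
  proof (rule sum_mono)
    fix z assume z: "z \<in> T"
    let ?S = "\<Sum>j<n. (real_of_int (z j))\<^sup>2"
    have e: "n * (- (x - 1) / 2) - (\<tau> / x) * ?S + \<tau> * ?S = \<tau> / x * ((x - 1) * (?S - x * n * \<sigma>\<^sup>2))"
      using \<sigma> x by (simp add: \<tau>_def field_simps)
    have "0 \<le> \<tau> / x * ((x - 1) * (?S - x * n * \<sigma>\<^sup>2))"
      using \<tau> x by (intro mult_nonneg_nonneg[OF _ tail[OF z]]) auto
    then have "- \<tau> * ?S \<le> n * (- (x - 1) / 2) + (- (\<tau> / x)) * ?S" unfolding e[symmetric] by linarith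
    then have "exp (- \<tau> * ?S) \<le> exp (n * (- (x - 1) / 2) + (- (\<tau> / x)) * ?S)" by simp
    also have "\<dots> = exp (- (x - 1) / 2) ^ n * exp ((- (\<tau> / x)) * ?S)"
      by (simp only: exp_add exp_of_nat_mult)
    finally show "gauss_weight n \<tau> z \<le> exp (- (x - 1) / 2) ^ n * gauss_weight n (\<tau> / x) z"
      by (simp add: gauss_weight_def)
  qed
  also have "\<dots> \<le> (\<Sum>z\<in>int_box n k. exp (- (x - 1) / 2) ^ n * gauss_weight n (\<tau> / x) z)"
    using T by (intro sum_mono2 finite_int_box) (auto intro!: mult_nonneg_nonneg less_imp_le[OF gauss_weight_pos])
  also have "\<dots> = (exp (- (x - 1) / 2) * gauss_sum k (\<tau> / x)) ^ n"
    by (simp add: sum_distrib_left[symmetric] sum_gauss_weight power_mult_distrib)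
  also have "\<dots> \<le> (exp (- (x - 1) / 2) * (sqrt x * s + 1)) ^ n"
  proof (intro power_mono mult_left_mono)
    have "sqrt (pi / (\<tau> / x)) = sqrt x * s"
    proof -
      have "pi / (\<tau> / x) = x * (\<sigma>\<^sup>2 * (2 * pi))" using \<sigma> x by (simp add: \<tau>_def field_simps)
      then show ?thesis using \<sigma> by (simp add: s real_sqrt_mult)
    qed
    then show "gauss_sum k (\<tau> / x) \<le> sqrt x * s + 1"
      using gauss_sum_bounds(1)[of "\<tau> / x" k] \<tau> x by simp
    show "0 \<le> exp (- (x - 1) / 2) * gauss_sum k (\<tau> / x)"
      by (intro mult_nonneg_nonneg) (auto simp: gauss_sum_def intro: sum_nonneg)
  qed auto
  finally show ?thesis by (simp add: \<tau>_def)
qed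

definition typical :: "nat \<Rightarrow> nat \<Rightarrow> real \<Rightarrow> real \<Rightarrow> (nat \<Rightarrow> int) set" where
  "typical n k \<sigma> \<delta> = {z \<in> int_box n k. (1 - \<delta>) * n * \<sigma>\<^sup>2 \<le> isq n z \<and>
      isq n z \<le> (1 + \<delta>) * n * \<sigma>\<^sup>2}"

text \<open>\<open>ch\<close> bounds each of the two tails, relative to the full Gaussian mass, by
  1/4.\<close>

lemma typical_mass:
  fixes \<sigma> \<delta> s :: real
  assumes \<sigma>: "\<sigma> > 0" and \<delta>: "0 < \<delta>" "\<delta> < 1" and s: "s = \<sigma> * sqrt (2 * pi)" "s > 2"
    and N: "gauss_sum k (1 / (2 * \<sigma>\<^sup>2)) \<ge> s - 2"
    and ch: "\<And>x. x = 1 + \<delta> \<or> x = 1 - \<delta> \<Longrightarrow> (exp (- (x - 1) / 2) * (sqrt x * s + 1) / (s - 2)) ^ n \<le> 1 / 4"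
  shows "(\<Sum>z\<in>typical n k \<sigma> \<delta>. gauss_weight n (1 / (2 * \<sigma>\<^sup>2)) z) \<ge> gauss_sum k (1 / (2 * \<sigma>\<^sup>2)) ^ n / 2"
proof -
  let ?w = "gauss_weight n (1 / (2 * \<sigma>\<^sup>2))"
  let ?q = "\<lambda>z::nat \<Rightarrow> int. \<Sum>j<n. (real_of_int (z j))\<^sup>2"
  define N where "N = gauss_sum k (1 / (2 * \<sigma>\<^sup>2))"
  define T1 where "T1 = {z \<in> int_box n k. ?q z > (1 + \<delta>) * n * \<sigma>\<^sup>2}"
  define T2 where "T2 = {z \<in> int_box n k. ?q z < (1 - \<delta>) * n * \<sigma>\<^sup>2}"
  have N0: "N \<ge> s - 2" "N > 0" using N s by (auto simp: N_def)
  have tail: "sum ?w T \<le> N ^ n / 4"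
    if x: "x = 1 + \<delta> \<or> x = 1 - \<delta>" and T: "T \<subseteq> int_box n k"
      and t: "\<And>z. z \<in> T \<Longrightarrow> 0 \<le> (x - 1) * (?q z - x * n * \<sigma>\<^sup>2)" for x T
  proof -
    let ?b = "exp (- (x - 1) / 2) * (sqrt x * s + 1)"
    have "x > 0" using x \<delta> by auto
    then have "sum ?w T \<le> ?b ^ n" by (rule gauss_tail[OF \<sigma> _ T t s(1)])
    also have "\<dots> = (?b / (s - 2)) ^ n * (s - 2) ^ n" using s by (simp add: power_divide)
    also have "\<dots> \<le> 1 / 4 * N ^ n"
      using ch[OF x] s N0 by (intro mult_mono power_mono) auto
    finally show ?thesis by simp
  qed
  have fin: "finite (typical n k \<sigma> \<delta>)" "finite T1" "finite T2"
    by (auto simp: typical_def T1_def T2_def finite_int_box)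
  have "N ^ n = sum ?w (int_box n k)" by (simp add: N_def sum_gauss_weight)
  also have "\<dots> \<le> sum ?w (typical n k \<sigma> \<delta> \<union> (T1 \<union> T2))"
    using fin by (intro sum_mono2) (auto simp: typical_def T1_def T2_def intro: less_imp_le[OF gauss_weight_pos])
  also have "\<dots> \<le> sum ?w (typical n k \<sigma> \<delta>) + (sum ?w T1 + sum ?w T2)"
  proof -
    have "sum ?w (A \<union> B) \<le> sum ?w A + sum ?w B" if "finite A" "finite B" for A B
      using that sum.union_inter[of A B ?w] sum_nonneg[of "A \<inter> B" ?w] less_imp_le[OF gauss_weight_pos]
      by (simp add: add_increasing2)
    from this[of "typical n k \<sigma> \<delta>" "T1 \<union> T2"] this[of T1 T2] fin show ?thesis by simp
  qed
  also have "sum ?w T1 \<le> N ^ n / 4"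
    using \<delta> by (intro tail[of "1 + \<delta>"]) (auto simp: T1_def)
  also have "sum ?w T2 \<le> N ^ n / 4"
    using \<delta> by (intro tail[of "1 - \<delta>"]) (auto simp: T2_def intro!: mult_nonneg_nonpos)
  finally show ?thesis by (simp add: N_def)
qed

text \<open>(s + 1)/(s - 2)^2 bounds the collision rate of one coordinate, and 2
  exp(-(1-\<delta>)n/2)/(s-2)^n the largest typical weight relative to the total. The first line is
  the contribution of the check sets, the rest that of the variable sets. \<open>p\<close> is real
  so that its limit can be studied as a function.\<close>

definition excess_bound :: "nat \<Rightarrow> nat \<Rightarrow> real \<Rightarrow> real \<Rightarrow> real \<Rightarrow> real \<Rightarrow> real \<Rightarrow> real \<Rightarrow> real \<Rightarrow> real \<Rightarrow> real \<Rightarrow> real" where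
  "excess_bound n m p \<delta> A \<beta> B \<epsilon> \<theta> \<rho> s =
     4 * (2 * (m * (p * ((s + 1) / (s - 2)\<^sup>2) powr B)) + 2 ^ m * (p * ((s + 1) / (s - 2)\<^sup>2) powr \<beta>) powr (\<theta> * m))
     + p ^ m * (2 * exp (- (1 - \<delta>) * n / 2) / (s - 2) ^ n)
       * (exp (n * ((2 * \<rho> + 1) * p powr - A)) + 2 ^ n * (exp ((1 + \<delta>) * n / 2) * ((s + 1) / p) powr (\<epsilon> * n)))"

text \<open>All analytic input is an inequality for one n, which postpones every limit.
  \<open>wrap\<close> makes coordinates of typical vectors that agree mod p equal, so that touched
  checks are determined by the true support of z - z'.\<close>

lemma typical_excess:
  fixes \<sigma> \<delta> s :: real
  assumes good: "good_graph n m H \<alpha> A \<beta> B \<epsilon> \<theta>" and \<alpha>: "\<alpha> \<ge> 1" and p: "prime p"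
    and \<sigma>: "\<sigma> > 0" and \<delta>: "0 < \<delta>" "\<delta> < 1" and s: "s = \<sigma> * sqrt (2 * pi)" "s > 2"
    and \<rho>: "\<rho> = sqrt ((1 + \<delta>) * n) * \<sigma>"
    and N: "gauss_sum k (1 / (2 * \<sigma>\<^sup>2)) \<ge> s - 2"
    and ch: "\<And>x. x = 1 + \<delta> \<or> x = 1 - \<delta> \<Longrightarrow> (exp (- (x - 1) / 2) * (sqrt x * s + 1) / (s - 2)) ^ n \<le> 1 / 4"
    and wrap: "2 * \<rho> < p" and Q: "(s + 1) / (s - 2)\<^sup>2 \<le> 1" and sp: "s + 1 \<le> p"
    and x1: "m * (p * ((s + 1) / (s - 2)\<^sup>2) powr B) \<le> 1" and x2: "p * ((s + 1) / (s - 2)\<^sup>2) powr \<beta> \<le> 1"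
    and \<theta>: "\<theta> \<ge> 0" and \<epsilon>: "\<epsilon> \<ge> 0"
    and T: "T = typical n k \<sigma> \<delta>" and w: "w = gauss_weight n (1 / (2 * \<sigma>\<^sup>2))"
  shows "(\<Sum>z\<in>T. \<Sum>z'\<in>T. w z * w z' * (real p ^ (m - touched n m p H z z') - 1)) / (\<Sum>z\<in>T. w z)\<^sup>2
    \<le> excess_bound n m p \<delta> A \<beta> B \<epsilon> \<theta> \<rho> s"
proof -
  define \<tau> where "\<tau> = 1 / (2 * \<sigma>\<^sup>2)"
  define N' where "N' = gauss_sum k \<tau>"
  define Q' where "Q' = (s + 1) / (s - 2)\<^sup>2"
  define W where "W = (\<Sum>z\<in>T. w z)"
  define M where "M = exp (- (1 - \<delta>) * n / 2)"
  define E where "E = exp ((1 + \<delta>) * n / 2)"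
  have p1: "p \<ge> 1" "p > 0" using prime_ge_1_nat[OF p] by auto
  have \<tau>0: "\<tau> > 0" using \<sigma> by (simp add: \<tau>_def)
  have \<rho>0: "\<rho> \<ge> 0" and \<rho>2: "\<rho>\<^sup>2 = (1 + \<delta>) * n * \<sigma>\<^sup>2" using \<delta> \<sigma> by (auto simp: \<rho> power_mult_distrib)
  have sqrt\<tau>: "sqrt (pi / \<tau>) = s"
    using \<sigma> by (simp add: \<tau>_def s(1) real_sqrt_mult mult_ac)
  have N': "N' \<ge> s - 2" "N' > 0" "N' \<le> s + 1"
    using N s(2) gauss_sum_bounds(1)[OF \<tau>0, of k] unfolding sqrt\<tau> by (auto simp: N'_def \<tau>_def[symmetric])
  have TT: "T \<subseteq> int_box n k" by (auto simp: T typical_def)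
  have sq: "isq n z \<le> \<rho>\<^sup>2" if "z \<in> T" for z
    using that by (simp add: T typical_def \<rho>2)
  have W: "W \<ge> N' ^ n / 2"
    unfolding W_def w T N'_def \<tau>_def by (rule typical_mass[OF \<sigma> \<delta> s N ch])
  have Wpos: "W > 0"
  proof -
    have "N' ^ n / 2 > 0" using N' by simp
    then show ?thesis using W by linarith
  qed
  have wM: "w z \<le> M" if "z \<in> T" for z
  proof -
    have "\<tau> * ((1 - \<delta>) * n * \<sigma>\<^sup>2) \<le> \<tau> * isq n z"
      using that \<tau>0 by (intro mult_left_mono) (auto simp: T typical_def)
    moreover have "\<tau> * ((1 - \<delta>) * n * \<sigma>\<^sup>2) = (1 - \<delta>) * n / 2" using \<sigma> by (simp add: \<tau>_def)
    ultimately have "- \<tau> * isq n z \<le> - (1 - \<delta>) * n / 2" by linarith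
    then show ?thesis by (simp only: w M_def gauss_weight_def \<tau>_def[symmetric] exp_le_cancel_iff)
  qed
  have comp: "\<bar>real_of_int (z j)\<bar> \<le> \<rho>" if "z \<in> T" "j < n" for z j
  proof -
    have "(real_of_int (z j))\<^sup>2 \<le> isq n z"
      using that by (intro member_le_sum) auto
    then have "(real_of_int (z j))\<^sup>2 \<le> \<rho>\<^sup>2" using sq[OF that(1)] by linarith
    then show ?thesis using \<rho>0 by (metis abs_le_square_iff abs_of_nonneg)
  qed
  have nowrap: "z j = z' j" if "z \<in> T" "z' \<in> T" "j < n" "int p dvd z j - z' j" for z z' j
  proof (rule ccontr)
    assume "z j \<noteq> z' j"
    then have "int p \<le> \<bar>z j - z' j\<bar>" using that(4) dvd_imp_le_int[of "z j - z' j" "int p"] by simp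
    then have "real p \<le> \<bar>real_of_int (z j) - real_of_int (z' j)\<bar>" by linarith
    then show False using comp[OF that(1,3)] comp[OF that(2,3)] wrap by linarith
  qed
  define cnt where "cnt = (\<lambda>S::nat set. min ((2 * \<rho> + 1) ^ card S) (E * N' ^ card S))"
  have cnt: "(\<Sum>z'\<in>T. of_bool (\<forall>j\<in>{..<n} - S. z j = z' j)) \<le> cnt S" if "z \<in> T" "S \<subseteq> {..<n}" for z S
  proof -
    have "\<tau> * \<rho>\<^sup>2 = (1 + \<delta>) * n / 2" using \<sigma> by (simp add: \<rho>2 \<tau>_def)
    then have "exp (\<tau> * \<rho>\<^sup>2) = E" by (simp only: E_def)
    then show ?thesis
      using neighbour_count[OF that(2) TT sq \<rho>0 less_imp_le[OF \<tau>0], of z]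
      by (simp add: cnt_def N'_def)
  qed
  have "(\<Sum>z\<in>T. \<Sum>z'\<in>T. w z * w z' * (real p ^ (m - touched n m p H z z') - 1)) / W\<^sup>2
    \<le> (\<Sum>X | X \<subseteq> {..<m} \<and> X \<noteq> {} \<and> 2 * card X \<le> m. 4 * real p ^ card X * (gauss_sum k (2 * \<tau>) / N'\<^sup>2) ^ card (nbhd_chk n H X))
      + (\<Sum>S | S \<subseteq> {..<n} \<and> real (card S) \<le> of_int \<lceil>real m / (2 * \<alpha>)\<rceil>. real p ^ (m - card (nbhd_var m H S)) * (M / W * cnt S))"
    unfolding W_def N'_def w \<tau>_def[symmetric]
    using \<alpha> p1 N' W wM nowrap
    by (intro pair_excess_sum[OF good _ _ TT] cnt) (auto simp: W_def N'_def w \<tau>_def[symmetric])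
  also have "(\<Sum>X | X \<subseteq> {..<m} \<and> X \<noteq> {} \<and> 2 * card X \<le> m. 4 * real p ^ card X * (gauss_sum k (2 * \<tau>) / N'\<^sup>2) ^ card (nbhd_chk n H X))
     \<le> (\<Sum>X | X \<subseteq> {..<m} \<and> X \<noteq> {} \<and> 2 * card X \<le> m. 4 * (real p ^ card X * Q' ^ card (nbhd_chk n H X)))"
  proof (rule sum_mono)
    fix X
    have "gauss_sum k (2 * \<tau>) \<le> sqrt (pi / (2 * \<tau>)) + 1" using \<tau>0 by (intro gauss_sum_bounds) simp
    also have "sqrt (pi / (2 * \<tau>)) \<le> sqrt (pi / \<tau>)" using \<tau>0 by (intro real_sqrt_le_mono divide_left_mono) auto
    finally have "gauss_sum k (2 * \<tau>) \<le> s + 1" by (simp add: sqrt\<tau>)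
    then have "gauss_sum k (2 * \<tau>) / N'\<^sup>2 \<le> Q'"
      unfolding Q'_def using N' s(2) by (intro frac_le power_mono) (auto simp: gauss_sum_def sum_nonneg)
    then have "(gauss_sum k (2 * \<tau>) / N'\<^sup>2) ^ card (nbhd_chk n H X) \<le> Q' ^ card (nbhd_chk n H X)"
      by (intro power_mono) (auto simp: gauss_sum_def sum_nonneg)
    then show "4 * real p ^ card X * (gauss_sum k (2 * \<tau>) / N'\<^sup>2) ^ card (nbhd_chk n H X) \<le> 4 * (real p ^ card X * Q' ^ card (nbhd_chk n H X))"
      by (simp add: mult_left_mono)
  qed
  also have "\<dots> = 4 * (\<Sum>X | X \<subseteq> {..<m} \<and> X \<noteq> {} \<and> 2 * card X \<le> m. real p ^ card X * Q' ^ card (nbhd_chk n H X))"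
    by (rule sum_distrib_left[symmetric])
  also have "(\<Sum>X | X \<subseteq> {..<m} \<and> X \<noteq> {} \<and> 2 * card X \<le> m. real p ^ card X * Q' ^ card (nbhd_chk n H X))
     \<le> 2 * (m * (p * Q' powr B)) + 2 ^ m * (p * Q' powr \<beta>) powr (\<theta> * m)"
    using Q x1 x2 p1 s(2) \<theta> by (intro small_check_sets_sum[OF good]) (auto simp: Q'_def)
  also have "(\<Sum>S | S \<subseteq> {..<n} \<and> real (card S) \<le> of_int \<lceil>real m / (2 * \<alpha>)\<rceil>. real p ^ (m - card (nbhd_var m H S)) * (M / W * cnt S))
     = M / W * (\<Sum>S | S \<subseteq> {..<n} \<and> real (card S) \<le> of_int \<lceil>real m / (2 * \<alpha>)\<rceil>. real p ^ (m - card (nbhd_var m H S)) * cnt S)"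
    by (simp add: sum_distrib_left mult_ac)
  also have "\<dots> \<le> 2 * M / (s - 2) ^ n * (real p ^ m * (exp (n * ((2 * \<rho> + 1) * p powr - A)) + 2 ^ n * (E * ((s + 1) / p) powr (\<epsilon> * n))))"
  proof (intro mult_mono)
    have "(s - 2) ^ n / 2 \<le> N' ^ n / 2" using N' s(2) by (intro divide_right_mono power_mono) auto
    then have "(s - 2) ^ n / 2 \<le> W" using W by linarith
    then have "M / W \<le> M / ((s - 2) ^ n / 2)" using s(2) Wpos by (intro divide_left_mono) (auto simp: M_def)
    then show "M / W \<le> 2 * M / (s - 2) ^ n" by (simp add: mult.commute)
    have "(\<Sum>S | S \<subseteq> {..<n} \<and> real (card S) \<le> of_int \<lceil>real m / (2 * \<alpha>)\<rceil>. real p ^ (m - card (nbhd_var m H S)) * cnt S)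
      \<le> real p ^ m * (exp (n * ((2 * \<rho> + 1) * p powr - A)) + 2 ^ n * (E * (N' / p) powr (\<epsilon> * n)))"
      using N' sp \<delta> \<rho>0 by (intro small_variable_sets_sum[OF good p1(1) \<alpha>] \<epsilon>) (auto simp: cnt_def E_def)
    also have "\<dots> \<le> real p ^ m * (exp (n * ((2 * \<rho> + 1) * p powr - A)) + 2 ^ n * (E * ((s + 1) / p) powr (\<epsilon> * n)))"
      using N' p1 \<epsilon> by (intro mult_left_mono add_left_mono powr_mono2 divide_right_mono) (auto simp: E_def)
    finally show "(\<Sum>S | S \<subseteq> {..<n} \<and> real (card S) \<le> of_int \<lceil>real m / (2 * \<alpha>)\<rceil>. real p ^ (m - card (nbhd_var m H S)) * cnt S)
      \<le> real p ^ m * (exp (n * ((2 * \<rho> + 1) * p powr - A)) + 2 ^ n * (E * ((s + 1) / p) powr (\<epsilon> * n)))" .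
    show "0 \<le> 2 * M / (s - 2) ^ n" using s(2) by (simp add: M_def)
    have "0 \<le> cnt S" for S using \<rho>0 N' by (auto simp: cnt_def E_def)
    then show "0 \<le> (\<Sum>S | S \<subseteq> {..<n} \<and> real (card S) \<le> of_int \<lceil>real m / (2 * \<alpha>)\<rceil>. real p ^ (m - card (nbhd_var m H S)) * cnt S)"
      by (intro sum_nonneg mult_nonneg_nonneg) auto
  qed
  finally show ?thesis by (simp add: excess_bound_def W_def M_def E_def Q'_def mult_ac)
qed

section \<open>From the expected excess to a probability\<close>

lemma prob_pmf_of_set_markov:
  fixes F :: "'a \<Rightarrow> real"
  assumes S: "finite S" "S \<noteq> {}" and F: "\<And>h. h \<in> S \<Longrightarrow> 0 \<le> F h" and \<kappa>: "\<kappa> > 0"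
    and good: "\<And>h. h \<in> S \<Longrightarrow> F h \<le> \<kappa> \<Longrightarrow> P h" and E: "(\<Sum>h\<in>S. F h) / card S \<le> E"
  shows "1 - E / \<kappa> \<le> measure_pmf.prob (pmf_of_set S) {h. P h}"
proof -
  have c: "real (card S) > 0" using S by (simp add: card_gt_0_iff)
  have "\<kappa> * card {h\<in>S. \<not> P h} = (\<Sum>h\<in>{h\<in>S. \<not> P h}. \<kappa>)" by simp
  also have "\<dots> \<le> (\<Sum>h\<in>{h\<in>S. \<not> P h}. F h)" using good by (intro sum_mono) force
  also have "\<dots> \<le> (\<Sum>h\<in>S. F h)" using S F by (intro sum_mono2) auto
  also have "\<dots> \<le> E * card S" using E c by (simp add: field_simps)
  finally have "card {h\<in>S. \<not> P h} \<le> E / \<kappa> * card S" using \<kappa> by (simp add: field_simps)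
  moreover have "card S = card {h\<in>S. P h} + card {h\<in>S. \<not> P h}"
    using S by (subst card_Un_disjoint[symmetric]) (auto intro: arg_cong[where f=card])
  ultimately have "(1 - E / \<kappa>) * card S \<le> card {h\<in>S. P h}" by (simp add: algebra_simps)
  then have "1 - E / \<kappa> \<le> card {h\<in>S. P h} / card S" using c by (simp add: field_simps)
  also have "\<dots> = measure_pmf.prob (pmf_of_set S) {h. P h}"
    using S by (simp add: measure_pmf_of_set Int_def)
  finally show ?thesis .
qed

lemma lda_nsm_prob:
  fixes \<sigma> \<delta> s \<kappa> :: real
  assumes n2: "n \<ge> 2" and good: "good_graph n m H \<alpha> A \<beta> B \<epsilon> \<theta>" and \<alpha>: "\<alpha> \<ge> 1" and p: "prime p"
    and \<sigma>: "\<sigma> > 0" and \<delta>: "0 < \<delta>" "\<delta> < 1" and s: "s = \<sigma> * sqrt (2 * pi)" "s > 2"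
    and \<rho>: "\<rho> = sqrt ((1 + \<delta>) * n) * \<sigma>"
    and ch: "\<And>x. x = 1 + \<delta> \<or> x = 1 - \<delta> \<Longrightarrow> (exp (- (x - 1) / 2) * (sqrt x * s + 1) / (s - 2)) ^ n \<le> 1 / 4"
    and wrap: "2 * \<rho> < p" and Q: "(s + 1) / (s - 2)\<^sup>2 \<le> 1" and sp: "s + 1 \<le> p"
    and x1: "m * (p * ((s + 1) / (s - 2)\<^sup>2) powr B) \<le> 1" and x2: "p * ((s + 1) / (s - 2)\<^sup>2) powr \<beta> \<le> 1"
    and \<theta>: "\<theta> \<ge> 0" and \<epsilon>: "\<epsilon> \<ge> 0" and \<kappa>: "\<kappa> > 0"
  shows "1 - excess_bound n m p \<delta> A \<beta> B \<epsilon> \<theta> \<rho> s / \<kappa> \<le> measure_pmf.prob (pmf_of_set (lda_coeffs n m p))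
     {h. 1 / (2 * pi * exp 1) \<le> nsm n (lda_lattice n m p H h) \<and>
         nsm n (lda_lattice n m p H h) \<le> ((1 + \<delta>)\<^sup>2 * \<sigma>\<^sup>2 + (1 + 1 / \<delta>) + \<kappa> * (real p)\<^sup>2) * (1 + \<kappa>) / real p powr (2 * real m / real n)}"
proof -
  have n0: "0 < n" "real n > 0" and p0: "0 < p" using n2 prime_gt_0_nat[OF p] by auto
  have \<tau>0: "1 / (2 * \<sigma>\<^sup>2) > 0" using \<sigma> by simp
  have sqrt\<tau>: "sqrt (pi / (1 / (2 * \<sigma>\<^sup>2))) = s"
    using \<sigma> by (simp add: s(1) real_sqrt_mult mult_ac)
  \<comment> \<open>The box size occurs neither in the hypotheses nor in the conclusion, so it may
    be as large as the lower bound on the Gaussian sum asks for.\<close>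
  obtain k where k: "gauss_sum k (1 / (2 * \<sigma>\<^sup>2)) \<ge> s - 2"
    using gauss_sum_bounds(2)[OF \<tau>0] unfolding sqrt\<tau> by auto
  define T where "T = typical n k \<sigma> \<delta>"
  define w where "w = gauss_weight n (1 / (2 * \<sigma>\<^sup>2))"
  have finT: "finite T" by (auto simp: T_def typical_def finite_int_box)
  have "gauss_sum k (1 / (2 * \<sigma>\<^sup>2)) ^ n / 2 > 0" using k s(2) by simp
  moreover have "gauss_sum k (1 / (2 * \<sigma>\<^sup>2)) ^ n / 2 \<le> (\<Sum>z\<in>T. w z)"
    unfolding T_def w_def by (rule typical_mass[OF \<sigma> \<delta> s k ch])
  ultimately have W: "(\<Sum>z\<in>T. w z) > 0" by linarith
  define F where "F = (\<lambda>h. real p ^ m * (pair_sum (kernel n m p H h) w T) / (\<Sum>z\<in>T. w z)\<^sup>2 - 1)"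
  have ne: "lda_coeffs n m p \<noteq> {}"
    using card_lda_coeffs[of n m p] p0 by (metis card.empty less_numeral_extra(3) zero_less_power)
  have F0: "0 \<le> F h" for h
    unfolding F_def
    by (rule periodic_lattice.pair_excess_nonneg[OF periodic_lattice_kernel[OF n0(1) p0] finT W card_kernel_lower[OF n0(1) p0]])
  have bounds: "1 / (2 * pi * exp 1) \<le> nsm n (lda_lattice n m p H h) \<and>
         nsm n (lda_lattice n m p H h) \<le> ((1 + \<delta>)\<^sup>2 * \<sigma>\<^sup>2 + (1 + 1 / \<delta>) + \<kappa> * (real p)\<^sup>2) * (1 + \<kappa>) / real p powr (2 * real m / real n)"
    if Fh: "F h \<le> \<kappa>" for h
  proof -
    interpret periodic_lattice n p "kernel n m p H h" by (rule periodic_lattice_kernel[OF n0(1) p0])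
    have sq: "isq n z \<le> (1 + \<delta>) * n * \<sigma>\<^sup>2" if "z \<in> T" for z
      using that by (simp add: T_def typical_def)
    have "nsm n L \<le> ((1 + \<delta>) * ((1 + \<delta>) * n * \<sigma>\<^sup>2) / n + (1 + 1 / \<delta>) + \<kappa> * (real p)\<^sup>2) * (1 + \<kappa>) / real p powr (2 * m / n)"
      using Fh \<delta> by (intro nsm_upper_covering[OF finT W sq _ card_kernel_lower[OF n0(1) p0] _ n2]) (auto simp: F_def)
    also have "(1 + \<delta>) * ((1 + \<delta>) * n * \<sigma>\<^sup>2) / n = (1 + \<delta>)\<^sup>2 * \<sigma>\<^sup>2"
      using n0 by (simp add: power2_eq_square)
    finally show ?thesis
      using nsm_lower by (simp add: lda_lattice_eq[OF n0(1) p0])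
  qed
  have "(\<Sum>h\<in>lda_coeffs n m p. F h) / card (lda_coeffs n m p)
    \<le> (\<Sum>z\<in>T. \<Sum>z'\<in>T. w z * w z' * (real p ^ (m - touched n m p H z z') - 1)) / (\<Sum>z\<in>T. w z)\<^sup>2"
    unfolding F_def card_lda_coeffs of_nat_power
    by (rule excess_expectation[OF p finT _ W]) (simp add: w_def gauss_weight_pos less_imp_le)
  also have "\<dots> \<le> excess_bound n m p \<delta> A \<beta> B \<epsilon> \<theta> \<rho> s"
    by (rule typical_excess[OF good \<alpha> p \<sigma> \<delta> s \<rho> k ch wrap Q sp x1 x2 \<theta> \<epsilon> T_def w_def])
  finally show ?thesis
    using F0 bounds by (intro prob_pmf_of_set_markov[where F=F, OF finite_lda_coeffs ne _ \<kappa>])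
qed

section \<open>Asymptotics\<close>

lemma lda_prime_prime: "prime (lda_prime n lam)" and lda_prime_ge: "real n powr lam \<le> real (lda_prime n lam)"
proof -
  obtain q where "prime q" "nat \<lceil>real n powr lam\<rceil> < q" using bigger_prime by blast
  then have "\<exists>q. prime q \<and> real n powr lam \<le> real q" by (intro exI[of _ q]) linarith
  from LeastI_ex[OF this] show "prime (lda_prime n lam)" "real n powr lam \<le> real (lda_prime n lam)"
    by (auto simp: lda_prime_def)
qed

text \<open>Any polynomial bound would do; it is what lets powers of p be absorbed by geometric
  decay in n.\<close>

lemma lda_prime_upper:
  assumes lam: "lam > 0"
  shows "\<forall>\<^sub>F n in at_top. real (lda_prime n lam) \<le> real n powr (2 * lam + 1)"
proof -
  have "\<forall>\<^sub>F n::nat in at_top. real n powr lam \<ge> 7" using lam by real_asymp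
  moreover have "\<forall>\<^sub>F n::nat in at_top. 2 * (real n powr lam + 1)\<^sup>2 \<le> real n powr (2 * lam + 1)" using lam by real_asymp
  ultimately show ?thesis
  proof eventually_elim
    case (elim n)
    define x where "x = nat \<lceil>real n powr lam\<rceil>"
    have x: "real n powr lam \<le> x" "x \<le> real n powr lam + 1" "x \<ge> 7"
      using elim(1) unfolding x_def by linarith+
    obtain q where q: "prime q" "x \<le> q" "q \<le> 2 * x\<^sup>2" using exists_prime_between[OF x(3)] by auto
    have "real n powr lam \<le> real q" using x(1) q(2) by linarith
    then have "lda_prime n lam \<le> q" unfolding lda_prime_def using q(1) by (intro Least_le) auto
    then have "lda_prime n lam \<le> 2 * x\<^sup>2" using q(3) by linarith
    then have "real (lda_prime n lam) \<le> real (2 * x\<^sup>2)" by (simp only: of_nat_le_iff)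
    also have "\<dots> \<le> 2 * (real n powr lam + 1)\<^sup>2" using x(2) by (simp add: power_mono)
    finally show ?case using elim(2) by linarith
  qed
qed

lemma lda_prime_at_top:
  assumes lam: "lam > 0"
  shows "filterlim (\<lambda>n. real (lda_prime n lam)) at_top at_top"
proof (rule filterlim_at_top_mono)
  show "filterlim (\<lambda>n::nat. real n powr lam) at_top at_top" using lam by real_asymp
qed (simp add: lda_prime_ge)

lemma poly_times_geometric_tendsto_0:
  assumes lam: "lam > 0" and r: "0 < r" "r < 1" and a: "a \<ge> 0"
  shows "((\<lambda>n. real (lda_prime n lam) powr a * r ^ n) \<longlongrightarrow> 0) at_top"
proof (rule tendsto_sandwich[of "\<lambda>_. 0" _ _ "\<lambda>n. real n powr ((2 * lam + 1) * a) * r ^ n"])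
  show "\<forall>\<^sub>F n in at_top. real (lda_prime n lam) powr a * r ^ n \<le> real n powr ((2 * lam + 1) * a) * r ^ n"
    using lda_prime_upper[OF lam]
  proof eventually_elim
    case (elim n)
    then have "real (lda_prime n lam) powr a \<le> (real n powr (2 * lam + 1)) powr a"
      using a by (intro powr_mono2) auto
    then show ?case using r by (simp add: powr_powr)
  qed
  show "((\<lambda>n. real n powr ((2 * lam + 1) * a) * r ^ n) \<longlongrightarrow> 0) at_top"
    using r by real_asymp
qed (use r in auto)

text \<open>With s = c t^(1-R) the collision rate is at most 2/s for large t, so the product has
  order t^(a - b(1-R)).\<close>

lemma collision_rate_tendsto_0:
  fixes a b c R :: real
  assumes c: "c > 0" and R: "R < 1" and b: "b \<ge> 0" and ab: "a < b * (1 - R)"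
  shows "((\<lambda>t. t powr a * ((c * t powr (1 - R) + 1) / (c * t powr (1 - R) - 2)\<^sup>2) powr b) \<longlongrightarrow> 0) at_top"
proof (rule tendsto_sandwich[of "\<lambda>_. 0" _ _ "\<lambda>t. (2 / c) powr b * t powr (a - b * (1 - R))"])
  have "\<forall>\<^sub>F t in at_top. c * t powr (1 - R) \<ge> 8" using c R by real_asymp
  moreover have "\<forall>\<^sub>F t in at_top. t > (0::real)" by (rule eventually_gt_at_top)
  ultimately show "\<forall>\<^sub>F t in at_top. t powr a * ((c * t powr (1 - R) + 1) / (c * t powr (1 - R) - 2)\<^sup>2) powr b
      \<le> (2 / c) powr b * t powr (a - b * (1 - R))"
  proof eventually_elim
    case (elim t)
    define s where "s = c * t powr (1 - R)"
    have s: "s \<ge> 8" using elim by (simp add: s_def)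
    \<comment> \<open>This product is 2(s-2)^2 - (s+1)s, whence the threshold 8.\<close>
    have "0 \<le> (s - 1) * (s - 8)" using s by simp
    then have "(s + 1) * s \<le> 2 * (s - 2)\<^sup>2" by (simp add: power2_eq_square algebra_simps)
    then have "(s + 1) / (s - 2)\<^sup>2 \<le> 2 / s" using s by (simp add: divide_le_eq le_divide_eq field_simps)
    then have "((s + 1) / (s - 2)\<^sup>2) powr b \<le> (2 / s) powr b" using s b by (intro powr_mono2) auto
    also have "2 / s = (2 / c) * t powr (R - 1)" using elim(2) c by (simp add: s_def powr_diff)
    also have "\<dots> powr b = (2 / c) powr b * t powr ((R - 1) * b)" by (simp only: powr_mult powr_powr)
    finally have "t powr a * ((s + 1) / (s - 2)\<^sup>2) powr b \<le> t powr a * ((2 / c) powr b * t powr ((R - 1) * b))"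
      by (rule mult_left_mono) simp
    also have "\<dots> = (2 / c) powr b * t powr (a - b * (1 - R))"
      by (simp add: algebra_simps flip: powr_add)
    finally show ?case by (simp add: s_def)
  qed
  have "((\<lambda>t. t powr (a - b * (1 - R))) \<longlongrightarrow> 0) at_top"
    using ab by (intro tendsto_neg_powr filterlim_ident) simp
  then show "((\<lambda>t. (2 / c) powr b * t powr (a - b * (1 - R))) \<longlongrightarrow> 0) at_top"
    by (rule tendsto_mult_right_zero)
qed auto

text \<open>The strict form of ln x <= x - 1. The left side is the limiting base of the tail bound
  in \<open>gauss_tail\<close> relative to the mass, so both tails decay geometrically.\<close>

lemma exp_sqrt_less_1:
  fixes x :: real
  assumes "x > 0" "x \<noteq> 1"
  shows "exp (- (x - 1) / 2) * sqrt x < 1"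
proof -
  have "ln x < x - 1" using ln_le_minus_one[OF assms(1)] ln_eq_minus_one[OF assms(1)] assms(2) by fastforce
  then have "ln x / 2 < (x - 1) / 2" by simp
  then have "exp (ln x / 2) < exp ((x - 1) / 2)" by simp
  also have "exp (ln x / 2) = sqrt x" using assms by (simp add: powr_half_sqrt[symmetric] powr_def)
  finally have "exp (- (x - 1) / 2) * sqrt x < exp (- (x - 1) / 2) * exp ((x - 1) / 2)"
    by (intro mult_strict_left_mono) auto
  also have "\<dots> = 1" by (simp add: mult_exp_exp flip: add_divide_distrib)
  finally show ?thesis .
qed

lemma geometric_eventually_small:
  fixes f :: "nat \<Rightarrow> real"
  assumes f: "(f \<longlongrightarrow> l) at_top" "l < 1" and f0: "\<forall>\<^sub>F n in at_top. f n \<ge> 0" and e: "e > 0"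
  shows "\<forall>\<^sub>F n in at_top. f n ^ n \<le> e"
proof -
  obtain r where r: "max l 0 < r" "r < 1" using dense[of "max l 0" 1] f(2) by auto
  have "\<forall>\<^sub>F n in at_top. f n < r" using f(1) r by (intro order_tendstoD) auto
  moreover have "((\<lambda>n. r ^ n) \<longlongrightarrow> 0) at_top" using r by (intro LIMSEQ_power_zero) auto
  then have "\<forall>\<^sub>F n in at_top. r ^ n < e" using e by (rule order_tendstoD)
  ultimately show ?thesis using f0
  proof eventually_elim
    case (elim n)
    have "f n ^ n \<le> r ^ n" using elim by (intro power_mono) auto
    then show ?case using elim by linarith
  qed
qed

text \<open>\<open>t\<close> stands for p, \<open>c * t powr (1 - R)\<close> for the one-dimensional
  mass s, and t^(R/2) s for a bound on the shell radius, valid since n <= p^R. In the fifth claim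
  the leading exponent is 1 + R/2 - A; the seventh controls the rounding error relative to the
  scale.\<close>

lemma lattice_scale_limits:
  fixes c R x \<epsilon> A E :: real
  assumes "c > 0" "0 < R" "R < 1"
  shows "\<forall>\<^sub>F t in at_top. c * t powr (1 - R) > 8"
    and "\<forall>\<^sub>F t in at_top. c * t powr (1 - R) + 1 \<le> t"
    and "((\<lambda>t. E * (x * (c * t powr (1 - R)) + 1) / (c * t powr (1 - R) - 2)) \<longlongrightarrow> E * x) at_top"
    and "\<forall>\<^sub>F t in at_top. 2 * (t powr (R / 2) * (c * t powr (1 - R))) < t"
    and "A > 2 * (1 + R) \<Longrightarrow> \<forall>\<^sub>F t in at_top. t powr R * ((2 * (t powr (R / 2) * (c * t powr (1 - R))) + 1) * t powr - A) \<le> 1"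
    and "\<epsilon> > 0 \<Longrightarrow> E > 0 \<Longrightarrow> \<forall>\<^sub>F t in at_top. E * ((c * t powr (1 - R) + 1) / t) powr \<epsilon> \<le> 1"
    and "E > 0 \<Longrightarrow> \<forall>\<^sub>F t in at_top. x * t powr (- 2 * (1 - R)) \<le> E"
proof -
  show "\<forall>\<^sub>F t in at_top. c * t powr (1 - R) > 8" using assms by real_asymp
  show "\<forall>\<^sub>F t in at_top. c * t powr (1 - R) + 1 \<le> t" using assms by real_asymp
  show "((\<lambda>t. E * (x * (c * t powr (1 - R)) + 1) / (c * t powr (1 - R) - 2)) \<longlongrightarrow> E * x) at_top"
  proof -
    have "((\<lambda>t. E * (x * t + 1) / (t - 2)) \<longlongrightarrow> E * x) at_top" by real_asymp
    moreover have "filterlim (\<lambda>t. c * t powr (1 - R)) at_top at_top" using assms by real_asymp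
    ultimately show ?thesis by (rule filterlim_compose)
  qed
  show "\<forall>\<^sub>F t in at_top. 2 * (t powr (R / 2) * (c * t powr (1 - R))) < t" using assms by real_asymp
  show "\<forall>\<^sub>F t in at_top. t powr R * ((2 * (t powr (R / 2) * (c * t powr (1 - R))) + 1) * t powr - A) \<le> 1"
    if A: "A > 2 * (1 + R)"
  proof -
    have "((\<lambda>t. 2 * c * t powr (1 + R / 2 - A) + t powr (R - A)) \<longlongrightarrow> 2 * c * 0 + 0) at_top"
      using assms A by (intro tendsto_add tendsto_mult tendsto_const tendsto_neg_powr filterlim_ident) auto
    then have "\<forall>\<^sub>F t in at_top. 2 * c * t powr (1 + R / 2 - A) + t powr (R - A) < 1"
      by (rule order_tendstoD) simp
    then show ?thesis
    proof eventually_elim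
      case (elim t)
      have "t powr R * ((2 * (t powr (R / 2) * (c * t powr (1 - R))) + 1) * t powr - A)
          = 2 * c * (t powr R * t powr (R / 2) * t powr (1 - R) * t powr - A) + t powr R * t powr - A"
        by (simp add: algebra_simps)
      also have "\<dots> = 2 * c * t powr (1 + R / 2 - A) + t powr (R - A)"
        by (simp add: add.commute flip: powr_add)
      finally show ?case using elim by simp
    qed
  qed
  show "\<forall>\<^sub>F t in at_top. E * ((c * t powr (1 - R) + 1) / t) powr \<epsilon> \<le> 1" if \<epsilon>: "\<epsilon> > 0" and E: "E > 0"
  proof -
    have "((\<lambda>t. (c * t powr (1 - R) + 1) / t) \<longlongrightarrow> 0) at_top" using assms by real_asymp
    then have "((\<lambda>t. ((c * t powr (1 - R) + 1) / t) powr \<epsilon>) \<longlongrightarrow> 0 powr \<epsilon>) at_top"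
    proof (rule tendsto_powr')
      have "\<forall>\<^sub>F t in at_top. 0 \<le> (c * t powr (1 - R) + 1) / t"
        using eventually_gt_at_top[of "0::real"] by eventually_elim (use assms in auto)
      then show "0 \<noteq> (0::real) \<or> 0 < \<epsilon> \<and> (\<forall>\<^sub>F t in at_top. 0 \<le> (c * t powr (1 - R) + 1) / t)"
        using \<epsilon> by simp
    qed simp
    then have "((\<lambda>t. E * ((c * t powr (1 - R) + 1) / t) powr \<epsilon>) \<longlongrightarrow> E * 0) at_top"
      by (intro tendsto_mult tendsto_const) simp
    then have "\<forall>\<^sub>F t in at_top. E * ((c * t powr (1 - R) + 1) / t) powr \<epsilon> < 1" by (rule order_tendstoD) simp
    then show ?thesis by (rule eventually_mono) simp
  qed
  show "\<forall>\<^sub>F t in at_top. x * t powr (- 2 * (1 - R)) \<le> E" if "E > 0"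
  proof -
    have "((\<lambda>t. x * t powr (- 2 * (1 - R))) \<longlongrightarrow> x * 0) at_top"
      using assms by (intro tendsto_mult tendsto_const tendsto_neg_powr filterlim_ident) auto
    then have "\<forall>\<^sub>F t in at_top. x * t powr (- 2 * (1 - R)) < E" using that by (intro order_tendstoD(2)) auto
    then show ?thesis by (rule eventually_mono) simp
  qed
qed

text \<open>P^(2R) is, up to \<delta>, the inverse of the Markov threshold. The three terms come
  from small check sets, large check sets and variable sets; the exponent 1 + 3R adds this 2R, the R
  from m <= P^R and the 1 from the gain of a single untouched check.\<close>

lemma excess_bound_le:
  fixes \<delta> A \<beta> B \<epsilon> \<theta> \<rho> s P R :: real
  assumes m: "real m = n * (1 - R)" and R: "0 < R" "R < 1" and P: "P > 0" "n \<le> P powr R" and s: "s = exp (\<delta> - 1 / 2) * P powr (1 - R)" "s > 2"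
    and hA: "n * ((2 * \<rho> + 1) * P powr - A) \<le> 1"
    and h\<epsilon>: "2 * exp ((1 + \<delta>) / 2) * ((s + 1) / P) powr \<epsilon> \<le> 1"
    and hy: "2 * (P * ((s + 1) / (s - 2)\<^sup>2) powr \<beta>) powr (\<theta> * (1 - R)) \<le> 1 / 2"
    and hr: "exp (- \<delta> / 2) * (s / (s - 2)) \<le> r"
  shows "P powr (2 * R) * excess_bound n m P \<delta> A \<beta> B \<epsilon> \<theta> \<rho> s
    \<le> 8 * (P powr (1 + 3 * R) * ((s + 1) / (s - 2)\<^sup>2) powr B)
      + 4 * (P powr (2 * R) * (1 / 2) ^ n) + 8 * (P powr (2 * R) * r ^ n)"
proof -
  define Q where "Q = (s + 1) / (s - 2)\<^sup>2"
  define y where "y = (P * Q powr \<beta>) powr (\<theta> * (1 - R))"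
  have mn: "m \<le> n"
  proof -
    have "real m \<le> real n * 1" unfolding m using R by (intro mult_left_mono) auto
    then show ?thesis by simp
  qed
  have pown: "x powr (a * n) = (x powr a) ^ n" if "x > 0" for x a :: real
    using that by (simp add: powr_powr[symmetric] powr_realpow)
  have Q0: "Q > 0" using s(2) by (simp add: Q_def)
  have "m * (P * Q powr B) \<le> P powr R * (P * Q powr B)"
    using mn P by (intro mult_right_mono) auto
  also have "\<dots> = P powr (1 + R) * Q powr B" using P by (simp add: powr_add)
  finally have t1: "m * (P * Q powr B) \<le> P powr (1 + R) * Q powr B" .
  have "2 ^ m * (P * Q powr \<beta>) powr (\<theta> * m) \<le> 2 ^ n * (P * Q powr \<beta>) powr (\<theta> * m)"
    using mn by (intro mult_right_mono power_increasing) auto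
  also have "2 ^ n * (P * Q powr \<beta>) powr (\<theta> * m) = 2 ^ n * (P * Q powr \<beta>) powr ((\<theta> * (1 - R)) * n)"
    by (simp add: m mult_ac)
  also have "\<dots> = (2 * y) ^ n"
    using P(1) Q0 by (simp add: pown y_def power_mult_distrib)
  also have "\<dots> \<le> (1 / 2) ^ n" using hy by (intro power_mono) (auto simp: y_def Q_def)
  finally have t2: "2 ^ m * (P * Q powr \<beta>) powr (\<theta> * m) \<le> (1 / 2) ^ n" .
  have "P ^ m = P powr ((1 - R) * n)" using P by (simp add: powr_realpow[symmetric] m mult.commute)
  also have "\<dots> = (P powr (1 - R)) ^ n" using P(1) by (rule pown)
  also have "P powr (1 - R) = (exp (\<delta> - 1 / 2) * exp (1 / 2 - \<delta>)) * P powr (1 - R)"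
    by (simp flip: exp_add)
  also have "\<dots> = s * exp (1 / 2 - \<delta>)" by (simp add: s(1) mult_ac)
  finally have "P ^ m * (2 * exp (- (1 - \<delta>) * n / 2) / (s - 2) ^ n)
      = 2 * (s ^ n * (exp (1 / 2 - \<delta>) ^ n * exp (n * (- (1 - \<delta>) / 2))) / (s - 2) ^ n)"
    by (simp add: power_mult_distrib mult_ac)
  \<comment> \<open>The critical cancellation: P^m is s^n times e^((1/2-\<delta>)n), the largest
    weight contributes e^(-(1-\<delta>)n/2), and e^(-\<delta> n/2) is left over.\<close>
  also have "exp (1 / 2 - \<delta>) ^ n * exp (n * (- (1 - \<delta>) / 2)) = exp (- \<delta> / 2) ^ n"
    by (simp only: exp_of_nat_mult power_mult_distrib[symmetric] exp_add[symmetric]) (simp add: field_simps)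
  also have "2 * (s ^ n * exp (- \<delta> / 2) ^ n / (s - 2) ^ n) = 2 * (exp (- \<delta> / 2) * (s / (s - 2))) ^ n"
    by (simp add: power_mult_distrib power_divide mult_ac)
  also have "\<dots> \<le> 2 * r ^ n" using hr s(2) by (intro mult_left_mono power_mono) auto
  finally have t3: "P ^ m * (2 * exp (- (1 - \<delta>) * n / 2) / (s - 2) ^ n) \<le> 2 * r ^ n" .
  have t4: "exp (n * ((2 * \<rho> + 1) * P powr - A)) + 2 ^ n * (exp ((1 + \<delta>) * n / 2) * ((s + 1) / P) powr (\<epsilon> * n)) \<le> 4"
  proof -
    have "exp (n * ((2 * \<rho> + 1) * P powr - A)) \<le> exp 1" using hA by simp
    also have "\<dots> \<le> (3::real)" by (rule exp_le)
    finally have e1: "exp (n * ((2 * \<rho> + 1) * P powr - A)) \<le> 3" .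
    have "exp ((1 + \<delta>) * n / 2) = exp ((1 + \<delta>) / 2) ^ n" by (simp add: mult.commute flip: exp_of_nat_mult)
    then have "2 ^ n * (exp ((1 + \<delta>) * n / 2) * ((s + 1) / P) powr (\<epsilon> * n)) = (2 * exp ((1 + \<delta>) / 2) * ((s + 1) / P) powr \<epsilon>) ^ n"
      using P(1) s(2) by (simp add: pown power_mult_distrib mult.assoc)
    also have "\<dots> \<le> 1" using h\<epsilon> by (intro power_le_one) auto
    finally show ?thesis using e1 by linarith
  qed
  have r0: "0 \<le> r" using hr s(2) by (smt (verit) divide_nonneg_pos exp_gt_zero mult_nonneg_nonneg)
  have "excess_bound n m P \<delta> A \<beta> B \<epsilon> \<theta> \<rho> s \<le> 4 * (2 * (P powr (1 + R) * Q powr B) + (1 / 2) ^ n) + (2 * r ^ n) * 4"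
    unfolding excess_bound_def Q_def[symmetric]
  proof (rule add_mono)
    have "4 * (2 * a + b) \<le> 4 * (2 * c + d)" if "a \<le> c" "b \<le> d" for a b c d :: real
      using that by (intro mult_left_mono add_mono) auto
    from this[OF t1 t2] show "4 * (2 * (m * (P * Q powr B)) + 2 ^ m * (P * Q powr \<beta>) powr (\<theta> * m)) \<le> 4 * (2 * (P powr (1 + R) * Q powr B) + (1 / 2) ^ n)" .
  qed (rule mult_mono[OF t3 t4], use r0 in auto)
  then have "P powr (2 * R) * excess_bound n m P \<delta> A \<beta> B \<epsilon> \<theta> \<rho> s
      \<le> P powr (2 * R) * (4 * (2 * (P powr (1 + R) * Q powr B) + (1 / 2) ^ n) + (2 * r ^ n) * 4)"
    by (intro mult_left_mono) auto
  also have "\<dots> = 8 * ((P powr (2 * R) * P powr (1 + R)) * Q powr B) + 4 * (P powr (2 * R) * (1 / 2) ^ n) + 8 * (P powr (2 * R) * r ^ n)"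
    by (simp add: algebra_simps)
  also have "P powr (2 * R) * P powr (1 + R) = P powr (1 + 3 * R)" by (simp add: add.commute flip: powr_add)
  finally show ?thesis by (simp add: Q_def)
qed

text \<open>The expression dominates the upper bound on the second moment for large n; it is
  continuous in \<delta> and equals 1/(2 pi e) at 0.\<close>

lemma good_slack_exists:
  fixes \<delta>0 :: real
  assumes "\<delta>0 > 0"
  shows "\<exists>\<delta>. 0 < \<delta> \<and> \<delta> < 1 \<and> ((1 + \<delta>)\<^sup>2 * exp (2 * \<delta>) / (2 * pi * exp 1) + 2 * \<delta>) * (1 + \<delta>) < 1 / (2 * pi * exp 1) + \<delta>0"
proof -
  have "((\<lambda>\<delta>::real. ((1 + \<delta>)\<^sup>2 * exp (2 * \<delta>) / (2 * pi * exp 1) + 2 * \<delta>) * (1 + \<delta>))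
      \<longlongrightarrow> ((1 + 0)\<^sup>2 * exp (2 * 0) / (2 * pi * exp 1) + 2 * 0) * (1 + 0)) (at_right 0)"
    by (intro tendsto_intros) auto
  then have "\<forall>\<^sub>F \<delta> in at_right 0. ((1 + \<delta>)\<^sup>2 * exp (2 * \<delta>) / (2 * pi * exp 1) + 2 * \<delta>) * (1 + \<delta>) < 1 / (2 * pi * exp 1) + \<delta>0"
    using assms by (intro order_tendstoD(2)) auto
  moreover have "\<forall>\<^sub>F \<delta> in at_right 0. (0::real) < \<delta> \<and> \<delta> < 1"
    by (auto simp: eventually_at_right_field intro: exI[of _ 1])
  ultimately have "\<forall>\<^sub>F \<delta> in at_right 0. (0 < \<delta> \<and> \<delta> < 1) \<and> ((1 + \<delta>)\<^sup>2 * exp (2 * \<delta>) / (2 * pi * exp 1) + 2 * \<delta>) * (1 + \<delta>) < 1 / (2 * pi * exp 1) + \<delta>0"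
    by eventually_elim simp
  then show ?thesis using eventually_happens'[of "at_right (0::real)"] by auto
qed

text \<open>The limit runs along \<open>Ns\<close>, the block lengths at which n (1 - R) is an
  integer and a graph is given. Goodness with probability tending to 1 is expressed as convergence
  in probability of the normalised second moment to 1/(2 pi e).\<close>

theorem theorem3:
  fixes R A B \<alpha> \<beta> \<epsilon> \<theta> lam :: real
    and dV dC :: nat
    and Ns :: "nat set"
    and m :: "nat \<Rightarrow> nat"
    and Hh :: "nat \<Rightarrow> nat \<Rightarrow> nat \<Rightarrow> bool"
  assumes R: "0 < R" "R < 1"
    and deg: "0 < dV" "dV < dC" "real dV / real dC = 1 - R"
    and A: "A > 2 * (1 + R)"
    and B: "B > 2 * (1 + R) / (1 - R)"
    and alpha: "1 \<le> \<alpha>" "\<alpha> < A"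
    and beta: "1 / (1 - R) < \<beta>" "\<beta> < min (2 / (1 - R)) B"
    and eps: "\<epsilon> = (1 - R) / (A + 1 - R)"
    and theta: "\<theta> = 1 / (B * (1 - R) + 1)"
    and star: "degree_condition dV R \<alpha> A \<beta> B \<epsilon> \<theta>"
    and Ns: "infinite Ns"
    and m: "\<And>n. n \<in> Ns \<Longrightarrow> real (m n) = real n * (1 - R)"
    and reg: "\<And>n. n \<in> Ns \<Longrightarrow> biregular n (m n) (Hh n) dV dC"
    and good: "\<And>n. n \<in> Ns \<Longrightarrow> good_graph n (m n) (Hh n) \<alpha> A \<beta> B \<epsilon> \<theta>"
    and lam: "lam > Max {1 / R, 1 / (1 - R), 2 / (A - 2 * (1 + R)),
                       2 / (B * (1 - R) - 2 * (1 + R)),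
                       2 * inverse (1 - 1 / (A * B - 1) - 1 / A)}"
  shows "\<forall>\<delta>>0. ((%n. measure_pmf.prob
             (pmf_of_set (lda_coeffs n (m n) (lda_prime n lam)))
             {h. \<bar>nsm n (lda_lattice n (m n) (lda_prime n lam) (Hh n) h) - 1 / (2 * pi * exp 1)\<bar> < \<delta>})
           \<longlongrightarrow> 1) (at_top \<sqinter> principal Ns)"
proof (intro allI impI)
  let ?G = "\<lambda>n h. nsm n (lda_lattice n (m n) (lda_prime n lam) (Hh n) h)"
  let ?D = "\<lambda>n. pmf_of_set (lda_coeffs n (m n) (lda_prime n lam))"
  fix \<delta>0 :: real assume \<delta>0: "\<delta>0 > 0"
  have lamR: "lam > 1 / R" using lam by simp
  have lam0: "lam > 0" using lamR R by (meson divide_pos_pos less_trans zero_less_one)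
  have B1: "B * (1 - R) > 2 * (1 + R)" using B R by (simp add: divide_less_eq)
  have \<epsilon>0: "\<epsilon> > 0" using eps A R by (simp add: divide_pos_pos)
  have \<theta>0: "\<theta> > 0" using theta B1 R by simp
  have \<beta>1: "1 < \<beta> * (1 - R)" using beta(1) R by (simp add: divide_less_eq)
  have "0 < B * (1 - R)" by (rule less_trans[OF _ B1]) (use R in simp)
  then have B0: "B \<ge> 0" using R by (simp add: zero_less_mult_iff)
  have "1 / (1 - R) > 0" using R by simp
  then have \<beta>0: "\<beta> \<ge> 0" using beta(1) by linarith
  obtain \<delta> where \<delta>: "0 < \<delta>" "\<delta> < 1"
    and slack: "((1 + \<delta>)\<^sup>2 * exp (2 * \<delta>) / (2 * pi * exp 1) + 2 * \<delta>) * (1 + \<delta>) < 1 / (2 * pi * exp 1) + \<delta>0"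
    using good_slack_exists[OF \<delta>0] by auto
  \<comment> \<open>This makes \<sigma>^2 / p^(2(1-R)) equal to e^(2 \<delta>)/(2 pi e), slightly
    above the target.\<close>
  define c where "c = exp (\<delta> - 1 / 2)"
  \<comment> \<open>Any base strictly between e^(-\<delta>/2) and 1 absorbs the factor s/(s-2),
    which tends to 1.\<close>
  define r where "r = exp (- \<delta> / 4)"
  define P where "P = (\<lambda>n. real (lda_prime n lam))"
  define s where "s = (\<lambda>n. c * P n powr (1 - R))"
  define \<sigma> where "\<sigma> = (\<lambda>n. s n / sqrt (2 * pi))"
  define \<rho> where "\<rho> = (\<lambda>n. sqrt ((1 + \<delta>) * real n) * \<sigma> n)"
  define Q where "Q = (\<lambda>n. (s n + 1) / (s n - 2)\<^sup>2)"
  \<comment> \<open>The Markov threshold: uncovered points then contribute \<kappa> p^2 / p^(2(1-R))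
    = \<delta> to the second moment.\<close>
  define \<kappa> where "\<kappa> = (\<lambda>n. \<delta> * P n powr (- 2 * R))"
  define bd where "bd = (\<lambda>n. 8 * (P n powr (1 + 3 * R) * Q n powr B)
      + 4 * (P n powr (2 * R) * (1 / 2) ^ n) + 8 * (P n powr (2 * R) * r ^ n))"
  have c0: "c > 0" by (simp add: c_def)
  have r01: "0 < r" "r < 1" using \<delta> by (auto simp: r_def)
  have P_top: "filterlim P at_top at_top" unfolding P_def by (rule lda_prime_at_top[OF lam0])
  have P1: "P n \<ge> 1" for n using prime_ge_1_nat[OF lda_prime_prime[of n lam]] by (simp add: P_def)
  then have P0: "P n > 0" for n by (rule less_le_trans[OF zero_less_one])
  have nP: "real n \<le> P n powr R" for n
  proof (cases "n = 0")
    case False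
    have "real n powr 1 \<le> real n powr (lam * R)"
      using False lamR R by (intro powr_mono) (auto simp: field_simps)
    also have "\<dots> = (real n powr lam) powr R" by (simp add: powr_powr)
    also have "\<dots> \<le> P n powr R" using R lda_prime_ge[of n lam] by (intro powr_mono2) (auto simp: P_def)
    finally show ?thesis by simp
  qed simp
  note lim = lattice_scale_limits[OF c0 R]
  note ev = eventually_compose_filterlim[OF _ P_top]
  have Qrate: "((\<lambda>n. P n powr a * Q n powr b) \<longlongrightarrow> 0) at_top" if "b \<ge> 0" "a < b * (1 - R)" for a b
    using filterlim_compose[OF collision_rate_tendsto_0[OF c0 R(2) that] P_top] by (simp add: Q_def s_def)
  have s8: "\<forall>\<^sub>F n in at_top. s n > 8" using ev[OF lim(1)] by (simp add: s_def)
  have sP: "\<forall>\<^sub>F n in at_top. s n + 1 \<le> P n" using ev[OF lim(2)] by (simp add: s_def)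
  have wrap: "\<forall>\<^sub>F n in at_top. 2 * (P n powr (R / 2) * s n) < P n" using ev[OF lim(4)] by (simp add: s_def)
  have hA: "\<forall>\<^sub>F n in at_top. P n powr R * ((2 * (P n powr (R / 2) * s n) + 1) * P n powr - A) \<le> 1"
    using ev[OF lim(5)[OF A]] by (simp add: s_def)
  have h\<epsilon>: "\<forall>\<^sub>F n in at_top. 2 * exp ((1 + \<delta>) / 2) * ((s n + 1) / P n) powr \<epsilon> \<le> 1"
    using ev[OF lim(6)[OF \<epsilon>0, of "2 * exp ((1 + \<delta>) / 2)"]] by (simp add: s_def)
  have small: "\<forall>\<^sub>F n in at_top. (1 + 1 / \<delta>) * P n powr (- 2 * (1 - R)) \<le> \<delta>"
    using ev[OF lim(7)[OF \<delta>(1)]] by simp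
  have ratio: "((\<lambda>n. E * (x * s n + 1) / (s n - 2)) \<longlongrightarrow> E * x) at_top" for E x
    using filterlim_compose[OF lim(3)[of E x] P_top] by (simp add: s_def)
  have hr: "\<forall>\<^sub>F n in at_top. exp (- \<delta> / 2) * (s n / (s n - 2)) \<le> r"
  proof -
    have "exp (- \<delta> / 2) * 1 < r" using \<delta> by (simp add: r_def)
    then have "\<forall>\<^sub>F n in at_top. exp (- \<delta> / 2) * (1 * s n + 1) / (s n - 2) < r"
      using ratio[of "exp (- \<delta> / 2)" 1] by (intro order_tendstoD(2))
    then show ?thesis using s8
    proof eventually_elim
      case (elim n)
      have "exp (- \<delta> / 2) * (s n / (s n - 2)) \<le> exp (- \<delta> / 2) * (1 * s n + 1) / (s n - 2)"
        using elim(2) by (simp add: divide_right_mono)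
      then show ?case using elim(1) by linarith
    qed
  qed
  have ch: "\<forall>\<^sub>F n in at_top. (exp (- (x - 1) / 2) * (sqrt x * s n + 1) / (s n - 2)) ^ n \<le> 1 / 4"
    if "x > 0" "x \<noteq> 1" for x
  proof (rule geometric_eventually_small[OF ratio])
    show "exp (- (x - 1) / 2) * sqrt x < 1" using that by (rule exp_sqrt_less_1)
    show "\<forall>\<^sub>F n in at_top. 0 \<le> exp (- (x - 1) / 2) * (sqrt x * s n + 1) / (s n - 2)"
      using s8 by eventually_elim (use that in auto)
  qed simp
  have ch1: "\<forall>\<^sub>F n in at_top. (exp (- (1 + \<delta> - 1) / 2) * (sqrt (1 + \<delta>) * s n + 1) / (s n - 2)) ^ n \<le> 1 / 4"
    using \<delta> by (intro ch) auto
  have ch2: "\<forall>\<^sub>F n in at_top. (exp (- (1 - \<delta> - 1) / 2) * (sqrt (1 - \<delta>) * s n + 1) / (s n - 2)) ^ n \<le> 1 / 4"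
    using \<delta> by (intro ch) auto
  have x1: "\<forall>\<^sub>F n in at_top. P n powr (1 + R) * Q n powr B < 1"
    using B0 B1 R by (intro order_tendstoD(2)[OF Qrate]) auto
  have "((\<lambda>n. P n * Q n powr \<beta>) \<longlongrightarrow> 0) at_top"
    using Qrate[OF \<beta>0, of 1] \<beta>1 P0 by (simp add: less_imp_le)
  moreover have th: "\<theta> * (1 - R) > 0" using \<theta>0 R by simp
  ultimately have "((\<lambda>n. (P n * Q n powr \<beta>) powr (\<theta> * (1 - R))) \<longlongrightarrow> 0 powr (\<theta> * (1 - R))) at_top"
    by (intro tendsto_powr' tendsto_const) (auto intro!: always_eventually mult_nonneg_nonneg less_imp_le[OF P0])
  \<comment> \<open>1/4 leaves a factor 1/2 per dimension after the number of check sets, at most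
    2^n, is paid for.\<close>
  then have hy: "\<forall>\<^sub>F n in at_top. (P n * Q n powr \<beta>) powr (\<theta> * (1 - R)) < 1 / 4"
    by (rule order_tendstoD(2)) simp
  have x2: "\<forall>\<^sub>F n in at_top. P n * Q n powr \<beta> < 1"
    by (rule order_tendstoD(2)) (use \<open>((\<lambda>n. P n * Q n powr \<beta>) \<longlongrightarrow> 0) at_top\<close> in auto)
  have bd0: "((\<lambda>n. bd n / \<delta>) \<longlongrightarrow> 0) at_top"
  proof -
    have "(bd \<longlongrightarrow> 8 * 0 + 4 * 0 + 8 * 0) at_top"
      unfolding bd_def
    proof (intro tendsto_add tendsto_mult tendsto_const)
      \<comment> \<open>Since R < 1, 1 + 3R < 2(1 + R) < B (1 - R).\<close>
      show "((\<lambda>n. P n powr (1 + 3 * R) * Q n powr B) \<longlongrightarrow> 0) at_top" using B0 B1 R by (intro Qrate) auto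
      show "((\<lambda>n. P n powr (2 * R) * (1 / 2) ^ n) \<longlongrightarrow> 0) at_top"
        unfolding P_def using R by (intro poly_times_geometric_tendsto_0[OF lam0]) auto
      show "((\<lambda>n. P n powr (2 * R) * r ^ n) \<longlongrightarrow> 0) at_top"
        unfolding P_def using R r01 by (intro poly_times_geometric_tendsto_0[OF lam0]) auto
    qed
    then have "((\<lambda>n. bd n / \<delta>) \<longlongrightarrow> 0 / \<delta>) at_top" using \<delta> by (intro tendsto_divide tendsto_const) auto
    then show ?thesis by simp
  qed
  define pr where "pr = (\<lambda>n. measure_pmf.prob (?D n)
             {h. \<bar>?G n h - 1 / (2 * pi * exp 1)\<bar> < \<delta>0})"
  \<comment> \<open>The estimates on p and s hold for all large n; membership in \<open>Ns\<close>
    enters only through the graph, so it is kept as a premise and turned into a filter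
    afterwards.\<close>
  have "\<forall>\<^sub>F n in at_top. n \<in> Ns \<longrightarrow> 1 - bd n / \<delta> \<le> pr n"
    using eventually_ge_at_top[of "2::nat"] s8 sP wrap hA h\<epsilon> small hr ch1 ch2 x1 x2 hy
  proof eventually_elim
    case (elim n)
    show ?case
    proof
      assume n: "n \<in> Ns"
      have mle: "real (m n) \<le> P n powr R"
      proof -
        have "real (m n) \<le> real n * 1" unfolding m[OF n] using R by (intro mult_left_mono) auto
        then show ?thesis using nP[of n] by linarith
      qed
      have s2: "s n > 2" using elim by simp
      have \<sigma>0: "\<sigma> n > 0" and ss: "s n = \<sigma> n * sqrt (2 * pi)" using s2 by (auto simp: \<sigma>_def)
      have Q1: "Q n \<le> 1"
      proof -
        have "0 \<le> (s n - 5) * s n" using elim by simp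
        then have "s n + 1 \<le> (s n - 2)\<^sup>2" by (simp add: power2_eq_square algebra_simps)
        then show ?thesis using s2 by (simp add: Q_def divide_le_eq)
      qed
      have \<rho>le: "\<rho> n \<le> P n powr (R / 2) * s n"
      proof -
        have "sqrt ((1 + \<delta>) * n) * (s n / sqrt (2 * pi)) \<le> sqrt (2 * pi * P n powr R) * (s n / sqrt (2 * pi))"
        proof (intro mult_right_mono real_sqrt_le_mono)
          have "1 + \<delta> \<le> 2 * pi" using \<delta> pi_gt3 by linarith
          then show "(1 + \<delta>) * n \<le> 2 * pi * P n powr R" using nP[of n] \<delta> by (intro mult_mono) auto
        qed (use s2 in auto)
        also have "\<dots> = sqrt (P n powr R) * s n" by (simp add: real_sqrt_mult)
        also have "sqrt (P n powr R) = P n powr (R / 2)" by (simp add: powr_half_sqrt[symmetric] powr_powr)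
        finally show ?thesis by (simp add: \<rho>_def \<sigma>_def)
      qed
      have \<rho>0: "\<rho> n \<ge> 0" using \<delta> \<sigma>0 by (simp add: \<rho>_def)
      have \<kappa>0: "\<kappa> n > 0" using \<delta> P0[of n] by (simp add: \<kappa>_def)
      have \<kappa>1: "\<kappa> n \<le> \<delta>"
      proof -
        have "P n powr (- 2 * R) \<le> P n powr 0" using P1[of n] R by (intro powr_mono) auto
        then show ?thesis using \<delta> P0[of n] by (simp add: \<kappa>_def mult_left_le)
      qed
      have Aterm: "real n * ((2 * \<rho> n + 1) * P n powr - A) \<le> 1"
      proof -
        have "real n * ((2 * \<rho> n + 1) * P n powr - A) \<le> P n powr R * ((2 * (P n powr (R / 2) * s n) + 1) * P n powr - A)"
          using nP[of n] \<rho>le \<rho>0 by (intro mult_mono) auto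
        then show ?thesis using elim by linarith
      qed
      have mx: "real (m n) * (P n * Q n powr B) \<le> 1"
      proof -
        have "real (m n) * (P n * Q n powr B) \<le> P n powr R * (P n * Q n powr B)"
          using mle P0[of n] by (intro mult_right_mono) auto
        also have "\<dots> = P n powr (1 + R) * Q n powr B" using P0[of n] by (simp add: powr_add)
        finally show ?thesis using elim by linarith
      qed
      let ?E = "excess_bound n (m n) (P n) \<delta> A \<beta> B \<epsilon> \<theta> (\<rho> n) (s n)"
      have "P n powr (2 * R) * ?E \<le> bd n"
        unfolding bd_def Q_def
        using elim by (intro excess_bound_le[OF m[OF n] R P0 nP _ s2 Aterm]) (auto simp: s_def c_def Q_def)
      then have "P n powr (2 * R) * ?E / \<delta> \<le> bd n / \<delta>" using \<delta> by (intro divide_right_mono) auto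
      moreover have "P n powr (2 * R) * ?E / \<delta> = ?E / \<kappa> n"
        using P0[of n] by (simp add: \<kappa>_def powr_minus divide_inverse mult_ac)
      ultimately have "1 - bd n / \<delta> \<le> 1 - ?E / \<kappa> n" by simp
      also have "\<dots> \<le> measure_pmf.prob (?D n)
        {h. 1 / (2 * pi * exp 1) \<le> ?G n h \<and>
         ?G n h \<le> ((1 + \<delta>)\<^sup>2 * (\<sigma> n)\<^sup>2 + (1 + 1 / \<delta>) + \<kappa> n * (real (lda_prime n lam))\<^sup>2) * (1 + \<kappa> n)
            / real (lda_prime n lam) powr (2 * real (m n) / real n)}"
        unfolding P_def
      proof (rule lda_nsm_prob[OF _ good[OF n] alpha(1) lda_prime_prime \<sigma>0 \<delta> ss s2 \<rho>_def[THEN fun_cong]])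
        show "2 * \<rho> n < real (lda_prime n lam)" using \<rho>le elim by (simp add: P_def)
        show "(exp (- (x - 1) / 2) * (sqrt x * s n + 1) / (s n - 2)) ^ n \<le> 1 / 4" if "x = 1 + \<delta> \<or> x = 1 - \<delta>" for x
          using that elim by auto
      qed (use elim Q1 mx \<theta>0 \<epsilon>0 \<kappa>0 in \<open>auto simp: P_def Q_def\<close>)
      also have "\<dots> \<le> pr n"
        unfolding pr_def
      proof (intro measure_pmf.finite_measure_mono subsetI)
        fix h
        assume "h \<in> {h. 1 / (2 * pi * exp 1) \<le> ?G n h \<and>
         ?G n h \<le> ((1 + \<delta>)\<^sup>2 * (\<sigma> n)\<^sup>2 + (1 + 1 / \<delta>) + \<kappa> n * (real (lda_prime n lam))\<^sup>2) * (1 + \<kappa> n)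
            / real (lda_prime n lam) powr (2 * real (m n) / real n)}"
        then have lo: "1 / (2 * pi * exp 1) \<le> ?G n h"
          and up: "?G n h \<le> ((1 + \<delta>)\<^sup>2 * (\<sigma> n)\<^sup>2 + (1 + 1 / \<delta>) + \<kappa> n * (P n)\<^sup>2) * (1 + \<kappa> n) / P n powr (2 * real (m n) / real n)"
          by (auto simp: P_def)
        define D where "D = P n powr (2 * (1 - R))"
        have D0: "D > 0" using P0[of n] by (simp add: D_def)
        have exq: "2 * real (m n) / real n = 2 * (1 - R)" using m[OF n] elim by simp
        have \<sigma>2: "(\<sigma> n)\<^sup>2 = exp (2 * \<delta>) / (2 * pi * exp 1) * D"
        proof -
          have "(P n powr (1 - R))\<^sup>2 = D" by (simp add: D_def power2_eq_square flip: powr_add)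
          moreover have "c\<^sup>2 = exp (2 * \<delta>) / exp 1" by (simp add: c_def power2_eq_square flip: exp_add exp_diff)
          ultimately show ?thesis by (simp add: \<sigma>_def s_def power_divide power_mult_distrib)
        qed
        have \<kappa>2: "\<kappa> n * (P n)\<^sup>2 = \<delta> * D"
        proof -
          have "P n powr (- 2 * R) * (P n)\<^sup>2 = P n powr (- 2 * R) * P n powr 2" using P0[of n] by (simp add: powr_numeral)
          also have "\<dots> = D" by (simp add: D_def flip: powr_add)
          finally show ?thesis by (simp add: \<kappa>_def)
        qed
        have sm: "(1 + 1 / \<delta>) / D \<le> \<delta>"
        proof -
          have "P n powr (- 2 * (1 - R)) = 1 / D" using P0[of n] by (simp add: D_def powr_minus_divide[symmetric])
          then show ?thesis using elim(7) by simp
        qed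
        have "?G n h \<le> ((1 + \<delta>)\<^sup>2 * (exp (2 * \<delta>) / (2 * pi * exp 1) * D) + (1 + 1 / \<delta>) + \<delta> * D) * (1 + \<kappa> n) / D"
          using up unfolding exq \<sigma>2 \<kappa>2 D_def[symmetric] .
        also have "\<dots> = ((1 + \<delta>)\<^sup>2 * exp (2 * \<delta>) / (2 * pi * exp 1) + (1 + 1 / \<delta>) / D + \<delta>) * (1 + \<kappa> n)"
        proof -
          have "(a * (e * D) + b + d * D) * k / D = (a * e + b / D + d) * k" for a e b d k
            using D0 by (simp add: field_simps)
          from this[of "(1 + \<delta>)\<^sup>2" "exp (2 * \<delta>) / (2 * pi * exp 1)" "1 + 1 / \<delta>" \<delta> "1 + \<kappa> n"]
          show ?thesis by (simp only: times_divide_eq_right)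
        qed
        also have "\<dots> \<le> ((1 + \<delta>)\<^sup>2 * exp (2 * \<delta>) / (2 * pi * exp 1) + 2 * \<delta>) * (1 + \<delta>)"
          using sm \<kappa>0 \<kappa>1 \<delta> by (intro mult_mono) auto
        also have "\<dots> < 1 / (2 * pi * exp 1) + \<delta>0" by (rule slack)
        finally show "h \<in> {h. \<bar>?G n h - 1 / (2 * pi * exp 1)\<bar> < \<delta>0}"
          using lo by (simp add: abs_less_iff)
      qed auto
      finally show "1 - bd n / \<delta> \<le> pr n" .
    qed
  qed
  then have low: "\<forall>\<^sub>F n in at_top \<sqinter> principal Ns. 1 - bd n / \<delta> \<le> pr n"
    by (simp add: eventually_inf_principal)
  have "((\<lambda>n. 1 - bd n / \<delta>) \<longlongrightarrow> 1 - 0) (at_top \<sqinter> principal Ns)"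
    by (intro tendsto_diff tendsto_const tendsto_mono[OF inf_le1 bd0])
  then have "(pr \<longlongrightarrow> 1) (at_top \<sqinter> principal Ns)"
    by (intro tendsto_sandwich[OF low _ _ tendsto_const[of 1]]) (auto simp: pr_def)
  then show "((%n. measure_pmf.prob
             (?D n)
             {h. \<bar>?G n h - 1 / (2 * pi * exp 1)\<bar> < \<delta>0})
           \<longlongrightarrow> 1) (at_top \<sqinter> principal Ns)"
    by (simp add: pr_def)
qed

end
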